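(* Let $\mathcal{L}$ be a finite distributive lattice and let $\sigma$ be the cone associated to the Hibi toric variety $X_{\mathcal{L}}$. For each face $\tau$ of $\sigma$ fix a maximal chain $\Gamma$ in $D_\tau$, and let $$\mathcal{S}_{\mathcal{L}}=\{\tau \text{ a face of }\sigma : \#G_\tau(\Gamma)+\#\Gamma>\#J_{\mathcal{L}}\}.$$ Then the singular locus of $X_{\mathcal{L}}$ is $$\operatorname{Sing} X_{\mathcal{L}}=\bigcup_{\tau\in\mathcal{S}_{\mathcal{L}}}X(D_\tau).$$
   Context: $K$ is an algebraically closed field of arbitrary characteristic; points are closed points. $\mathcal{L}$ is a finite distributive lattice with join $\vee$ and meet $\wedge$. $J_{\mathcal{L}}$ is the set of join-irreducible elements, i.e. those $z\in\mathcal{L}$ such that $z=x\vee y$ implies $z=x$ or $z=y$ (so the minimal element $\hat 0$ belongs to $J_{\mathcal{L}}$). For $\alpha\in\mathcal{L}$, $I_\alpha=\{\theta\in J_{\mathcal{L}} : \theta\le\alpha\}$. The Hibi toric variety $X_{\mathcal{L}}\subset\mathbb{A}^{\#\mathcal{L}}$ is the affine variety whose vanishing ideal in $K[X_\alpha,\alpha\in\mathcal{L}]$ is the (prime) ideal generated by all $X_\alpha X_\beta-X_{\alpha\vee\beta}X_{\alpha\wedge\beta}$, $\alpha,\beta\in\mathcal{L}$. Let $T=(K^* )^{J_{\mathcal{L}}}$, $M=X(T)$ its character group with $\mathbb{Z}$-basis the coordinate characters $f_\beta$, $\beta\in J_{\mathcal{L}}$, and $N$ the $\mathbb{Z}$-dual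 of $M$. Put $f_{I_\alpha}=\sum_{z\in I_\alpha}f_z$. The map $t\mapsto (f_{I_\alpha}(t))_{\alpha\in\mathcal{L}}$ embeds $T$ as a dense open subset of $X_{\mathcal{L}}$ and makes $X_{\mathcal{L}}$ a normal affine toric variety; $\sigma\subset N\otimes\mathbb{R}$ is the strongly convex rational polyhedral cone such that $K[X_{\mathcal{L}}]$ (viewed inside $K[T]=K[M]$) equals the semigroup algebra $K[S_\sigma]$, $S_\sigma=\sigma^\vee\cap M$. A face of $\sigma$ is a cone $\tau=\sigma\cap u^\perp$ with $u\in\sigma^\vee$ (both $0$ and $\sigma$ are allowed); $\tau^\perp$ is the set of elements of $M\otimes\mathbb{R}$ vanishing on $\tau$. $P_\tau\in X_{\mathcal{L}}$ is the point whose $\alpha$-coordinate $P_\tau(\alpha)$ is $1$ if $f_{I_\alpha}\in\tau^\perp$ and $0$ otherwise. $D_\tau=\{\alpha\in\mathcal{L} : P_\tau(\alpha)\ne 0\}$; it is a sublattice of $\mathcal{L}$ (possibly empty), and $X(D_\tau)$ is the Hibi toric variety of $D_\tau$, viewed as the closed subvariety of $X_{\mathcal{L}}$ of points of $\mathbb{A}^{\#\mathcal{L}}$ whose coordinates outside $D_\tau$ vanish and whose coordinates in $D_\tau$ satisfy the defining equations for $D_\tau$. A diamond is a quadruple $(\alpha,\beta,\alpha\vee\beta,\alpha\wedge\beta)$ with $\alpha,\beta$ non-comparable; its diagonals are the pairs $\{\alpha,\beta\}$ and $\{\alpha\vee\beta,\alpha\wedge\beta\}$, and its sides are the other pairs of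 vertices, with opposite sides $\{\alpha,\alpha\vee\beta\},\{\alpha\wedge\beta,\beta\}$ and $\{\beta,\alpha\vee\beta\},\{\alpha\wedge\beta,\alpha\}$. $E_\tau$ is the set of $\alpha\in\mathcal{L}\setminus D_\tau$ for which there are $\beta\in D_\tau$ and a diamond $D$ in $\mathcal{L}$ such that $(\alpha,\beta)$ is a diagonal of $D$ and $D\cap D_\tau=\{\beta\}$. Equivalence relation on $\mathcal{L}\setminus D_\tau$: $\theta\sim\delta$ if $\theta=\delta$ or there is a sequence $\theta=\theta_1,\dots,\theta_n=\delta$ in $\mathcal{L}\setminus D_\tau$ such that each $(\theta_i,\theta_{i+1})$ is a side of a diamond in $\mathcal{L}$ whose opposite side is contained in $D_\tau$. $[\theta]$ is the class of $\theta$. $\Lambda_\tau(\Gamma)$ is the union of all maximal chains of $\mathcal{L}$ containing $\Gamma$ (equivalently, the set of elements of $\mathcal{L}$ comparable to every $\gamma\in\Gamma$). $Z_\tau(\Gamma)=\Lambda_\tau(\Gamma)\setminus(\Gamma\cup E_\tau)$, and $G_\tau(\Gamma)=\{[\theta] : \theta\in Z_\tau(\Gamma),\ [\theta]\cap E_\tau=\emptyset\}$. *)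

theory Defs
  imports
    "HOL-Analysis.Starlike"
    "HOL-Analysis.Cartesian_Euclidean_Space"
    "HOL-Computational_Algebra.Polynomial"
    "HOL-Library.Poly_Mapping"
    "HOL-Library.Extended_Nat"
begin

text \<open>
  The lattice \<open>L\<close> is the universe of a type \<open>'l\<close> of class \<open>{finite, distrib_lattice}\<close>; it is
  automatically nonempty. Points of the affine space with coordinates indexed by \<open>L\<close> are
  elements of \<open>'k ^ 'l\<close>.
\<close>


section \<open>Affine varieties and their singular points\<close>

text \<open>Polynomials over \<open>'k\<close> in the variables \<open>'x\<close>: an exponent vector is an element of \<open>'x \<Rightarrow>\<^sub>0 nat\<close>.\<close>

type_synonym ('x, 'k) mpoly = "('x \<Rightarrow>\<^sub>0 nat) \<Rightarrow>\<^sub>0 'k"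

definition mvar :: "'x \<Rightarrow> ('x, 'k::comm_ring_1) mpoly" where
  "mvar x = Poly_Mapping.single (Poly_Mapping.single x 1) 1"

text \<open>Substitution of \<open>g x\<close> for the variable \<open>x\<close>, where \<open>h\<close> embeds the coefficients.\<close>

definition msubst ::
    "('k::zero \<Rightarrow> 'a::comm_ring_1) \<Rightarrow> ('x::finite \<Rightarrow> 'a) \<Rightarrow> ('x, 'k) mpoly \<Rightarrow> 'a" where
  "msubst h g p =
     (\<Sum>m\<in>Poly_Mapping.keys p.
        h (Poly_Mapping.lookup p m) * (\<Prod>x\<in>UNIV. g x ^ Poly_Mapping.lookup m x))"

definition meval :: "('x::finite, 'k::comm_ring_1) mpoly \<Rightarrow> 'k ^ 'x \<Rightarrow> 'k" where
  "meval p a = msubst (\<lambda>c. c) (($) a) p"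

text \<open>
  Formal partial derivative. The truncated subtraction of exponents is harmless: if \<open>x\<close> does
  not occur in \<open>m\<close>, the coefficient is \<open>0\<close>.
\<close>

definition mpderiv :: "'x \<Rightarrow> ('x, 'k::comm_ring_1) mpoly \<Rightarrow> ('x, 'k) mpoly" where
  "mpderiv x p =
     (\<Sum>m\<in>Poly_Mapping.keys p.
        Poly_Mapping.single (m - Poly_Mapping.single x 1)
          (of_nat (Poly_Mapping.lookup m x) * Poly_Mapping.lookup p m))"

definition zero_locus :: "('x::finite, 'k::comm_ring_1) mpoly set \<Rightarrow> ('k ^ 'x) set" where
  "zero_locus F = {a. \<forall>f\<in>F. meval f a = 0}"

definition vanishing_ideal :: "('k::comm_ring_1 ^ 'x::finite) set \<Rightarrow> ('x, 'k) mpoly set" where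
  "vanishing_ideal V = {f. \<forall>a\<in>V. meval f a = 0}"

definition zariski_closed :: "('k::comm_ring_1 ^ 'x::finite) set \<Rightarrow> bool" where
  "zariski_closed V \<longleftrightarrow> (\<exists>F. V = zero_locus F)"

definition irreducible_closed :: "('k::comm_ring_1 ^ 'x::finite) set \<Rightarrow> bool" where
  "irreducible_closed V \<longleftrightarrow> zariski_closed V \<and> V \<noteq> {} \<and>
     (\<forall>A B. zariski_closed A \<longrightarrow> zariski_closed B \<longrightarrow> V = A \<union> B \<longrightarrow> V = A \<or> V = B)"

text \<open>Krull dimension of the Zariski topology on \<open>V\<close>.\<close>

definition variety_dim :: "('k::comm_ring_1 ^ 'x::finite) set \<Rightarrow> enat" where
  "variety_dim V =
     (SUP n\<in>{n. \<exists>Z :: nat \<Rightarrow> ('k ^ 'x) set.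
                  (\<forall>i\<le>n. irreducible_closed (Z i) \<and> Z i \<subseteq> V) \<and>
                  (\<forall>i<n. Z i \<subset> Z (Suc i))}. enat n)"

text \<open>Zariski tangent space of \<open>V\<close> at \<open>a\<close>, as a subspace of the ambient vector space.\<close>

definition tangent_space :: "('k::comm_ring_1 ^ 'x::finite) set \<Rightarrow> 'k ^ 'x \<Rightarrow> ('k ^ 'x) set" where
  "tangent_space V a =
     {v. \<forall>f\<in>vanishing_ideal V. (\<Sum>x\<in>UNIV. meval (mpderiv x f) a * v $ x) = 0}"

text \<open>
  This is the singular locus of an irreducible affine variety \<open>V\<close>, for which the local dimension
  at every point is the dimension of \<open>V\<close>.
\<close>

definition singular_locus :: "('k::field ^ 'x::finite) set \<Rightarrow> ('k ^ 'x) set" where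
  "singular_locus V = {a \<in> V. enat (vec.dim (tangent_space V a)) \<noteq> variety_dim V}"


section \<open>Hibi toric varieties\<close>

definition hibi_binomial :: "'l::lattice \<Rightarrow> 'l \<Rightarrow> ('l, 'k::comm_ring_1) mpoly" where
  "hibi_binomial \<alpha> \<beta> = mvar \<alpha> * mvar \<beta> - mvar (sup \<alpha> \<beta>) * mvar (inf \<alpha> \<beta>)"

text \<open>
  \<open>hibi_subvariety D\<close> is the Hibi toric variety of the sublattice \<open>D\<close>, placed in the coordinate
  subspace where all coordinates outside \<open>D\<close> vanish.
\<close>

definition hibi_subvariety ::
    "'l::{finite, distrib_lattice} set \<Rightarrow> ('k::comm_ring_1 ^ 'l::{finite, distrib_lattice}) set" where
  "hibi_subvariety D =
     zero_locus ({mvar \<alpha> | \<alpha>. \<alpha> \<notin> D} \<union> {hibi_binomial \<alpha> \<beta> | \<alpha> \<beta>. \<alpha> \<in> D \<and> \<beta> \<in> D})"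

definition hibi_variety :: "('k::comm_ring_1 ^ 'l::{finite, distrib_lattice}) set" where
  "hibi_variety = zero_locus {hibi_binomial \<alpha> \<beta> | \<alpha> \<beta>. True}"


section \<open>The torus and the cone\<close>

text \<open>The least element of \<open>L\<close> counts as join-irreducible.\<close>

definition join_irreducibles :: "'l::lattice set" where
  "join_irreducibles = {z. \<forall>x y. z = sup x y \<longrightarrow> z = x \<or> z = y}"

lemma join_irreducibles_nonempty:
  "\<exists>z :: 'l::{finite, lattice}. z \<in> join_irreducibles"
proof -
  obtain z :: 'l where z: "\<And>y. y \<le> z \<Longrightarrow> z = y"
    using finite_has_minimal[of "UNIV :: 'l set"] by auto
  have "z = x" if "z = sup x y" for x y
    using z[of x] that by simp
  then have "z \<in> join_irreducibles"
    by (auto simp: join_irreducibles_def)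
  then show ?thesis ..
qed

typedef (overloaded) 'l ji = "join_irreducibles :: 'l::{finite, distrib_lattice} set"
  using join_irreducibles_nonempty by blast

instance ji :: ("{finite, distrib_lattice}") finite
proof
  have "finite (range (Rep_ji :: 'a ji \<Rightarrow> 'a))"
    by simp
  then show "finite (UNIV :: 'a ji set)"
    by (rule finite_imageD) (simp add: inj_on_def Rep_ji_inject)
qed

text \<open>
  The character group \<open>M\<close> is \<open>'l ji \<Rightarrow>\<^sub>0 int\<close>, with basis \<open>f\<^sub>\<beta> = Poly_Mapping.single \<beta> 1\<close>, and the
  coordinate ring \<open>K[T] = K[M]\<close> of the torus is \<open>('l ji \<Rightarrow>\<^sub>0 int) \<Rightarrow>\<^sub>0 'k\<close>. Both \<open>M \<otimes> \<real>\<close> and \<open>N \<otimes> \<real>\<close>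
  are \<open>real ^ 'l ji\<close>, with coordinates taken in the basis \<open>f\<^sub>\<beta>\<close> and its dual basis, so that the
  pairing between them is the standard inner product.
\<close>

definition ideal_character :: "'l::{finite, distrib_lattice} \<Rightarrow> ('l ji \<Rightarrow>\<^sub>0 int)" where
  "ideal_character \<alpha> = (\<Sum>z | Rep_ji z \<le> \<alpha>. Poly_Mapping.single z 1)"

definition real_character :: "('j::finite \<Rightarrow>\<^sub>0 int) \<Rightarrow> real ^ 'j" where
  "real_character m = (\<chi> z. of_int (Poly_Mapping.lookup m z))"

text \<open>
  Pullback of polynomial functions along the embedding of the torus in the affine space; its
  range is the coordinate ring of the Hibi variety, viewed inside \<open>K[M]\<close>.
\<close>

definition torus_pullback ::
    "('l::{finite, distrib_lattice}, 'k::comm_ring_1) mpoly \<Rightarrow> (('l ji \<Rightarrow>\<^sub>0 int) \<Rightarrow>\<^sub>0 'k)" where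
  "torus_pullback =
     msubst (\<lambda>c. Poly_Mapping.single 0 c) (\<lambda>\<alpha>. Poly_Mapping.single (ideal_character \<alpha>) 1)"

definition dual_cone :: "(real ^ 'j::finite) set \<Rightarrow> (real ^ 'j) set" where
  "dual_cone \<sigma> = {u. \<forall>v\<in>\<sigma>. 0 \<le> u \<bullet> v}"

definition rational_polyhedral_cone :: "(real ^ 'j::finite) set \<Rightarrow> bool" where
  "rational_polyhedral_cone \<sigma> \<longleftrightarrow>
     (\<exists>V. finite V \<and> (\<forall>v\<in>V. \<forall>z. v $ z \<in> \<int>) \<and> \<sigma> = convex_cone hull V)"

definition strongly_convex :: "(real ^ 'j::finite) set \<Rightarrow> bool" where
  "strongly_convex \<sigma> \<longleftrightarrow> \<sigma> \<inter> uminus ` \<sigma> = {0}"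

definition cone_semigroup :: "(real ^ 'j::finite) set \<Rightarrow> ('j \<Rightarrow>\<^sub>0 int) set" where
  "cone_semigroup \<sigma> = {m. real_character m \<in> dual_cone \<sigma>}"

definition semigroup_algebra :: "'m set \<Rightarrow> ('m \<Rightarrow>\<^sub>0 'k::zero) set" where
  "semigroup_algebra S = {q. Poly_Mapping.keys q \<subseteq> S}"

text \<open>
  The defining property of the cone of the Hibi variety over the field \<open>'k\<close>; the field is passed
  as a type argument because it does not occur in the type of \<open>\<sigma>\<close>.
\<close>

definition is_hibi_cone ::
    "'k::comm_ring_1 itself \<Rightarrow> (real ^ ('l::{finite, distrib_lattice}) ji) set \<Rightarrow> bool" where
  "is_hibi_cone _ \<sigma> \<longleftrightarrow>
     rational_polyhedral_cone \<sigma> \<and> strongly_convex \<sigma> \<and>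
     range (torus_pullback :: ('l, 'k) mpoly \<Rightarrow> _) = semigroup_algebra (cone_semigroup \<sigma>)"

definition is_cone_face :: "(real ^ 'j::finite) set \<Rightarrow> (real ^ 'j) set \<Rightarrow> bool" where
  "is_cone_face \<tau> \<sigma> \<longleftrightarrow> (\<exists>u\<in>dual_cone \<sigma>. \<tau> = {v \<in> \<sigma>. u \<bullet> v = 0})"

definition face_point ::
    "(real ^ ('l::{finite, distrib_lattice}) ji) set \<Rightarrow>
      'k::zero_neq_one ^ 'l::{finite, distrib_lattice}" where
  "face_point \<tau> = (\<chi> \<alpha>. if real_character (ideal_character \<alpha>) \<in> \<tau>\<^sup>\<bottom> then 1 else 0)"

text \<open>
  The set \<open>D\<^sub>\<tau>\<close> does not depend on the field, so it is defined without the distinguished point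
  \<open>P\<^sub>\<tau>\<close>; the lemma says that it is the set of nonvanishing coordinates of that point.
\<close>

definition face_sublattice ::
    "(real ^ ('l::{finite, distrib_lattice}) ji) set \<Rightarrow> 'l set" where
  "face_sublattice \<tau> = {\<alpha>. real_character (ideal_character \<alpha>) \<in> \<tau>\<^sup>\<bottom>}"

lemma face_sublattice_eq_support:
  "face_sublattice \<tau> = {\<alpha>. (face_point \<tau> :: 'k::zero_neq_one ^ 'l::{finite, distrib_lattice}) $ \<alpha> \<noteq> 0}"
  by (auto simp: face_sublattice_def face_point_def)


section \<open>Diamonds\<close>

definition noncomparable :: "'l::order \<Rightarrow> 'l \<Rightarrow> bool" where
  "noncomparable x y \<longleftrightarrow> \<not> x \<le> y \<and> \<not> y \<le> x"

definition diamond_vertices :: "'l::lattice \<Rightarrow> 'l \<Rightarrow> 'l set" where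
  "diamond_vertices x y = {x, y, sup x y, inf x y}"

definition diamond_diagonals :: "'l::lattice \<Rightarrow> 'l \<Rightarrow> 'l set set" where
  "diamond_diagonals x y = {{x, y}, {sup x y, inf x y}}"

text \<open>Ordered pairs consisting of a side and its opposite side.\<close>

definition diamond_opposite_sides :: "'l::lattice \<Rightarrow> 'l \<Rightarrow> ('l set \<times> 'l set) set" where
  "diamond_opposite_sides x y =
     {({x, sup x y}, {inf x y, y}), ({inf x y, y}, {x, sup x y}),
      ({y, sup x y}, {inf x y, x}), ({inf x y, x}, {y, sup x y})}"

definition E_set :: "'l::lattice set \<Rightarrow> 'l set" where
  "E_set D = {\<alpha>. \<alpha> \<notin> D \<and>
     (\<exists>\<beta>\<in>D. \<exists>x y. noncomparable x y \<and> {\<alpha>, \<beta>} \<in> diamond_diagonals x y \<and>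
                    diamond_vertices x y \<inter> D = {\<beta>})}"

definition side_step :: "'l::lattice set \<Rightarrow> 'l \<Rightarrow> 'l \<Rightarrow> bool" where
  "side_step D \<theta> \<delta> \<longleftrightarrow> \<theta> \<notin> D \<and> \<delta> \<notin> D \<and>
     (\<exists>x y t. noncomparable x y \<and> ({\<theta>, \<delta>}, t) \<in> diamond_opposite_sides x y \<and> t \<subseteq> D)"

text \<open>The equivalence class of an element \<open>\<theta>\<close> outside \<open>D\<close>.\<close>

definition side_class :: "'l::lattice set \<Rightarrow> 'l \<Rightarrow> 'l set" where
  "side_class D \<theta> = {\<delta>. (side_step D)\<^sup>*\<^sup>* \<theta> \<delta>}"

abbreviation maximal_chain_in :: "'l::order set \<Rightarrow> 'l set \<Rightarrow> bool" where
  "maximal_chain_in A C \<equiv> pred_on.maxchain A (<) C"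

definition Lambda_set :: "'l::order set \<Rightarrow> 'l set" where
  "Lambda_set \<Gamma> = \<Union> {C. maximal_chain_in UNIV C \<and> \<Gamma> \<subseteq> C}"

definition Z_set :: "'l::lattice set \<Rightarrow> 'l set \<Rightarrow> 'l set" where
  "Z_set D \<Gamma> = Lambda_set \<Gamma> - (\<Gamma> \<union> E_set D)"

text \<open>
  For a maximal chain \<open>\<Gamma>\<close> in \<open>D\<close>, the elements of \<open>Z_set D \<Gamma>\<close> lie outside \<open>D\<close>, so that their
  classes are meaningful.
\<close>

definition G_set :: "'l::lattice set \<Rightarrow> 'l set \<Rightarrow> 'l set set" where
  "G_set D \<Gamma> = {side_class D \<theta> | \<theta>. \<theta> \<in> Z_set D \<Gamma> \<and> side_class D \<theta> \<inter> E_set D = {}}"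

end

theory Submission
  imports
    Defs
    "HOL-Analysis.Determinants"
    "HOL-Analysis.Polytope"
    "HOL-Library.Multiset"
begin

text \<open>
  The singular points are found by computing the tangent space at every point and comparing its
  dimension with that of the variety. Throughout, a subset \<open>D\<close> of the lattice is called embedded if
  for all \<open>x\<close> and \<open>y\<close> both lie in \<open>D\<close> exactly if their join and meet do; these are the supports of
  the points of the Hibi variety.

  The tool behind all steps is a fact about monomials. The weight of a monomial is the exponent
  vector of its pullback to the torus, the sum of the indicators of the order ideals of its factors.
  If a function on the lattice with values in a commutative monoid respects the Hibi relations
  \<open>x y = (x \<squnion> y) (x \<sqinter> y)\<close>, then its value on a monomial depends only on the weight
  (\<open>monomial_value_eq_of_weight_eq\<close>), because the relations allow one to split off the join of all
  factors, and the weight determines this join. Applied to points of the variety it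
  shows that a polynomial which vanishes on a torus orbit vanishes on the closed subvariety of its
  support (\<open>orbit_dense\<close>), and applied to dual numbers that the tangent space is given by the
  linearised Hibi equations alone (\<open>tangent_space_hibi_variety\<close>).

  At a point with support \<open>D\<close> these equations decouple. Inside \<open>D\<close> they define modular functions,
  which correspond to arbitrary values on a maximal chain; outside \<open>D\<close> they make the solution,
  up to scaling by the torus, constant on the classes of the side relation and zero on the classes
  that meet \<open>E_set D\<close>. So the dimension is the number in the theorem
  (\<open>tangent_coordinates\<close>), where the elements comparable to the chain suffice to find
  all classes that avoid \<open>E_set D\<close> (\<open>side_class_meets_Z_set\<close>). By semicontinuity the dimension can only grow on the closure
  of the orbit (\<open>tangent_dim_on_orbit_closure\<close>), and it is nowhere below the number of
  join-irreducible elements, which is its value on the open orbit (\<open>tangent_dim_ge_card_ji\<close>).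

  The dimension of the variety is the number of join-irreducible elements
  (\<open>variety_dim_hibi_variety\<close>). For the upper bound, a chain of \<open>n + 1\<close> irreducible closed
  subsets yields \<open>n\<close> algebraically independent functions, whose monomials would outnumber the weights
  if \<open>n\<close> exceeded this number. For the lower bound there are the closures of subtori.

  Finally, the sets \<open>face_sublattice \<tau>\<close> are exactly the embedded subsets
  (\<open>face_sublattice_embedded\<close>, \<open>embedded_sublattice_is_face_sublattice\<close>), since the cone is the dual of
  the ideal characters (\<open>hibi_cone_eq\<close>). So the supports of the points and the faces correspond
  to each other, and the singular points are those at which the dimension count exceeds the number
  of join-irreducible elements.
\<close>


section \<open>Polynomial functions over an infinite field\<close>

lemma infinite_UNIV_alg_closed: "infinite (UNIV :: 'k::alg_closed_field set)"
proof
  assume fin: "finite (UNIV :: 'k set)"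
  (* a polynomial without roots, in the manner of Euclid *)
  define p :: "'k poly" where "p = (\<Prod>c\<in>UNIV. [:- c, 1:]) + 1"
  have "degree (\<Prod>c\<in>(UNIV :: 'k set). [:- c, 1:]) = card (UNIV :: 'k set)"
    by (subst degree_prod_eq_sum_degree) auto
  moreover have "card (UNIV :: 'k set) > 0"
    using fin by (simp add: card_gt_0_iff)
  ultimately have "degree p > 0"
    unfolding p_def by (subst degree_add_eq_left) auto
  then obtain x where "poly p x = 0"
    using alg_closed_imp_poly_has_root by blast
  moreover have "poly (\<Prod>c\<in>(UNIV :: 'k set). [:- c, 1:]) x = 0"
    using fin by (auto simp: poly_prod)
  ultimately show False
    by (simp add: p_def)
qed

definition monomial_value :: "('x::finite \<Rightarrow> 'a::comm_monoid_mult) \<Rightarrow> ('x \<Rightarrow>\<^sub>0 nat) \<Rightarrow> 'a" where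
  "monomial_value g m = (\<Prod>x\<in>UNIV. g x ^ Poly_Mapping.lookup m x)"

lemma monomial_value_add: "monomial_value g (m + n) = monomial_value g m * monomial_value g n"
  by (simp add: monomial_value_def lookup_add power_add prod.distrib)

lemma monomial_value_zero [simp]: "monomial_value g 0 = 1"
  by (simp add: monomial_value_def)

lemma monomial_value_single:
  "monomial_value g (Poly_Mapping.single x 1) = g x"
proof -
  have "monomial_value g (Poly_Mapping.single x 1) = (\<Prod>y\<in>UNIV. if y = x then g y else 1)"
    unfolding monomial_value_def by (intro prod.cong) (auto simp: lookup_single when_def)
  also have "\<dots> = g x"
    by simp
  finally show ?thesis .
qed

lemma meval_eq: "meval p a = (\<Sum>m\<in>Poly_Mapping.keys p. Poly_Mapping.lookup p m * monomial_value (($) a) m)"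
  by (simp add: meval_def msubst_def monomial_value_def)

lemma meval_superset:
  assumes "finite A" "Poly_Mapping.keys p \<subseteq> A"
  shows "meval p a = (\<Sum>m\<in>A. Poly_Mapping.lookup p m * monomial_value (($) a) m)"
  unfolding meval_eq using assms
  by (intro sum.mono_neutral_left) (auto simp: in_keys_iff)

lemma meval_zero [simp]: "meval 0 a = 0"
  by (simp add: meval_eq)

lemma meval_add: "meval (p + q) a = meval p a + meval q a"
proof -
  let ?A = "Poly_Mapping.keys p \<union> Poly_Mapping.keys q"
  have "Poly_Mapping.keys (p + q) \<subseteq> ?A"
    by (rule keys_add)
  then show ?thesis
    by (subst (1 2 3) meval_superset[of ?A]) (auto simp: lookup_add algebra_simps sum.distrib)
qed

lemma meval_uminus: "meval (- p) a = - meval p a"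
  using meval_add[of p "- p" a] by (simp add: add_eq_0_iff)

lemma meval_diff: "meval (p - q) a = meval p a - meval q a"
  using meval_add[of p "- q" a] by (simp add: meval_uminus)

lemma meval_sum: "meval (\<Sum>i\<in>I. p i) a = (\<Sum>i\<in>I. meval (p i) a)"
  by (induction I rule: infinite_finite_induct) (auto simp: meval_add)

lemma meval_single: "meval (Poly_Mapping.single m c) a = c * monomial_value (($) a) m"
  by (subst meval_superset[of "{m}"]) auto

lemma poly_mapping_eq_sum_single:
  "p = (\<Sum>m\<in>Poly_Mapping.keys p. Poly_Mapping.single m (Poly_Mapping.lookup p m))"
proof (rule poly_mapping_eqI)
  fix k
  have "(\<Sum>m\<in>Poly_Mapping.keys p. Poly_Mapping.lookup p m when m = k)
      = (\<Sum>m\<in>Poly_Mapping.keys p. if m = k then Poly_Mapping.lookup p k else 0)"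
    by (intro sum.cong) (auto simp: when_def)
  also have "\<dots> = Poly_Mapping.lookup p k"
    by (auto simp: sum.delta in_keys_iff)
  finally show "Poly_Mapping.lookup p k =
      Poly_Mapping.lookup (\<Sum>m\<in>Poly_Mapping.keys p. Poly_Mapping.single m (Poly_Mapping.lookup p m)) k"
    by (simp add: lookup_sum lookup_single)
qed

lemma meval_mult: "meval (p * q) a = meval p a * meval q a"
proof -
  let ?s = "\<lambda>p. \<Sum>m\<in>Poly_Mapping.keys p. Poly_Mapping.single m (Poly_Mapping.lookup p m)"
  have "p * q = ?s p * ?s q"
    using poly_mapping_eq_sum_single[of p] poly_mapping_eq_sum_single[of q] by simp
  also have "\<dots> = (\<Sum>m\<in>Poly_Mapping.keys p. \<Sum>n\<in>Poly_Mapping.keys q.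
      Poly_Mapping.single (m + n) (Poly_Mapping.lookup p m * Poly_Mapping.lookup q n))"
    by (simp add: sum_product mult_single)
  finally show ?thesis
    by (simp add: meval_sum meval_single meval_eq[of p] meval_eq[of q] sum_product
        monomial_value_add mult_ac)
qed

lemma meval_one [simp]: "meval 1 a = 1"
  using meval_single[of 0 1 a] by simp

lemma meval_mvar [simp]: "meval (mvar x) a = a $ x"
  using monomial_value_single[of "($) a" x] by (simp add: mvar_def meval_single)

lemma meval_power: "meval (p ^ n) a = meval p a ^ n"
  by (induction n) (auto simp: meval_mult)

lemma meval_hibi_binomial:
  "meval (hibi_binomial x y) a = a $ x * a $ y - a $ sup x y * a $ inf x y"
  by (simp add: hibi_binomial_def meval_diff meval_mult)

definition polynomial_function :: "('k::comm_ring_1 ^ 'x::finite \<Rightarrow> 'k) \<Rightarrow> bool" where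
  "polynomial_function f \<longleftrightarrow> (\<exists>p. \<forall>a. f a = meval p a)"

lemma polynomial_function_const: "polynomial_function (\<lambda>a. c)"
  unfolding polynomial_function_def
  by (rule exI[of _ "Poly_Mapping.single 0 c"]) (simp add: meval_single)

lemma polynomial_function_coordinate: "polynomial_function (\<lambda>a. a $ x)"
  unfolding polynomial_function_def by (rule exI[of _ "mvar x"]) simp

lemma polynomial_function_add:
  "polynomial_function f \<Longrightarrow> polynomial_function g \<Longrightarrow> polynomial_function (\<lambda>a. f a + g a)"
  unfolding polynomial_function_def using meval_add by metis

lemma polynomial_function_mult:
  "polynomial_function f \<Longrightarrow> polynomial_function g \<Longrightarrow> polynomial_function (\<lambda>a. f a * g a)"
  unfolding polynomial_function_def using meval_mult by metis

lemma polynomial_function_uminus: "polynomial_function f \<Longrightarrow> polynomial_function (\<lambda>a. - f a)"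
  unfolding polynomial_function_def using meval_uminus by metis

lemma polynomial_function_sum:
  "(\<And>i. i \<in> I \<Longrightarrow> polynomial_function (f i)) \<Longrightarrow> polynomial_function (\<lambda>a. \<Sum>i\<in>I. f i a)"
  by (induction I rule: infinite_finite_induct)
     (auto intro: polynomial_function_const polynomial_function_add)

lemma polynomial_function_prod:
  "(\<And>i. i \<in> I \<Longrightarrow> polynomial_function (f i)) \<Longrightarrow> polynomial_function (\<lambda>a. \<Prod>i\<in>I. f i a)"
  by (induction I rule: infinite_finite_induct)
     (auto intro: polynomial_function_const polynomial_function_mult)

lemma univariate_coefficients_vanish:
  fixes b :: "nat \<Rightarrow> 'k::alg_closed_field"
  assumes fin: "finite E" and zero: "\<And>s. s \<noteq> 0 \<Longrightarrow> (\<Sum>e\<in>E. b e * s ^ e) = 0" and "e \<in> E"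
  shows "b e = 0"
proof -
  define p where "p = (\<Sum>e\<in>E. monom (b e) e)"
  have "poly p s = 0" if "s \<noteq> 0" for s
    using zero[OF that] by (simp add: p_def poly_sum poly_monom)
  then have "UNIV - {0} \<subseteq> {s. poly p s = 0}"
    by auto
  moreover have "infinite (UNIV - {0 :: 'k})"
    using infinite_UNIV_alg_closed by simp
  ultimately have "p = 0"
    using poly_roots_finite finite_subset by blast
  moreover have "coeff p e = b e"
    using fin \<open>e \<in> E\<close> by (simp add: p_def coeff_sum)
  ultimately show ?thesis
    by simp
qed

text \<open>
  Linear independence of the characters of a torus. In each parameter in turn the relation is a
  polynomial with infinitely many roots; comparing its coefficients splits the relation according
  to the exponent of that parameter.
\<close>
lemma torus_monomials_independent_on:
  fixes c :: "('j \<Rightarrow> nat) \<Rightarrow> 'k::alg_closed_field"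
  assumes "finite S" "finite W"
    and "\<And>t. (\<And>z. t z \<noteq> 0) \<Longrightarrow> (\<Sum>w\<in>W. c w * (\<Prod>z\<in>S. t z ^ w z)) = 0"
  shows "(\<Sum>w | w \<in> W \<and> (\<forall>z\<in>S. w z = w0 z). c w) = 0"
  using assms
proof (induction S arbitrary: W rule: finite_induct)
  case empty
  then show ?case
    using empty(2)[of "\<lambda>_. 1"] by simp
next
  case (insert x S)
  let ?W = "{w \<in> W. w x = w0 x}"
  have "(\<Sum>w\<in>?W. c w * (\<Prod>z\<in>S. t z ^ w z)) = 0" if t: "\<And>z. t z \<noteq> 0" for t
  proof -
    define b where "b e = (\<Sum>w | w \<in> W \<and> w x = e. c w * (\<Prod>z\<in>S. t z ^ w z))" for e
    have "(\<Sum>e\<in>(\<lambda>w. w x) ` W. b e * s ^ e) = 0" if "s \<noteq> 0" for s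
    proof -
      have "(\<Sum>e\<in>(\<lambda>w. w x) ` W. b e * s ^ e)
          = (\<Sum>e\<in>(\<lambda>w. w x) ` W. \<Sum>w | w \<in> W \<and> w x = e. c w * (\<Prod>z\<in>S. t z ^ w z) * s ^ w x)"
        unfolding b_def sum_distrib_right by (intro sum.cong) auto
      also have "\<dots> = (\<Sum>w\<in>W. c w * (\<Prod>z\<in>S. t z ^ w z) * s ^ w x)"
        using insert.prems(1) by (intro sum.group) auto
      also have "\<dots> = (\<Sum>w\<in>W. c w * (\<Prod>z\<in>insert x S. (t(x := s)) z ^ w z))"
      proof (intro sum.cong refl)
        fix w
        have "(\<Prod>z\<in>S. (t(x := s)) z ^ w z) = (\<Prod>z\<in>S. t z ^ w z)"
          using insert.hyps by (intro prod.cong) auto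
        then show "c w * (\<Prod>z\<in>S. t z ^ w z) * s ^ w x
            = c w * (\<Prod>z\<in>insert x S. (t(x := s)) z ^ w z)"
          using insert.hyps by simp
      qed
      also have "\<dots> = 0"
        using t that by (intro insert.prems(2)) auto
      finally show ?thesis .
    qed
    then have "b e = 0" if "e \<in> (\<lambda>w. w x) ` W" for e
      using univariate_coefficients_vanish[of "(\<lambda>w. w x) ` W" b e] insert.prems(1) that by blast
    moreover have "b (w0 x) = 0" if "w0 x \<notin> (\<lambda>w. w x) ` W"
    proof -
      have empty: "{w \<in> W. w x = w0 x} = {}"
        using that by (auto simp: image_iff)
      show ?thesis
        unfolding b_def empty by simp
    qed
    ultimately have "b (w0 x) = 0"
      by blast
    then show ?thesis
      by (simp add: b_def)
  qed
  then have "(\<Sum>w | w \<in> ?W \<and> (\<forall>z\<in>S. w z = w0 z). c w) = 0"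
    using insert.IH[of ?W] insert.prems(1) by simp
  moreover have "{w \<in> ?W. \<forall>z\<in>S. w z = w0 z} = {w \<in> W. \<forall>z\<in>insert x S. w z = w0 z}"
    by auto
  ultimately show ?case
    by simp
qed

lemma torus_monomials_independent:
  fixes c :: "('j::finite \<Rightarrow> nat) \<Rightarrow> 'k::alg_closed_field"
  assumes "finite W" "\<And>t. (\<And>z. t z \<noteq> 0) \<Longrightarrow> (\<Sum>w\<in>W. c w * (\<Prod>z\<in>UNIV. t z ^ w z)) = 0" "w \<in> W"
  shows "c w = 0"
proof -
  have "(\<Sum>u | u \<in> W \<and> (\<forall>z\<in>UNIV. u z = w z). c u) = 0"
    using assms by (intro torus_monomials_independent_on) auto
  moreover have "{u \<in> W. \<forall>z\<in>UNIV. u z = w z} = {w}"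
    using assms(3) by auto
  ultimately show ?thesis
    by simp
qed

section \<open>Homogeneous linear systems\<close>

lemma homogeneous_system_solution:
  fixes A :: "'w \<Rightarrow> 'i \<Rightarrow> 'k::field"
  assumes "finite W" "finite I" "card W < card I"
  shows "\<exists>c. (\<exists>i\<in>I. c i \<noteq> 0) \<and> (\<forall>w\<in>W. (\<Sum>i\<in>I. A w i * c i) = 0)"
  using assms
proof (induction W arbitrary: I A rule: finite_induct)
  case empty
  then obtain i where "i \<in> I"
    by (metis card.empty card_gt_0_iff ex_in_conv)
  then show ?case
    by (intro exI[of _ "\<lambda>_. 1"]) auto
next
  case (insert w W)
  show ?case
  proof (cases "\<forall>i\<in>I. A w i = 0")
    case True
    moreover obtain c where "\<exists>i\<in>I. c i \<noteq> 0" "\<forall>w\<in>W. (\<Sum>i\<in>I. A w i * c i) = 0"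
      using insert.IH[of I A] insert.prems insert.hyps by auto
    ultimately show ?thesis
      by (intro exI[of _ c]) auto
  next
    case False
    then obtain j where j: "j \<in> I" "A w j \<noteq> 0"
      by auto
    (* eliminate the unknown j by means of the equation w *)
    define B where "B u i = A u i - A u j * A w i / A w j" for u i
    have "card W < card (I - {j})"
      using insert.prems insert.hyps j by simp
    then obtain c where c: "\<exists>i\<in>I - {j}. c i \<noteq> 0" "\<forall>u\<in>W. (\<Sum>i\<in>I - {j}. B u i * c i) = 0"
      using insert.IH[of "I - {j}" B] insert.prems by auto
    define c' where "c' = c(j := - (\<Sum>i\<in>I - {j}. A w i * c i) / A w j)"
    have expand: "(\<Sum>i\<in>I. A u i * c' i) = A u j * c' j + (\<Sum>i\<in>I - {j}. A u i * c i)" for u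
    proof -
      have "(\<Sum>i\<in>I. A u i * c' i) = A u j * c' j + (\<Sum>i\<in>I - {j}. A u i * c' i)"
        using insert.prems j by (intro sum.remove) auto
      also have "(\<Sum>i\<in>I - {j}. A u i * c' i) = (\<Sum>i\<in>I - {j}. A u i * c i)"
        by (intro sum.cong) (auto simp: c'_def)
      finally show ?thesis .
    qed
    have "(\<Sum>i\<in>I. A w i * c' i) = 0"
      unfolding expand using j by (simp add: c'_def)
    moreover have "(\<Sum>i\<in>I. A u i * c' i) = 0" if "u \<in> W" for u
    proof -
      have "(\<Sum>i\<in>I - {j}. B u i * c i)
          = (\<Sum>i\<in>I - {j}. A u i * c i) - A u j / A w j * (\<Sum>i\<in>I - {j}. A w i * c i)"
        by (simp add: B_def algebra_simps sum_subtractf sum_distrib_left)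
      then show ?thesis
        unfolding expand using c(2) that by (simp add: c'_def algebra_simps)
    qed
    moreover have "\<exists>i\<in>I. c' i \<noteq> 0"
      using c(1) by (auto simp: c'_def)
    ultimately show ?thesis
      by (intro exI[of _ c']) auto
  qed
qed


section \<open>Join-irreducible elements and monomials of equal weight\<close>

lemma ji_le_sup [simp]: "Rep_ji z \<le> sup x y \<longleftrightarrow> Rep_ji z \<le> x \<or> Rep_ji z \<le> y"
proof
  assume "Rep_ji z \<le> sup x y"
  then have "Rep_ji z = sup (inf (Rep_ji z) x) (inf (Rep_ji z) y)"
    by (simp add: inf_sup_distrib1[symmetric] inf_absorb1)
  moreover have "Rep_ji z \<in> join_irreducibles"
    by (rule Rep_ji)
  ultimately have "Rep_ji z = inf (Rep_ji z) x \<or> Rep_ji z = inf (Rep_ji z) y"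
    unfolding join_irreducibles_def by blast
  then show "Rep_ji z \<le> x \<or> Rep_ji z \<le> y"
    by (metis inf.cobounded2)
qed (auto intro: le_supI1 le_supI2)

lemma le_iff_ji_le:
  fixes x y :: "'l::{finite, distrib_lattice}"
  shows "x \<le> y \<longleftrightarrow> (\<forall>z. Rep_ji z \<le> x \<longrightarrow> Rep_ji z \<le> y)"
proof
  show "x \<le> y" if "\<forall>z. Rep_ji z \<le> x \<longrightarrow> Rep_ji z \<le> y"
    using that
  proof (induction "card {u. u \<le> x}" arbitrary: x rule: less_induct)
    case less
    show ?case
    proof (cases "x \<in> join_irreducibles")
      case True
      then show ?thesis
        using less.prems by (metis Abs_ji_inverse order_refl)
    next
      case False
      then obtain a b where ab: "x = sup a b" "x \<noteq> a" "x \<noteq> b"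
        by (auto simp: join_irreducibles_def)
      have "u \<le> y" if "u \<le> x" "u \<noteq> x" for u
      proof (rule less.hyps)
        show "card {v. v \<le> u} < card {v. v \<le> x}"
          by (rule psubset_card_mono) (use that in \<open>auto dest: order_trans antisym\<close>)
        show "\<forall>z. Rep_ji z \<le> u \<longrightarrow> Rep_ji z \<le> y"
          using less.prems that(1) order_trans by blast
      qed
      then show ?thesis
        using ab by (metis sup.cobounded1 sup.cobounded2 sup_least)
    qed
  qed
qed (auto intro: order_trans)

lemma eq_iff_ji_le:
  fixes x y :: "'l::{finite, distrib_lattice}"
  shows "x = y \<longleftrightarrow> (\<forall>z. Rep_ji z \<le> x \<longleftrightarrow> Rep_ji z \<le> y)"
  by (auto simp: order.eq_iff[of x y] le_iff_ji_le[of x y] le_iff_ji_le[of y x])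

lemma ji_le_Sup_fin:
  assumes "finite A" "A \<noteq> {}"
  shows "Rep_ji z \<le> Sup_fin A \<longleftrightarrow> (\<exists>x\<in>A. Rep_ji z \<le> x)"
  using assms by (induction A rule: finite_ne_induct) auto

text \<open>Half of Birkhoff's theorem; the element is the join of the ideal.\<close>
lemma nonempty_order_ideal_realised:
  fixes A :: "'l::{finite, distrib_lattice} ji set"
  assumes "A \<noteq> {}" "\<And>z w. z \<in> A \<Longrightarrow> Rep_ji w \<le> Rep_ji z \<Longrightarrow> w \<in> A"
  obtains x where "\<And>z. Rep_ji z \<le> x \<longleftrightarrow> z \<in> A"
proof (rule that)
  show "Rep_ji z \<le> Sup_fin (Rep_ji ` A) \<longleftrightarrow> z \<in> A" for z
    using assms by (subst ji_le_Sup_fin) auto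
qed

definition bottom_ji :: "'l::{finite, distrib_lattice} ji" where
  "bottom_ji = (SOME z. \<forall>x. Rep_ji z \<le> x)"

lemma bottom_ji_le [simp]: "Rep_ji bottom_ji \<le> (x :: 'l::{finite, distrib_lattice})"
proof -
  let ?b = "Inf_fin (UNIV :: 'l set)"
  have le: "?b \<le> y" for y
    by (rule Inf_fin.coboundedI) auto
  have "?b \<in> join_irreducibles"
    unfolding join_irreducibles_def using le by (auto intro: order.antisym simp: le_supI1)
  then have "\<forall>y. Rep_ji (Abs_ji ?b) \<le> y"
    using le by (simp add: Abs_ji_inverse)
  then have "\<forall>y :: 'l. Rep_ji bottom_ji \<le> y"
    unfolding bottom_ji_def by (rule someI)
  then show ?thesis
    by blast
qed

definition sublattice :: "'l::lattice set \<Rightarrow> bool" where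
  "sublattice D \<longleftrightarrow> (\<forall>x\<in>D. \<forall>y\<in>D. sup x y \<in> D \<and> inf x y \<in> D)"

definition hibi_multiplicative_on :: "'l::lattice set \<Rightarrow> ('l \<Rightarrow> 'a::times) \<Rightarrow> bool" where
  "hibi_multiplicative_on D g \<longleftrightarrow> (\<forall>x\<in>D. \<forall>y\<in>D. g x * g y = g (sup x y) * g (inf x y))"

text \<open>The exponents of the torus coordinates in the pullback of a monomial.\<close>
definition mset_weight :: "'l::{finite, distrib_lattice} multiset \<Rightarrow> 'l ji \<Rightarrow> nat" where
  "mset_weight M z = size (filter_mset (\<lambda>x. Rep_ji z \<le> x) M)"

definition weight :: "('l::{finite, distrib_lattice} \<Rightarrow>\<^sub>0 nat) \<Rightarrow> 'l ji \<Rightarrow> nat" where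
  "weight m z = (\<Sum>x | Rep_ji z \<le> x. Poly_Mapping.lookup m x)"

lemma mset_weight_add_mset:
  "mset_weight (add_mset x M) z = (if Rep_ji z \<le> x then 1 else 0) + mset_weight M z"
  by (simp add: mset_weight_def)

lemma mset_weight_pos_iff: "mset_weight M z > 0 \<longleftrightarrow> (\<exists>x\<in>#M. Rep_ji z \<le> x)"
  by (induction M) (auto simp: mset_weight_def)

text \<open>
  Folding a monomial by the Hibi relations \<open>x y = (x \<squnion> y) (x \<sqinter> y)\<close> extracts the join of all its
  factors.
\<close>
lemma extract_join:
  fixes g :: "'l::{finite, distrib_lattice} \<Rightarrow> 'a::comm_monoid_mult"
  assumes D: "sublattice D" and g: "hibi_multiplicative_on D g"
    and "x \<in> D" "set_mset M \<subseteq> D"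
  shows "\<exists>y N. y \<in> D \<and> set_mset N \<subseteq> D \<and> (\<forall>u\<in>#add_mset x M. u \<le> y) \<and>
    mset_weight (add_mset x M) = mset_weight (add_mset y N) \<and>
    prod_mset (image_mset g (add_mset x M)) = prod_mset (image_mset g (add_mset y N))"
  using assms(4)
proof (induction M)
  case empty
  show ?case
    using \<open>x \<in> D\<close> by (intro exI[of _ x] exI[of _ "{#}"]) auto
next
  case (add v M)
  then obtain y N where IH: "y \<in> D" "set_mset N \<subseteq> D" "\<forall>u\<in>#add_mset x M. u \<le> y"
    "mset_weight (add_mset x M) = mset_weight (add_mset y N)"
    "prod_mset (image_mset g (add_mset x M)) = prod_mset (image_mset g (add_mset y N))"
    by auto
  have v: "v \<in> D"
    using add.prems by simp
  have "mset_weight (add_mset x (add_mset v M)) z = mset_weight (add_mset (sup y v) (add_mset (inf y v) N)) z" for z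
    using fun_cong[OF IH(4), of z] by (simp add: mset_weight_add_mset split: if_splits)
  moreover have "prod_mset (image_mset g (add_mset x (add_mset v M)))
      = prod_mset (image_mset g (add_mset (sup y v) (add_mset (inf y v) N)))"
  proof -
    have "prod_mset (image_mset g (add_mset x (add_mset v M))) = g v * prod_mset (image_mset g (add_mset x M))"
      by (simp add: mult_ac)
    also have "\<dots> = g y * g v * prod_mset (image_mset g N)"
      unfolding IH(5) by (simp add: mult_ac)
    also have "g y * g v = g (sup y v) * g (inf y v)"
      using g IH(1) v by (auto simp: hibi_multiplicative_on_def)
    finally show ?thesis
      by (simp add: mult_ac)
  qed
  moreover have "\<forall>u\<in>#add_mset x (add_mset v M). u \<le> sup y v"
    using IH(3) by (auto intro: le_supI1)
  ultimately show ?case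
    using IH(1,2) v D by (intro exI[of _ "sup y v"] exI[of _ "add_mset (inf y v) N"])
      (auto simp: sublattice_def)
qed

text \<open>
  The weight determines the join of the factors, since a join-irreducible element lies below the
  join exactly if it lies below some factor. So two monomials of equal weight have equal
  extracted joins, and the joins can be cancelled from the weights.
\<close>
lemma prod_mset_eq_of_weight_eq:
  fixes g :: "'l::{finite, distrib_lattice} \<Rightarrow> 'a::comm_monoid_mult"
  assumes D: "sublattice D" and g: "hibi_multiplicative_on D g"
    and "set_mset M \<subseteq> D" "set_mset M' \<subseteq> D" "mset_weight M = mset_weight M'"
  shows "prod_mset (image_mset g M) = prod_mset (image_mset g M')"
  using assms(3-5)
proof (induction "size M" arbitrary: M M')
  case 0
  then have "M = {#}"
    by simp
  then have "mset_weight M' bottom_ji = 0"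
    using fun_cong[OF 0(4), of bottom_ji] by (simp add: mset_weight_def)
  then show ?case
    using \<open>M = {#}\<close> by (simp add: mset_weight_def)
next
  case (Suc n)
  have size_eq: "size M = size M'" if "mset_weight M = mset_weight M'" for M M' :: "'l multiset"
    using fun_cong[OF that, of bottom_ji] by (simp add: mset_weight_def)
  from Suc(2) obtain x M1 where M: "M = add_mset x M1"
    by (metis size_eq_Suc_imp_eq_union)
  from Suc(2) size_eq[OF Suc.prems(3)] obtain x' M1' where M': "M' = add_mset x' M1'"
    by (metis size_eq_Suc_imp_eq_union)
  obtain y N where N: "y \<in> D" "set_mset N \<subseteq> D" "\<forall>u\<in>#M. u \<le> y"
    "mset_weight M = mset_weight (add_mset y N)"
    "prod_mset (image_mset g M) = prod_mset (image_mset g (add_mset y N))"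
    using extract_join[OF D g, of x M1] Suc.prems(1) unfolding M by auto
  obtain y' N' where N': "y' \<in> D" "set_mset N' \<subseteq> D" "\<forall>u\<in>#M'. u \<le> y'"
    "mset_weight M' = mset_weight (add_mset y' N')"
    "prod_mset (image_mset g M') = prod_mset (image_mset g (add_mset y' N'))"
    using extract_join[OF D g, of x' M1'] Suc.prems(2) unfolding M' by auto
  have "Rep_ji z \<le> y \<longleftrightarrow> mset_weight M z > 0" for z
    using N(3) by (metis N(4) mset_weight_pos_iff order_trans union_single_eq_member)
  moreover have "Rep_ji z \<le> y' \<longleftrightarrow> mset_weight M' z > 0" for z
    using N'(3) by (metis N'(4) mset_weight_pos_iff order_trans union_single_eq_member)
  ultimately have "y = y'"
    using Suc.prems(3) eq_iff_ji_le[of y y'] by simp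
  then have "mset_weight N z = mset_weight N' z" for z
    using fun_cong[OF N(4), of z] fun_cong[OF N'(4), of z] Suc.prems(3)
    by (simp add: mset_weight_add_mset)
  moreover have "n = size N"
    using Suc(2) size_eq[OF N(4)] by simp
  ultimately have "prod_mset (image_mset g N) = prod_mset (image_mset g N')"
    using Suc(1)[of N N'] N(2) N'(2) by blast
  then show ?case
    using N(5) N'(5) \<open>y = y'\<close> by simp
qed

lemma monomial_value_eq_of_weight_eq:
  fixes g :: "'l::{finite, distrib_lattice} \<Rightarrow> 'a::comm_monoid_mult"
  assumes "sublattice D" "hibi_multiplicative_on D g"
    and "Poly_Mapping.keys m \<subseteq> D" "Poly_Mapping.keys n \<subseteq> D" "weight m = weight n"
  shows "monomial_value g m = monomial_value g n"
proof -
  define M where "M m = (\<Sum>x\<in>UNIV. replicate_mset (Poly_Mapping.lookup m x) x)"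
    for m :: "'l \<Rightarrow>\<^sub>0 nat"
  have image_sum: "prod_mset (image_mset g (\<Sum>x\<in>A. replicate_mset (e x) x)) = (\<Prod>x\<in>A. g x ^ e x)"
    for A e
    by (induction A rule: infinite_finite_induct) auto
  have filter_replicate: "filter_mset P (replicate_mset n x) = (if P x then replicate_mset n x else {#})"
    for P and n :: nat and x :: 'l
    by (induction n) auto
  have filter_sum: "size (filter_mset P (\<Sum>x\<in>A. replicate_mset (e x) x))
      = (\<Sum>x\<in>A. if P x then e x else 0)" for A e and P :: "'l \<Rightarrow> bool"
    by (induction A rule: infinite_finite_induct) (auto simp: filter_replicate)
  have val: "prod_mset (image_mset g (M m)) = monomial_value g m" for m
    by (simp add: M_def image_sum monomial_value_def)
  have weight: "mset_weight (M m) = weight m" for m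
    by (auto simp: mset_weight_def weight_def M_def filter_sum fun_eq_iff sum.If_cases)
  have "set_mset (M m) = Poly_Mapping.keys m" for m
    by (auto simp: M_def set_mset_sum in_keys_iff split: if_splits)
  then show ?thesis
    using prod_mset_eq_of_weight_eq[of D g "M m" "M n"] assms by (simp add: val weight)
qed

lemma weight_single: "weight (Poly_Mapping.single x k) z = (if Rep_ji z \<le> x then k else 0)"
proof -
  have "weight (Poly_Mapping.single x k) z = (\<Sum>y | Rep_ji z \<le> y. if y = x then k else 0)"
    unfolding weight_def by (intro sum.cong) (auto simp: lookup_single when_def)
  then show ?thesis
    by simp
qed


section \<open>Torus orbits, density and the tangent equations\<close>

text \<open>
  The condition says that the indicator function of \<open>D\<close> is a point of the Hibi variety. The support
  of every point satisfies it.
\<close>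
definition embedded_sublattice :: "'l::lattice set \<Rightarrow> bool" where
  "embedded_sublattice D \<longleftrightarrow> (\<forall>x y. x \<in> D \<and> y \<in> D \<longleftrightarrow> sup x y \<in> D \<and> inf x y \<in> D)"

lemma embedded_sublatticeD: "embedded_sublattice D \<Longrightarrow> sublattice D"
  by (auto simp: embedded_sublattice_def sublattice_def)

lemma embedded_sublattice_UNIV: "embedded_sublattice UNIV"
  by (simp add: embedded_sublattice_def)

definition torus_coordinate :: "('l::{finite, distrib_lattice} ji \<Rightarrow> 'k::comm_ring_1) \<Rightarrow> 'l \<Rightarrow> 'k" where
  "torus_coordinate t x = (\<Prod>z | Rep_ji z \<le> x. t z)"

lemma torus_coordinate_hibi:
  "torus_coordinate t x * torus_coordinate t y = torus_coordinate t (sup x y) * torus_coordinate t (inf x y)"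
proof -
  have "{z. Rep_ji z \<le> sup x y} = {z. Rep_ji z \<le> x} \<union> {z. Rep_ji z \<le> y}"
    "{z. Rep_ji z \<le> inf x y} = {z. Rep_ji z \<le> x} \<inter> {z. Rep_ji z \<le> y}"
    by auto
  then show ?thesis
    unfolding torus_coordinate_def by (simp add: prod.union_inter)
qed

lemma torus_coordinate_nonzero:
  fixes t :: "'l::{finite, distrib_lattice} ji \<Rightarrow> 'k::field"
  shows "(\<And>z. t z \<noteq> 0) \<Longrightarrow> torus_coordinate t x \<noteq> 0"
  by (simp add: torus_coordinate_def)

text \<open>
  The points of the orbit of the distinguished point with support \<open>D\<close>, provided that the
  parameters \<open>t\<close> are nonzero.
\<close>
definition orbit_point ::
    "'l set \<Rightarrow> ('l ji \<Rightarrow> 'k::comm_ring_1) \<Rightarrow> 'k ^ 'l::{finite, distrib_lattice}" where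
  "orbit_point D t = (\<chi> x. if x \<in> D then torus_coordinate t x else 0)"

lemma orbit_point_nth [simp]: "orbit_point D t $ x = (if x \<in> D then torus_coordinate t x else 0)"
  by (simp add: orbit_point_def)

lemma in_hibi_variety_iff:
  "a \<in> hibi_variety \<longleftrightarrow> (\<forall>x y. a $ x * a $ y = a $ sup x y * a $ inf x y)"
  by (auto simp: hibi_variety_def zero_locus_def meval_hibi_binomial)
     (metis eq_iff_diff_eq_0 meval_hibi_binomial)

lemma in_hibi_subvariety_iff:
  "a \<in> hibi_subvariety D \<longleftrightarrow>
     (\<forall>x. x \<notin> D \<longrightarrow> a $ x = 0) \<and> (\<forall>x\<in>D. \<forall>y\<in>D. a $ x * a $ y = a $ sup x y * a $ inf x y)"
proof
  assume a: "a \<in> hibi_subvariety D"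
  have "a $ x = 0" if "x \<notin> D" for x
  proof -
    have "meval (mvar x) a = 0"
      using a that unfolding hibi_subvariety_def zero_locus_def by blast
    then show ?thesis
      by simp
  qed
  moreover have "a $ x * a $ y = a $ sup x y * a $ inf x y" if "x \<in> D" "y \<in> D" for x y
  proof -
    have "meval (hibi_binomial x y) a = 0"
      using a that unfolding hibi_subvariety_def zero_locus_def by blast
    then show ?thesis
      by (simp add: meval_hibi_binomial)
  qed
  ultimately show "(\<forall>x. x \<notin> D \<longrightarrow> a $ x = 0) \<and>
      (\<forall>x\<in>D. \<forall>y\<in>D. a $ x * a $ y = a $ sup x y * a $ inf x y)"
    by blast
qed (auto simp: hibi_subvariety_def zero_locus_def meval_hibi_binomial)

lemma hibi_subvariety_subset:
  assumes "embedded_sublattice D"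
  shows "hibi_subvariety D \<subseteq> hibi_variety"
proof
  fix a
  assume a: "a \<in> hibi_subvariety D"
  show "a \<in> hibi_variety"
    unfolding in_hibi_variety_iff
  proof (intro allI)
    fix x y
    show "a $ x * a $ y = a $ sup x y * a $ inf x y"
    proof (cases "x \<in> D \<and> y \<in> D")
      case False
      then have "\<not> (sup x y \<in> D \<and> inf x y \<in> D)"
        using assms by (auto simp: embedded_sublattice_def)
      then show ?thesis
        using a False by (auto simp: in_hibi_subvariety_iff)
    qed (use a in \<open>auto simp: in_hibi_subvariety_iff\<close>)
  qed
qed

lemma hibi_subvariety_UNIV: "hibi_subvariety UNIV = hibi_variety"
  by (auto simp: in_hibi_variety_iff in_hibi_subvariety_iff)

lemma orbit_point_in_subvariety:
  "sublattice D \<Longrightarrow> orbit_point D t \<in> hibi_subvariety D"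
  using torus_coordinate_hibi by (auto simp: in_hibi_subvariety_iff sublattice_def)

lemma support_embedded_sublattice:
  fixes a :: "'k::field ^ 'l::{finite, distrib_lattice}"
  assumes "a \<in> hibi_variety"
  shows "embedded_sublattice {x. a $ x \<noteq> 0}"
  using assms unfolding embedded_sublattice_def in_hibi_variety_iff mem_Collect_eq
  by (metis mult_eq_0_iff)

lemma monomial_value_torus_coordinate:
  "monomial_value (torus_coordinate t) m = (\<Prod>z\<in>UNIV. t z ^ weight m z)"
proof -
  have "monomial_value (torus_coordinate t) m
      = (\<Prod>x\<in>UNIV. \<Prod>z\<in>UNIV. if Rep_ji z \<le> x then t z ^ Poly_Mapping.lookup m x else 1)"
    by (simp add: monomial_value_def torus_coordinate_def prod_power_distrib prod.If_cases)
  also have "\<dots> = (\<Prod>z\<in>UNIV. \<Prod>x\<in>UNIV. if Rep_ji z \<le> x then t z ^ Poly_Mapping.lookup m x else 1)"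
    by (rule prod.swap)
  also have "\<dots> = (\<Prod>z\<in>UNIV. t z ^ weight m z)"
    by (simp add: weight_def power_sum prod.If_cases)
  finally show ?thesis .
qed

lemma monomial_value_restrict:
  fixes a :: "'k::field ^ 'x::finite"
  assumes "\<And>x. x \<notin> D \<Longrightarrow> a $ x = 0" "\<not> Poly_Mapping.keys m \<subseteq> D"
  shows "monomial_value (($) a) m = 0"
proof -
  obtain x where "x \<in> Poly_Mapping.keys m" "x \<notin> D"
    using assms(2) by auto
  then have "a $ x ^ Poly_Mapping.lookup m x = 0"
    using assms(1) by (simp add: in_keys_iff)
  then show ?thesis
    unfolding monomial_value_def by (metis UNIV_I finite_class.finite_UNIV prod_zero_iff)
qed

text \<open>
  A polynomial that vanishes on the orbit has zero total coefficient in each weight, by the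
  independence of the torus monomials. Hence it is killed by every linear functional that depends
  only on the weights of monomials: the value at a point of the closed subvariety, or a derivative
  in a direction satisfying the linearised equations.
\<close>
lemma weight_functional_vanishes:
  fixes p :: "('l::{finite, distrib_lattice}, 'k::alg_closed_field) mpoly" and G :: "_ \<Rightarrow> 'k"
  assumes vanish: "\<And>t. (\<And>z. t z \<noteq> 0) \<Longrightarrow> meval p (orbit_point D t) = 0"
    and G: "\<And>m n. Poly_Mapping.keys m \<subseteq> D \<Longrightarrow> Poly_Mapping.keys n \<subseteq> D \<Longrightarrow> weight m = weight n \<Longrightarrow> G m = G n"
  shows "(\<Sum>m | m \<in> Poly_Mapping.keys p \<and> Poly_Mapping.keys m \<subseteq> D. Poly_Mapping.lookup p m * G m) = 0"
proof -
  let ?K = "{m \<in> Poly_Mapping.keys p. Poly_Mapping.keys m \<subseteq> D}"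
  define c where "c w = (\<Sum>m | m \<in> ?K \<and> weight m = w. Poly_Mapping.lookup p m)" for w
  have fin: "finite ?K"
    by simp
  have "(\<Sum>w\<in>weight ` ?K. c w * (\<Prod>z\<in>UNIV. t z ^ w z)) = 0" if t: "\<And>z. t z \<noteq> 0" for t
  proof -
    have "(\<Sum>w\<in>weight ` ?K. c w * (\<Prod>z\<in>UNIV. t z ^ w z))
        = (\<Sum>w\<in>weight ` ?K. \<Sum>m | m \<in> ?K \<and> weight m = w. Poly_Mapping.lookup p m * (\<Prod>z\<in>UNIV. t z ^ weight m z))"
      unfolding c_def sum_distrib_right by (intro sum.cong) auto
    also have "\<dots> = (\<Sum>m\<in>?K. Poly_Mapping.lookup p m * (\<Prod>z\<in>UNIV. t z ^ weight m z))"
      using fin by (intro sum.group) auto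
    also have "\<dots> = (\<Sum>m\<in>?K. Poly_Mapping.lookup p m * monomial_value (($) (orbit_point D t)) m)"
    proof (intro sum.cong refl)
      fix m assume "m \<in> ?K"
      then have "Poly_Mapping.lookup m x = 0" if "x \<notin> D" for x
        using that by (auto simp: in_keys_iff)
      then have "monomial_value (($) (orbit_point D t)) m = monomial_value (torus_coordinate t) m"
        unfolding monomial_value_def by (intro prod.cong) auto
      then show "Poly_Mapping.lookup p m * (\<Prod>z\<in>UNIV. t z ^ weight m z)
          = Poly_Mapping.lookup p m * monomial_value (($) (orbit_point D t)) m"
        by (simp add: monomial_value_torus_coordinate)
    qed
    also have "\<dots> = meval p (orbit_point D t)"
      unfolding meval_eq by (intro sum.mono_neutral_left)
        (use monomial_value_restrict[of D "orbit_point D t"] in auto)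
    finally show ?thesis
      using vanish[OF t] by simp
  qed
  then have c: "c w = 0" if "w \<in> weight ` ?K" for w
    using torus_monomials_independent[of "weight ` ?K" c] that fin by blast
  have "(\<Sum>m\<in>?K. Poly_Mapping.lookup p m * G m)
      = (\<Sum>w\<in>weight ` ?K. \<Sum>m | m \<in> ?K \<and> weight m = w. Poly_Mapping.lookup p m * G m)"
    using fin by (intro sum.group[symmetric]) auto
  also have "\<dots> = (\<Sum>w\<in>weight ` ?K. 0)"
  proof (intro sum.cong refl)
    fix w assume w: "w \<in> weight ` ?K"
    then obtain n where n: "n \<in> ?K" "weight n = w"
      by auto
    have "(\<Sum>m | m \<in> ?K \<and> weight m = w. Poly_Mapping.lookup p m * G m)
        = (\<Sum>m | m \<in> ?K \<and> weight m = w. Poly_Mapping.lookup p m * G n)"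
    proof (intro sum.cong refl)
      fix m assume "m \<in> {m \<in> ?K. weight m = w}"
      then show "Poly_Mapping.lookup p m * G m = Poly_Mapping.lookup p m * G n"
        using G[of m n] n by simp
    qed
    also have "\<dots> = c w * G n"
      by (simp add: c_def sum_distrib_right)
    finally show "(\<Sum>m | m \<in> ?K \<and> weight m = w. Poly_Mapping.lookup p m * G m) = 0"
      using c[OF w] by simp
  qed
  finally show ?thesis
    by simp
qed

text \<open>
  At a point of the closed subvariety the value of a monomial in the coordinates from \<open>D\<close> depends
  only on the weight, and all other monomials vanish.
\<close>
theorem orbit_dense:
  fixes f :: "'k::alg_closed_field ^ 'l::{finite, distrib_lattice} \<Rightarrow> 'k"
  assumes "sublattice D" "polynomial_function f"
    and vanish: "\<And>t. (\<And>z. t z \<noteq> 0) \<Longrightarrow> f (orbit_point D t) = 0"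
    and a: "a \<in> hibi_subvariety D"
  shows "f a = 0"
proof -
  obtain p where p: "\<And>a. f a = meval p a"
    using assms(2) by (auto simp: polynomial_function_def)
  have "f a = (\<Sum>m | m \<in> Poly_Mapping.keys p \<and> Poly_Mapping.keys m \<subseteq> D.
      Poly_Mapping.lookup p m * monomial_value (($) a) m)"
    unfolding p meval_eq using a
    by (intro sum.mono_neutral_right) (auto intro: monomial_value_restrict simp: in_hibi_subvariety_iff)
  also have "\<dots> = 0"
  proof (rule weight_functional_vanishes)
    show "meval p (orbit_point D t) = 0" if "\<And>z. t z \<noteq> 0" for t
      using vanish[OF that] by (simp add: p)
    show "monomial_value (($) a) m = monomial_value (($) a) n"
      if "Poly_Mapping.keys m \<subseteq> D" "Poly_Mapping.keys n \<subseteq> D" "weight m = weight n" for m n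
      using that assms(1) a
      by (intro monomial_value_eq_of_weight_eq[of D]) (auto simp: hibi_multiplicative_on_def in_hibi_subvariety_iff)
  qed
  finally show ?thesis .
qed

text \<open>
  Dual numbers \<open>a + v \<epsilon>\<close> with \<open>\<epsilon>\<^sup>2 = 0\<close>: a tangent vector is a point with dual coordinates, and
  satisfying the linearised Hibi equations means being multiplicative in this monoid.
\<close>
datatype 'k dual = Dual (re: 'k) (im: 'k)

instantiation dual :: (comm_ring_1) comm_monoid_mult
begin
definition times_dual :: "'a dual \<Rightarrow> 'a dual \<Rightarrow> 'a dual" where
  "times_dual p q = Dual (re p * re q) (re p * im q + im p * re q)"
definition one_dual :: "'a dual" where
  "one_dual = Dual 1 0"
instance
  by standard (auto simp: times_dual_def one_dual_def algebra_simps)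
end

lemma dual_power: "Dual a v ^ n = Dual (a ^ n) (of_nat n * a ^ (n - 1) * v)"
proof (induction n)
  case (Suc n)
  then show ?case
    by (cases n) (auto simp: times_dual_def one_dual_def algebra_simps)
qed (simp add: one_dual_def)

lemma dual_prod:
  "finite A \<Longrightarrow> (\<Prod>x\<in>A. Dual (b x) (u x)) = Dual (\<Prod>x\<in>A. b x) (\<Sum>x\<in>A. u x * (\<Prod>y\<in>A - {x}. b y))"
proof (induction A rule: finite_induct)
  case (insert x A)
  have "(\<Sum>y\<in>A. u y * (\<Prod>y\<in>insert x A - {y}. b y)) = (\<Sum>y\<in>A. b x * (u y * (\<Prod>y\<in>A - {y}. b y)))"
  proof (intro sum.cong refl)
    fix y assume "y \<in> A"
    then have "insert x A - {y} = insert x (A - {y})"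
      using insert.hyps by auto
    then show "u y * (\<Prod>y\<in>insert x A - {y}. b y) = b x * (u y * (\<Prod>y\<in>A - {y}. b y))"
      using insert.hyps by (simp add: algebra_simps)
  qed
  moreover have "insert x A - {x} = A"
    using insert.hyps by auto
  ultimately show ?case
    using insert by (simp add: times_dual_def sum_distrib_left algebra_simps)
qed (simp add: one_dual_def)

lemma directional_derivative_eq:
  "(\<Sum>x\<in>UNIV. meval (mpderiv x p) a * v $ x)
     = (\<Sum>m\<in>Poly_Mapping.keys p. Poly_Mapping.lookup p m * im (monomial_value (\<lambda>x. Dual (a $ x) (v $ x)) m))"
proof -
  have im: "im (monomial_value (\<lambda>x. Dual (a $ x) (v $ x)) m)
      = (\<Sum>x\<in>UNIV. of_nat (Poly_Mapping.lookup m x) * monomial_value (($) a) (m - Poly_Mapping.single x 1) * v $ x)" for m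
  proof -
    have "monomial_value (($) a) (m - Poly_Mapping.single x 1)
        = a $ x ^ (Poly_Mapping.lookup m x - 1) * (\<Prod>y\<in>UNIV - {x}. a $ y ^ Poly_Mapping.lookup m y)" for x
    proof -
      have "(\<Prod>y\<in>UNIV - {x}. a $ y ^ Poly_Mapping.lookup (m - Poly_Mapping.single x 1) y)
          = (\<Prod>y\<in>UNIV - {x}. a $ y ^ Poly_Mapping.lookup m y)"
        by (intro prod.cong) (auto simp: lookup_minus lookup_single when_def)
      then show ?thesis
        unfolding monomial_value_def
        by (subst prod.remove[of UNIV x]) (auto simp: lookup_minus)
    qed
    then show ?thesis
      by (simp add: monomial_value_def dual_power dual_prod mult_ac)
  qed
  have "meval (mpderiv x p) a = (\<Sum>m\<in>Poly_Mapping.keys p.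
      of_nat (Poly_Mapping.lookup m x) * Poly_Mapping.lookup p m * monomial_value (($) a) (m - Poly_Mapping.single x 1))" for x
    by (simp add: mpderiv_def meval_sum meval_single)
  then have "(\<Sum>x\<in>UNIV. meval (mpderiv x p) a * v $ x)
      = (\<Sum>x\<in>UNIV. \<Sum>m\<in>Poly_Mapping.keys p. Poly_Mapping.lookup p m *
          (of_nat (Poly_Mapping.lookup m x) * monomial_value (($) a) (m - Poly_Mapping.single x 1) * v $ x))"
    by (simp add: sum_distrib_left mult_ac)
  also have "\<dots> = (\<Sum>m\<in>Poly_Mapping.keys p. Poly_Mapping.lookup p m * im (monomial_value (\<lambda>x. Dual (a $ x) (v $ x)) m))"
    by (subst sum.swap) (simp add: im sum_distrib_left)
  finally show ?thesis .
qed

definition linearised_solutions :: "'k::comm_ring_1 ^ 'l::{finite, distrib_lattice} \<Rightarrow> ('k ^ 'l::{finite, distrib_lattice}) set" where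
  "linearised_solutions a =
     {v. \<forall>x y. a $ x * v $ y + v $ x * a $ y = a $ sup x y * v $ inf x y + v $ sup x y * a $ inf x y}"

text \<open>
  A polynomial in the vanishing ideal vanishes on the orbit, so that its weight components sum to
  zero. For a solution \<open>v\<close> of the linearised equations the derivatives of monomials in the direction
  \<open>v\<close> depend only on weights, hence the derivative of such a polynomial is zero.
\<close>
theorem tangent_space_hibi_variety:
  fixes a :: "'k::alg_closed_field ^ 'l::{finite, distrib_lattice}"
  assumes a: "a \<in> hibi_variety"
  shows "tangent_space hibi_variety a = linearised_solutions a"
proof (intro equalityI subsetI)
  fix v assume v: "v \<in> linearised_solutions a"
  show "v \<in> tangent_space hibi_variety a"
    unfolding tangent_space_def
  proof (intro CollectI ballI)
    fix f :: "('l, 'k) mpoly"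
    assume f: "f \<in> vanishing_ideal hibi_variety"
    let ?g = "\<lambda>x. Dual (a $ x) (v $ x)"
    have g: "hibi_multiplicative_on UNIV ?g"
      using a v
      by (auto simp: hibi_multiplicative_on_def times_dual_def in_hibi_variety_iff linearised_solutions_def)
    have "(\<Sum>m | m \<in> Poly_Mapping.keys f \<and> Poly_Mapping.keys m \<subseteq> UNIV.
        Poly_Mapping.lookup f m * im (monomial_value ?g m)) = 0"
    proof (rule weight_functional_vanishes)
      show "meval f (orbit_point UNIV t) = 0" for t
        using f orbit_point_in_subvariety[of UNIV t]
        by (auto simp: vanishing_ideal_def hibi_subvariety_UNIV sublattice_def)
      show "im (monomial_value ?g m) = im (monomial_value ?g n)" if "weight m = weight n" for m n
        using monomial_value_eq_of_weight_eq[OF _ g, of m n] that by (simp add: sublattice_def)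
    qed
    then show "(\<Sum>x\<in>UNIV. meval (mpderiv x f) a * v $ x) = 0"
      by (simp add: directional_derivative_eq)
  qed
next
  fix v assume v: "v \<in> tangent_space hibi_variety a"
  have keys: "monomial_value g (Poly_Mapping.single x 1 + Poly_Mapping.single y 1) = g x * g y"
    for x y :: 'l and g :: "'l \<Rightarrow> 'k dual"
    using monomial_value_single[of g x] monomial_value_single[of g y] by (simp add: monomial_value_add)
  have "a $ x * v $ y + v $ x * a $ y = a $ sup x y * v $ inf x y + v $ sup x y * a $ inf x y" for x y
  proof -
    let ?f = "hibi_binomial x y :: ('l, 'k) mpoly"
    let ?g = "\<lambda>x. Dual (a $ x) (v $ x)"
    let ?m = "Poly_Mapping.single x 1 + Poly_Mapping.single y 1 :: 'l \<Rightarrow>\<^sub>0 nat"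
    let ?n = "Poly_Mapping.single (sup x y) 1 + Poly_Mapping.single (inf x y) 1 :: 'l \<Rightarrow>\<^sub>0 nat"
    have f: "?f = Poly_Mapping.single ?m 1 - Poly_Mapping.single ?n 1"
      by (simp add: hibi_binomial_def mvar_def mult_single)
    have "?f \<in> vanishing_ideal hibi_variety"
      by (simp add: vanishing_ideal_def in_hibi_variety_iff meval_hibi_binomial)
    then have "(\<Sum>m\<in>Poly_Mapping.keys ?f. Poly_Mapping.lookup ?f m * im (monomial_value ?g m)) = 0"
      using v unfolding tangent_space_def directional_derivative_eq by blast
    also have "(\<Sum>m\<in>Poly_Mapping.keys ?f. Poly_Mapping.lookup ?f m * im (monomial_value ?g m))
        = (\<Sum>m\<in>{?m, ?n}. Poly_Mapping.lookup ?f m * im (monomial_value ?g m))"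
      by (intro sum.mono_neutral_left) (auto simp: f in_keys_iff lookup_minus lookup_single when_def split: if_splits)
    also have "\<dots> = im (monomial_value ?g ?m) - im (monomial_value ?g ?n)"
      by (cases "?m = ?n") (auto simp: f lookup_minus lookup_single when_def)
    finally show ?thesis
      unfolding keys by (simp add: times_dual_def)
  qed
  then show "v \<in> linearised_solutions a"
    by (simp add: linearised_solutions_def)
qed


section \<open>Maximal chains and transitivity of the torus action\<close>

lemma maxchainD:
  assumes "maximal_chain_in D C"
  shows "C \<subseteq> D" "\<And>x y. x \<in> C \<Longrightarrow> y \<in> C \<Longrightarrow> x \<le> y \<or> y \<le> x"
proof -
  have chain: "C \<subseteq> D" "\<forall>x\<in>C. \<forall>y\<in>C. x < y \<or> x = y \<or> y < x"
    using assms unfolding pred_on.maxchain_def pred_on.chain_def by auto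
  show "C \<subseteq> D"
    by (rule chain(1))
  show "x \<le> y \<or> y \<le> x" if "x \<in> C" "y \<in> C" for x y
    using chain(2) that by (metis order.order_iff_strict)
qed

lemma maxchain_memI:
  assumes C: "maximal_chain_in D C" and "x \<in> D" "\<And>y. y \<in> C \<Longrightarrow> x \<le> y \<or> y \<le> x"
  shows "x \<in> C"
proof (rule ccontr)
  assume "x \<notin> C"
  moreover have "pred_on.chain D (<) (insert x C)"
    using assms by (auto simp: pred_on.maxchain_def pred_on.chain_def order.strict_iff_order)
  ultimately show False
    using C by (auto simp: pred_on.maxchain_def)
qed

lemma finite_chain_has_greatest:
  fixes A :: "'a::order set"
  assumes "finite A" "A \<noteq> {}" "\<And>x y. x \<in> A \<Longrightarrow> y \<in> A \<Longrightarrow> x \<le> y \<or> y \<le> x"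
  obtains m where "m \<in> A" "\<And>x. x \<in> A \<Longrightarrow> x \<le> m"
  using finite_has_maximal[OF assms(1,2)] assms(3) by metis

lemma finite_chain_has_least:
  fixes A :: "'a::order set"
  assumes "finite A" "A \<noteq> {}" "\<And>x y. x \<in> A \<Longrightarrow> y \<in> A \<Longrightarrow> x \<le> y \<or> y \<le> x"
  obtains m where "m \<in> A" "\<And>x. x \<in> A \<Longrightarrow> m \<le> x"
  using finite_has_minimal[OF assms(1,2)] assms(3) by metis

text \<open>
  A function on \<open>D\<close> that respects \<open>x y = (x \<squnion> y) (x \<sqinter> y)\<close> is determined by its values on a
  maximal chain: apply this to the set \<open>Q\<close> on which two such functions agree. The proof descends
  from \<open>x \<sqinter> c\<close> to \<open>x \<sqinter> d\<close>, where \<open>d\<close> precedes \<open>c\<close> in the chain; the element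
  \<open>(x \<sqinter> c) \<squnion> d\<close> lies between \<open>d\<close> and \<open>c\<close>, so that it is one of them.
\<close>
lemma maximal_chain_generates:
  fixes D :: "'l::{finite, distrib_lattice} set"
  assumes D: "sublattice D" and C: "maximal_chain_in D C" and "C \<subseteq> Q"
    and Q: "\<And>x y. x \<in> D \<Longrightarrow> y \<in> D \<Longrightarrow> y \<in> Q \<Longrightarrow> sup x y \<in> Q \<Longrightarrow> inf x y \<in> Q \<Longrightarrow> x \<in> Q"
  shows "D \<subseteq> Q"
proof
  fix x assume x: "x \<in> D"
  note CD = maxchainD(1)[OF C] and lin = maxchainD(2)[OF C]
  have infs: "inf x c \<in> Q" if "c \<in> C" for c
    using that
  proof (induction "card {d \<in> C. d < c}" arbitrary: c rule: less_induct)
    case less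
    have xc: "inf x c \<in> D"
      using D x less.prems CD by (auto simp: sublattice_def)
    show ?case
    proof (cases "{d \<in> C. d < c} = {}")
      case True
      then have "c \<le> d" if "d \<in> C" for d
        using lin[OF that less.prems] that by (auto simp: order.order_iff_strict)
      then have "inf x c \<in> C"
        by (intro maxchain_memI[OF C xc]) (auto intro: le_infI2)
      then have "inf x c = c"
        using True by (metis (mono_tags, lifting) empty_Collect_eq inf.cobounded2 order.not_eq_order_implies_strict)
      then show ?thesis
        using less.prems assms(3) by auto
    next
      case False
      obtain d where d: "d \<in> {d \<in> C. d < c}" "\<And>e. e \<in> {d \<in> C. d < c} \<Longrightarrow> e \<le> d"
        using finite_chain_has_greatest[of "{d \<in> C. d < c}"] False lin by (metis (mono_tags, lifting) finite mem_Collect_eq)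
      have IH: "inf x d \<in> Q"
      proof (rule less.hyps)
        show "card {e \<in> C. e < d} < card {e \<in> C. e < c}"
          by (rule psubset_card_mono) (use d(1) in \<open>auto dest: less_trans\<close>)
      qed (use d in auto)
      let ?s = "sup (inf x c) d"
      have "?s \<in> D"
        using D xc d(1) CD by (auto simp: sublattice_def)
      moreover have sc: "d \<le> ?s" "?s \<le> c"
        using d(1) by auto
      moreover have "?s \<le> e \<or> e \<le> ?s" if "e \<in> C" for e
        using d(2)[of e] lin[OF that less.prems] sc that order_trans
        by (metis (mono_tags, lifting) mem_Collect_eq order.not_eq_order_implies_strict)
      ultimately have "?s \<in> C"
        using maxchain_memI[OF C] by blast
      then have "?s = c \<or> ?s = d"
        using d(2)[of ?s] sc by (metis (mono_tags, lifting) mem_Collect_eq order.antisym order.not_eq_order_implies_strict)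
      then show ?thesis
      proof
        assume s: "?s = d"
        then have "inf x c \<le> d"
          by (metis sup.cobounded1)
        then have "inf x c = inf x d"
          using d(1) by (intro order.antisym) (auto intro: le_infI2)
        then show ?thesis
          using IH by simp
      next
        assume s: "?s = c"
        have "inf (inf x c) d = inf x d"
          using d(1) by (metis (mono_tags, lifting) inf.absorb2 inf.assoc mem_Collect_eq order.strict_implies_order)
        then show ?thesis
          using Q[of "inf x c" d] xc d(1) CD IH s less.prems assms(3) by auto
      qed
    qed
  qed
  have "C \<noteq> {}"
    using maxchain_memI[OF C x] by auto
  then obtain c where c: "c \<in> C" "\<And>d. d \<in> C \<Longrightarrow> d \<le> c"
    using finite_chain_has_greatest[of C] lin by (metis finite)
  have "sup x c \<in> C"
    by (rule maxchain_memI[OF C]) (use D x c CD in \<open>auto simp: sublattice_def le_supI2\<close>)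
  then have "inf x c = x"
    using c(2) by (metis inf.absorb1 le_sup_iff)
  then show "x \<in> Q"
    using infs[OF c(1)] by simp
qed

text \<open>Take an element below \<open>c\<close> that is not below the predecessor of \<open>c\<close> in the chain.\<close>
lemma chain_separating_ji:
  fixes C :: "'l::{finite, distrib_lattice} set"
  assumes lin: "\<And>x y. x \<in> C \<Longrightarrow> y \<in> C \<Longrightarrow> x \<le> y \<or> y \<le> x" and c: "c \<in> C"
  obtains z where "\<And>d. d \<in> C \<Longrightarrow> Rep_ji z \<le> d \<longleftrightarrow> c \<le> d"
proof (cases "{d \<in> C. d < c} = {}")
  case True
  then have "c \<le> d" if "d \<in> C" for d
    using lin[OF that c] that by (auto simp: order.order_iff_strict)
  then show ?thesis
    by (intro that[of bottom_ji]) simp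
next
  case False
  obtain b where b: "b \<in> {d \<in> C. d < c}" "\<And>e. e \<in> {d \<in> C. d < c} \<Longrightarrow> e \<le> b"
    using finite_chain_has_greatest[of "{d \<in> C. d < c}"] False lin by (metis (mono_tags, lifting) finite mem_Collect_eq)
  then have "\<not> c \<le> b"
    by auto
  then obtain z where z: "Rep_ji z \<le> c" "\<not> Rep_ji z \<le> b"
    using le_iff_ji_le[of c b] by blast
  show ?thesis
  proof (rule that[of z])
    fix d assume "d \<in> C"
    then show "Rep_ji z \<le> d \<longleftrightarrow> c \<le> d"
      using lin[OF c \<open>d \<in> C\<close>] b(2)[of d] z
      by (metis (mono_tags, lifting) mem_Collect_eq order.not_eq_order_implies_strict order_trans)
  qed
qed

text \<open>
  Here \<open>c\<close> is replaced by its successor in the chain. If \<open>c\<close> is the greatest element, then there is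
  none, and \<open>None\<close> plays the part of an additional element on top of the join-irreducibles.
\<close>
lemma chain_separating_ji_strict:
  fixes C :: "'l::{finite, distrib_lattice} set"
  assumes lin: "\<And>x y. x \<in> C \<Longrightarrow> y \<in> C \<Longrightarrow> x \<le> y \<or> y \<le> x" and c: "c \<in> C"
  obtains z where "\<And>d. d \<in> C \<Longrightarrow> (case z of None \<Rightarrow> False | Some w \<Rightarrow> Rep_ji w \<le> d) \<longleftrightarrow> c < d"
proof (cases "{d \<in> C. c < d} = {}")
  case True
  then show ?thesis
    by (intro that[of None]) auto
next
  case False
  obtain b where b: "b \<in> {d \<in> C. c < d}" "\<And>e. e \<in> {d \<in> C. c < d} \<Longrightarrow> b \<le> e"
    using finite_chain_has_least[of "{d \<in> C. c < d}"] False lin by (metis (mono_tags, lifting) finite mem_Collect_eq)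
  obtain z where "\<And>d. d \<in> C \<Longrightarrow> Rep_ji z \<le> d \<longleftrightarrow> b \<le> d"
    using chain_separating_ji[where C = C and c = b] lin b(1) by blast
  then show ?thesis
    using b by (intro that[of "Some z"]) (auto dest: less_le_trans)
qed

text \<open>
  Along the chain the coordinates can be prescribed one after the other: a parameter that enters
  the product exactly at the greatest element adjusts its coordinate and leaves the others alone.
\<close>
lemma torus_coordinates_on_chain:
  fixes C :: "'l::{finite, distrib_lattice} set" and q :: "'l \<Rightarrow> 'k::field"
  assumes "\<And>x y. x \<in> C \<Longrightarrow> y \<in> C \<Longrightarrow> x \<le> y \<or> y \<le> x" "\<And>x. x \<in> C \<Longrightarrow> q x \<noteq> 0"
  shows "\<exists>t. (\<forall>z. t z \<noteq> 0) \<and> (\<forall>x\<in>C. torus_coordinate t x = q x)"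
  using assms
proof (induction "card C" arbitrary: C)
  case 0
  then show ?case
    by (intro exI[of _ "\<lambda>_. 1"]) auto
next
  case (Suc n)
  then have "C \<noteq> {}"
    by auto
  then obtain c where c: "c \<in> C" "\<And>d. d \<in> C \<Longrightarrow> d \<le> c"
    using finite_chain_has_greatest[of C] Suc.prems(1) by (metis finite)
  have "n = card (C - {c})"
    using Suc(2) c(1) by simp
  from Suc(1)[OF this] obtain t where t: "\<And>z. t z \<noteq> 0" "\<And>x. x \<in> C - {c} \<Longrightarrow> torus_coordinate t x = q x"
    using Suc.prems by blast
  obtain z where z: "\<And>d. d \<in> C \<Longrightarrow> Rep_ji z \<le> d \<longleftrightarrow> c \<le> d"
    using chain_separating_ji[OF Suc.prems(1) c(1)] by blast
  define t' where "t' = t(z := t z * q c / torus_coordinate t c)"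
  have nz: "torus_coordinate t c \<noteq> 0" "q c \<noteq> 0"
    using t(1) c Suc.prems(2) by (auto simp: torus_coordinate_nonzero)
  have "torus_coordinate t' x = q x" if "x \<in> C - {c}" for x
  proof -
    have "\<not> Rep_ji z \<le> x"
      using z[of x] c(2)[of x] that by auto
    then have "torus_coordinate t' x = torus_coordinate t x"
      unfolding torus_coordinate_def t'_def by (intro prod.cong) auto
    then show ?thesis
      using t(2)[OF that] by simp
  qed
  moreover have "torus_coordinate t' c = q c"
  proof -
    let ?Z = "{w. Rep_ji w \<le> c}"
    have zZ: "z \<in> ?Z"
      using z[OF c(1)] by simp
    have "torus_coordinate t' c = t' z * (\<Prod>w\<in>?Z - {z}. t' w)"
      unfolding torus_coordinate_def using zZ by (intro prod.remove) auto
    also have "(\<Prod>w\<in>?Z - {z}. t' w) = (\<Prod>w\<in>?Z - {z}. t w)"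
      by (intro prod.cong) (auto simp: t'_def)
    also have "t' z * (\<Prod>w\<in>?Z - {z}. t w) = q c / torus_coordinate t c * (t z * (\<Prod>w\<in>?Z - {z}. t w))"
      by (simp add: t'_def)
    also have "t z * (\<Prod>w\<in>?Z - {z}. t w) = torus_coordinate t c"
      unfolding torus_coordinate_def using zZ by (intro prod.remove[symmetric]) auto
    finally show ?thesis
      using nz by simp
  qed
  moreover have "\<forall>w. t' w \<noteq> 0"
    using t(1) nz by (simp add: t'_def)
  ultimately show ?case
    by (metis Diff_iff empty_iff insert_iff)
qed

text \<open>
  The torus acts transitively on the points with a given support. The group generated by the
  characters of a maximal chain is a direct summand of the character group, so that no roots have
  to be extracted.
\<close>
theorem point_in_orbit:
  fixes a :: "'k::field ^ 'l::{finite, distrib_lattice}"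
  assumes a: "a \<in> hibi_variety"
  obtains t where "\<And>z. t z \<noteq> 0" "a = orbit_point {x. a $ x \<noteq> 0} t"
proof -
  let ?D = "{x. a $ x \<noteq> 0}"
  have D: "sublattice ?D"
    using support_embedded_sublattice[OF a] by (rule embedded_sublatticeD)
  obtain C where C: "maximal_chain_in ?D C"
    using pred_on.Hausdorff by blast
  obtain t where t: "\<And>z. t z \<noteq> 0" "\<And>x. x \<in> C \<Longrightarrow> torus_coordinate t x = a $ x"
    using torus_coordinates_on_chain[of C "($) a"] maxchainD[OF C] by blast
  have "?D \<subseteq> {x. torus_coordinate t x = a $ x}"
  proof (rule maximal_chain_generates[OF D C])
    fix x y
    assume xy: "x \<in> ?D" "y \<in> ?D" "y \<in> {x. torus_coordinate t x = a $ x}"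
      "sup x y \<in> {x. torus_coordinate t x = a $ x}" "inf x y \<in> {x. torus_coordinate t x = a $ x}"
    have "a $ x * a $ y = a $ sup x y * a $ inf x y"
      using a by (auto simp: in_hibi_variety_iff)
    then have "torus_coordinate t x * a $ y = a $ x * a $ y"
      using torus_coordinate_hibi[of t x y] xy by simp
    then show "x \<in> {x. torus_coordinate t x = a $ x}"
      using xy(2) by simp
  qed (use t(2) in auto)
  then have "a = orbit_point ?D t"
    by (auto simp: vec_eq_iff)
  then show ?thesis
    using that t(1) by blast
qed


section \<open>The dimension of the tangent space at a point of an orbit\<close>

lemma subspace_linearised_solutions: "vec.subspace (linearised_solutions (a :: 'k::field ^ 'l::{finite, distrib_lattice}))"
proof (rule vec.subspaceI)
  show "c *s v \<in> linearised_solutions a" if v: "v \<in> linearised_solutions a" for c v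
  proof -
    have "a $ x * (c * v $ y) + c * v $ x * a $ y = a $ sup x y * (c * v $ inf x y) + c * v $ sup x y * a $ inf x y" for x y
    proof -
      have "a $ x * v $ y + v $ x * a $ y = a $ sup x y * v $ inf x y + v $ sup x y * a $ inf x y"
        using v by (simp add: linearised_solutions_def)
      then have "c * (a $ x * v $ y + v $ x * a $ y) = c * (a $ sup x y * v $ inf x y + v $ sup x y * a $ inf x y)"
        by simp
      then show ?thesis
        by (simp add: algebra_simps)
    qed
    then show ?thesis
      by (simp add: linearised_solutions_def)
  qed
  show "v + w \<in> linearised_solutions a" if "v \<in> linearised_solutions a" "w \<in> linearised_solutions a" for v w
  proof -
    have "a $ x * v $ y + v $ x * a $ y + (a $ x * w $ y + w $ x * a $ y)
        = a $ sup x y * v $ inf x y + v $ sup x y * a $ inf x y + (a $ sup x y * w $ inf x y + w $ sup x y * a $ inf x y)" for x y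
      using that by (simp add: linearised_solutions_def)
    then show ?thesis
      by (simp add: linearised_solutions_def algebra_simps)
  qed
qed (simp add: linearised_solutions_def)

definition determined_by :: "'x set \<Rightarrow> ('k::zero ^ 'x::finite) set \<Rightarrow> bool" where
  "determined_by S T \<longleftrightarrow> (\<forall>v\<in>T. (\<forall>s\<in>S. v $ s = 0) \<longrightarrow> v = 0)"

lemma dim_le_card_coordinates:
  fixes T :: "('k::field ^ 'x::finite) set"
  assumes T: "vec.subspace T" and inj: "determined_by S T"
  shows "vec.dim T \<le> card S"
proof (rule ccontr)
  assume "\<not> vec.dim T \<le> card S"
  obtain B where B: "B \<subseteq> T" "vec.independent B" "card B = vec.dim T"
    using vec.basis_exists by metis
  have fin: "finite B"
    using B(2) by (rule vec.finiteI_independent)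
  obtain c where c: "\<exists>b\<in>B. c b \<noteq> 0" "\<And>s. s \<in> S \<Longrightarrow> (\<Sum>b\<in>B. b $ s * c b) = 0"
    using homogeneous_system_solution[of S B "\<lambda>s b. b $ s"] fin B(3) \<open>\<not> vec.dim T \<le> card S\<close> by auto
  have "(\<Sum>b\<in>B. c b *s b) \<in> T"
    using B(1) T by (intro vec.subspace_sum vec.subspace_scale) auto
  moreover have "(\<Sum>b\<in>B. c b *s b) $ s = 0" if "s \<in> S" for s
    using c(2)[OF that] by (simp add: mult.commute)
  ultimately have "(\<Sum>b\<in>B. c b *s b) = 0"
    using inj unfolding determined_by_def by blast
  then show False
    using c(1) B(2) fin by (auto simp: vec.dependent_finite)
qed

lemma dim_ge_card_coordinates:
  fixes T :: "('k::field ^ 'x::finite) set"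
  assumes b: "\<And>s. s \<in> S \<Longrightarrow> b s \<in> T" "\<And>s s'. s \<in> S \<Longrightarrow> s' \<in> S \<Longrightarrow> b s $ s' = (if s' = s then 1 else 0)"
  shows "card S \<le> vec.dim T"
proof -
  have inj: "inj_on b S"
    using b(2) by (intro inj_onI) (metis zero_neq_one)
  have "vec.independent (b ` S)"
  proof
    assume "vec.dependent (b ` S)"
    then obtain u where u: "\<exists>v\<in>b ` S. u v \<noteq> 0" "(\<Sum>v\<in>b ` S. u v *s v) = 0"
      by (auto simp: vec.dependent_finite)
    have "u (b s) = 0" if s: "s \<in> S" for s
    proof -
      have "(\<Sum>v\<in>b ` S. u v *s v) $ s = (\<Sum>s'\<in>S. u (b s') * b s' $ s)"
        using inj by (simp add: sum.reindex)
      also have "\<dots> = (\<Sum>s'\<in>S. if s' = s then u (b s') else 0)"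
        using b(2) s by (intro sum.cong) auto
      also have "\<dots> = u (b s)"
        using s by simp
      finally show ?thesis
        by (simp add: u(2))
    qed
    then show False
      using u(1) by auto
  qed
  then have "card (b ` S) \<le> vec.dim T"
    using b(1) by (intro vec.independent_card_le_dim) auto
  then show ?thesis
    using inj by (simp add: card_image)
qed

lemma noncomparable_distinct:
  fixes x y :: "'l::lattice"
  assumes "noncomparable x y"
  shows "sup x y \<noteq> x" "sup x y \<noteq> y" "inf x y \<noteq> x" "inf x y \<noteq> y" "sup x y \<noteq> inf x y" "x \<noteq> y"
proof -
  have xy: "\<not> x \<le> y" "\<not> y \<le> x"
    using assms by (auto simp: noncomparable_def)
  show "sup x y \<noteq> x" "sup x y \<noteq> y" "inf x y \<noteq> x" "inf x y \<noteq> y" "x \<noteq> y"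
    using xy by (auto simp: sup.absorb_iff1[symmetric] sup.absorb_iff2[symmetric] inf.absorb_iff1[symmetric] inf.absorb_iff2[symmetric])
  show "sup x y \<noteq> inf x y"
    using xy(1) by (metis inf.cobounded2 order_trans sup.cobounded1)
qed

text \<open>
  Diamond by diamond, the number of vertices in \<open>D\<close> decides what a linearised equation says: four
  vertices give a condition inside \<open>D\<close>, a side in \<open>D\<close> identifies the values at the ends of the
  opposite side, a single vertex kills the value at the opposite end of its diagonal.
\<close>
lemma linearised_solutions_iff:
  fixes v :: "'k::field ^ 'l::{finite, distrib_lattice}"
  assumes D: "embedded_sublattice D"
  shows "v \<in> linearised_solutions (orbit_point D (\<lambda>_. 1)) \<longleftrightarrow>
    (\<forall>x\<in>D. \<forall>y\<in>D. v $ x + v $ y = v $ sup x y + v $ inf x y) \<and>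
    (\<forall>x\<in>E_set D. v $ x = 0) \<and> (\<forall>x y. side_step D x y \<longrightarrow> v $ x = v $ y)"
  (is "?L \<longleftrightarrow> ?V \<and> ?E \<and> ?S")
proof -
  have dd: "x \<in> D \<and> y \<in> D \<longleftrightarrow> sup x y \<in> D \<and> inf x y \<in> D" for x y
    using D by (auto simp: embedded_sublattice_def)
  let ?a = "\<lambda>x. if x \<in> D then 1 else 0 :: 'k"
  let ?eq = "\<lambda>x y. ?a x * v $ y + v $ x * ?a y = ?a (sup x y) * v $ inf x y + v $ sup x y * ?a (inf x y)"
  have L: "?L \<longleftrightarrow> (\<forall>x y. ?eq x y)"
    by (simp add: linearised_solutions_def torus_coordinate_def)
  show ?thesis
    unfolding L
  proof (intro iffI conjI)
    assume eq: "\<forall>x y. ?eq x y"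
    show ?V
    proof (intro ballI)
      fix x y assume "x \<in> D" "y \<in> D"
      moreover from this have "sup x y \<in> D" "inf x y \<in> D"
        using dd[of x y] by auto
      ultimately show "v $ x + v $ y = v $ sup x y + v $ inf x y"
        using spec[OF spec[OF eq, of x], of y] by (simp add: add.commute)
    qed
    show ?E
    proof
      fix e assume "e \<in> E_set D"
      then obtain b x y where e: "e \<notin> D" "b \<in> D" "noncomparable x y" "{e, b} \<in> diamond_diagonals x y"
        "diamond_vertices x y \<inter> D = {b}"
        unfolding E_set_def by blast
      have b: "u = b" if "u \<in> {x, y, sup x y, inf x y}" "u \<in> D" for u
        using e(5) that unfolding diamond_vertices_def by blast
      note ne = noncomparable_distinct[OF e(3)]
      have "e = x \<and> b = y \<or> e = y \<and> b = x \<or> e = sup x y \<and> b = inf x y \<or> e = inf x y \<and> b = sup x y"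
        using e(4) unfolding diamond_diagonals_def by (simp add: doubleton_eq_iff)
      then consider "e = x" "b = y" | "e = y" "b = x" | "e = sup x y" "b = inf x y" | "e = inf x y" "b = sup x y"
        by blast
      then show "v $ e = 0"
      proof cases
        case 1
        then have "sup x y \<notin> D" "inf x y \<notin> D"
          using b[of "sup x y"] b[of "inf x y"] ne by auto
        then show ?thesis
          using 1 e(1,2) spec[OF spec[OF eq, of x], of y] by simp
      next
        case 2
        then have "sup x y \<notin> D" "inf x y \<notin> D"
          using b[of "sup x y"] b[of "inf x y"] ne by auto
        then show ?thesis
          using 2 e(1,2) spec[OF spec[OF eq, of x], of y] by simp
      next
        case 3
        then have "x \<notin> D" "y \<notin> D"
          using b[of x] b[of y] ne by auto
        then show ?thesis
          using 3 e(1,2) spec[OF spec[OF eq, of x], of y] by simp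
      next
        case 4
        then have "x \<notin> D" "y \<notin> D"
          using b[of x] b[of y] ne by auto
        then show ?thesis
          using 4 e(1,2) spec[OF spec[OF eq, of x], of y] by simp
      qed
    qed
    show ?S
    proof (intro allI impI)
      fix p q assume "side_step D p q"
      then obtain x y t where s: "p \<notin> D" "q \<notin> D" "({p, q}, t) \<in> diamond_opposite_sides x y" "t \<subseteq> D"
        unfolding side_step_def by blast
      have "({p, q} = {x, sup x y} \<and> inf x y \<in> D \<and> y \<in> D) \<or> ({p, q} = {inf x y, y} \<and> x \<in> D \<and> sup x y \<in> D)
         \<or> ({p, q} = {y, sup x y} \<and> inf x y \<in> D \<and> x \<in> D) \<or> ({p, q} = {inf x y, x} \<and> y \<in> D \<and> sup x y \<in> D)"
      proof -
        have "{p, q} = {x, sup x y} \<and> t = {inf x y, y} \<or> {p, q} = {inf x y, y} \<and> t = {x, sup x y}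
          \<or> {p, q} = {y, sup x y} \<and> t = {inf x y, x} \<or> {p, q} = {inf x y, x} \<and> t = {y, sup x y}"
          using s(3) unfolding diamond_opposite_sides_def by simp
        then show ?thesis
          using s(4) by (elim disjE conjE) simp_all
      qed
      then show "v $ p = v $ q"
        using s(1,2) spec[OF spec[OF eq, of x], of y]
        by (elim disjE conjE) (auto simp: doubleton_eq_iff)
    qed
  next
    assume "?V \<and> ?E \<and> ?S"
    then have V: ?V and E: "\<And>x. x \<in> E_set D \<Longrightarrow> v $ x = 0" and S: "\<And>x y. side_step D x y \<Longrightarrow> v $ x = v $ y"
      by auto
    have half: "?eq x y" if xy: "noncomparable x y" "y \<notin> D" for x y
    proof -
      have step: "side_step D p q" if "({p, q}, t) \<in> diamond_opposite_sides x y" "p \<notin> D" "q \<notin> D" "t \<subseteq> D" for p q t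
        using that xy(1) unfolding side_step_def by blast
      have E': "e \<in> E_set D" if "{e, b} \<in> diamond_diagonals x y" "e \<notin> D" "diamond_vertices x y \<inter> D = {b}" for e b
        using that xy(1) unfolding E_set_def by blast
      have nboth: "\<not> (sup x y \<in> D \<and> inf x y \<in> D)"
        using xy(2) dd by blast
      consider "x \<in> D" "sup x y \<in> D" "inf x y \<notin> D" | "x \<in> D" "sup x y \<notin> D" "inf x y \<in> D"
        | "x \<in> D" "sup x y \<notin> D" "inf x y \<notin> D" | "x \<notin> D" "sup x y \<in> D" "inf x y \<notin> D"
        | "x \<notin> D" "sup x y \<notin> D" "inf x y \<in> D" | "x \<notin> D" "sup x y \<notin> D" "inf x y \<notin> D"
        using nboth by blast
      then show ?thesis
      proof cases
        case 1
        then have "side_step D y (inf x y)"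
          using xy(2) by (intro step[of _ _ "{x, sup x y}"]) (auto simp: diamond_opposite_sides_def insert_commute)
        then show ?thesis
          using 1 xy(2) S by simp
      next
        case 2
        then have "side_step D y (sup x y)"
          using xy(2) by (intro step[of _ _ "{inf x y, x}"]) (auto simp: diamond_opposite_sides_def insert_commute)
        then show ?thesis
          using 2 xy(2) S by simp
      next
        case 3
        then have "y \<in> E_set D"
          using xy(2) by (intro E'[of _ x]) (auto simp: diamond_diagonals_def diamond_vertices_def insert_commute)
        then show ?thesis
          using 3 xy(2) E by simp
      next
        case 4
        then have "inf x y \<in> E_set D"
          using xy(2) by (intro E'[of _ "sup x y"]) (auto simp: diamond_diagonals_def diamond_vertices_def insert_commute)
        then show ?thesis
          using 4 xy(2) E by simp
      next
        case 5
        then have "sup x y \<in> E_set D"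
          using xy(2) by (intro E'[of _ "inf x y"]) (auto simp: diamond_diagonals_def diamond_vertices_def insert_commute)
        then show ?thesis
          using 5 xy(2) E by simp
      next
        case 6
        then show ?thesis
          using xy(2) by simp
      qed
    qed
    show "\<forall>x y. ?eq x y"
    proof (intro allI)
      fix x y
      consider "x \<le> y" | "y \<le> x" | "noncomparable x y" "y \<notin> D" | "noncomparable x y" "x \<notin> D" | "x \<in> D" "y \<in> D"
        by (auto simp: noncomparable_def)
      then show "?eq x y"
      proof cases
        case 3
        then show ?thesis
          by (rule half)
      next
        case 4
        then have "?eq y x"
          by (intro half) (auto simp: noncomparable_def)
        then show ?thesis
          by (simp add: sup.commute[of x y] inf.commute[of x y] add.commute mult.commute)
      next
        case 5
        then show ?thesis
          using V dd[of x y] by (simp add: add.commute)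
      qed (auto simp: sup.absorb1 sup.absorb2 inf.absorb1 inf.absorb2 add.commute mult.commute)
    qed
  qed
qed

lemma side_step_sym:
  assumes "side_step D x y"
  shows "side_step D y x"
proof -
  have "{x, y} = {y, x}"
    by (rule insert_commute)
  then show ?thesis
    using assms unfolding side_step_def by simp
qed

lemma side_class_eq:
  assumes "y \<in> side_class D x"
  shows "side_class D y = side_class D x"
proof -
  have xy: "(side_step D)\<^sup>*\<^sup>* x y"
    using assms by (simp add: side_class_def)
  moreover have "symp (side_step D)"
    by (rule sympI) (rule side_step_sym)
  ultimately have yx: "(side_step D)\<^sup>*\<^sup>* y x"
    using sympD[OF symp_rtranclp] by metis
  show ?thesis
    unfolding side_class_def using rtranclp_trans[OF xy] rtranclp_trans[OF yx] by blast
qed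

lemma side_class_self: "x \<in> side_class D x"
  by (simp add: side_class_def)

lemma side_class_outside:
  assumes "x \<notin> D" "y \<in> side_class D x"
  shows "y \<notin> D"
proof -
  have "(side_step D)\<^sup>*\<^sup>* x y"
    using assms(2) by (simp add: side_class_def)
  then show ?thesis
    using assms(1) by cases (auto simp: side_step_def)
qed

lemma in_Lambda_set_iff:
  fixes C :: "'l::{finite, distrib_lattice} set"
  assumes lin: "\<And>x y. x \<in> C \<Longrightarrow> y \<in> C \<Longrightarrow> x \<le> y \<or> y \<le> x"
  shows "x \<in> Lambda_set C \<longleftrightarrow> (\<forall>c\<in>C. x \<le> c \<or> c \<le> x)"
proof
  assume "x \<in> Lambda_set C"
  then obtain M where "maximal_chain_in UNIV M" "C \<subseteq> M" "x \<in> M"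
    by (auto simp: Lambda_set_def)
  then show "\<forall>c\<in>C. x \<le> c \<or> c \<le> x"
    using maxchainD(2) by blast
next
  assume x: "\<forall>c\<in>C. x \<le> c \<or> c \<le> x"
  define P where "P M \<longleftrightarrow> insert x C \<subseteq> M \<and> pred_on.chain UNIV (<) M" for M
  have "P (insert x C)"
    using x lin by (auto simp: P_def pred_on.chain_def order.strict_iff_order)
  moreover have "finite {M. P M}"
    by simp
  ultimately obtain M where M: "P M" "\<And>N. P N \<Longrightarrow> M \<subseteq> N \<Longrightarrow> N = M"
    using finite_has_maximal[of "{M. P M}"] by auto
  have "maximal_chain_in UNIV M"
    unfolding pred_on.maxchain_def using M by (auto simp: P_def)
  then show "x \<in> Lambda_set C"
    using M(1) by (auto simp: P_def Lambda_set_def)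
qed

text \<open>
  If \<open>x\<close> is incomparable to an element \<open>c\<close> of the chain, then the diamond on \<open>x\<close> and \<open>c\<close> has a side
  in \<open>D\<close> through \<open>c\<close>, unless \<open>x\<close> belongs to \<open>E_set D\<close>. Moving along the opposite side replaces \<open>x\<close>
  by its join or meet with \<open>c\<close>, which is comparable to \<open>c\<close> and to everything in the chain to which
  \<open>x\<close> is comparable.
\<close>
lemma side_class_meets_Z_set:
  fixes D :: "'l::{finite, distrib_lattice} set"
  assumes D: "embedded_sublattice D" and C: "maximal_chain_in D C"
    and "x \<notin> D" "side_class D x \<inter> E_set D = {}"
  shows "side_class D x \<inter> Z_set D C \<noteq> {}"
  using assms(3,4)
proof (induction "card {c \<in> C. noncomparable x c}" arbitrary: x rule: less_induct)
  case less
  note CD = maxchainD(1)[OF C] and lin = maxchainD(2)[OF C]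
  show ?case
  proof (cases "{c \<in> C. noncomparable x c} = {}")
    case True
    then have "x \<in> Lambda_set C"
      using in_Lambda_set_iff[of C x] lin by (auto simp: noncomparable_def)
    then have "x \<in> Z_set D C"
      using less.prems CD side_class_self[of x D] by (auto simp: Z_set_def)
    then show ?thesis
      using side_class_self by blast
  next
    case False
    then obtain c where c: "c \<in> C" "noncomparable x c"
      by auto
    then have cD: "c \<in> D"
      using CD by auto
    have "x \<notin> E_set D"
      using less.prems(2) side_class_self by blast
    then have "diamond_vertices x c \<inter> D \<noteq> {c}"
      using less.prems(1) c cD unfolding E_set_def diamond_diagonals_def by blast
    then have one: "sup x c \<in> D \<or> inf x c \<in> D"
      using less.prems(1) cD by (auto simp: diamond_vertices_def)
    have both: "\<not> (sup x c \<in> D \<and> inf x c \<in> D)"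
      using D less.prems(1) by (auto simp: embedded_sublattice_def)
    define y where "y = (if sup x c \<in> D then inf x c else sup x c)"
    have step: "side_step D x y"
    proof (cases "sup x c \<in> D")
      case True
      then have "({x, y}, {c, sup x c}) \<in> diamond_opposite_sides x c"
        by (simp add: y_def diamond_opposite_sides_def insert_commute)
      then show ?thesis
        using True both less.prems(1) c cD unfolding side_step_def y_def by fastforce
    next
      case False
      then have "({x, y}, {inf x c, c}) \<in> diamond_opposite_sides x c"
        by (simp add: y_def diamond_opposite_sides_def)
      then show ?thesis
        using False one less.prems(1) c cD unfolding side_step_def y_def by fastforce
    qed
    have y: "y \<in> side_class D x" "y \<notin> D"
      using step by (auto simp: side_class_def) (auto simp: side_step_def)
    have "card {d \<in> C. noncomparable y d} < card {d \<in> C. noncomparable x d}"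
    proof (rule psubset_card_mono)
      have "\<not> noncomparable y c"
        by (auto simp: y_def noncomparable_def)
      moreover have "\<not> noncomparable y d" if d: "d \<in> C" "\<not> noncomparable x d" for d
      proof -
        have "d \<le> c \<or> c \<le> d"
          using lin d(1) c(1) by blast
        then show ?thesis
          using d(2) c(2) unfolding y_def noncomparable_def
          by (auto intro: le_infI1 le_infI2 le_supI1 le_supI2 dest: order_trans)
      qed
      ultimately show "{d \<in> C. noncomparable y d} \<subset> {d \<in> C. noncomparable x d}"
        using c by blast
    qed simp
    then show ?thesis
      using less.hyps[of y] y less.prems(2) side_class_eq[OF y(1)] by simp
  qed
qed

lemma G_set_eq:
  fixes D :: "'l::{finite, distrib_lattice} set"
  assumes D: "embedded_sublattice D" and C: "maximal_chain_in D C"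
  shows "G_set D C = {side_class D x | x. x \<notin> D \<and> side_class D x \<inter> E_set D = {}}"
proof -
  have "x \<notin> D" if "x \<in> Z_set D C" for x
  proof
    assume "x \<in> D"
    moreover have "\<forall>c\<in>C. x \<le> c \<or> c \<le> x"
      using that in_Lambda_set_iff[of C x] maxchainD(2)[OF C] by (auto simp: Z_set_def)
    ultimately have "x \<in> C"
      using maxchain_memI[OF C] by blast
    then show False
      using that by (simp add: Z_set_def)
  qed
  moreover have "\<exists>y. side_class D x = side_class D y \<and> y \<in> Z_set D C"
    if x: "x \<notin> D" "side_class D x \<inter> E_set D = {}" for x
  proof -
    obtain y where "y \<in> side_class D x" "y \<in> Z_set D C"
      using side_class_meets_Z_set[OF D C x] by blast
    then show ?thesis
      using side_class_eq by blast
  qed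
  ultimately show ?thesis
    unfolding G_set_def by (intro Collect_cong) metis
qed

text \<open>Translation by the torus element \<open>t\<close> is linear and preserves the Hibi equations.\<close>
lemma linearised_solutions_orbit:
  fixes t :: "'l::{finite, distrib_lattice} ji \<Rightarrow> 'k::field"
  assumes t: "\<And>z. t z \<noteq> 0"
  shows "(\<chi> x. torus_coordinate t x * v $ x) \<in> linearised_solutions (orbit_point D t)
    \<longleftrightarrow> v \<in> linearised_solutions (orbit_point D (\<lambda>_. 1))"
proof -
  let ?a = "\<lambda>x. if x \<in> D then 1 else 0 :: 'k" and ?t = "torus_coordinate t"
  have nz: "?t x \<noteq> 0" for x
    using t by (rule torus_coordinate_nonzero)
  have a1: "orbit_point D (\<lambda>_. 1) $ x = ?a x" "orbit_point D t $ x = ?t x * ?a x" for x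
    by (auto simp: torus_coordinate_def)
  have "(?t x * ?a x * (?t y * v $ y) + ?t x * v $ x * (?t y * ?a y)
        = ?t (sup x y) * ?a (sup x y) * (?t (inf x y) * v $ inf x y)
        + ?t (sup x y) * v $ sup x y * (?t (inf x y) * ?a (inf x y)))
     \<longleftrightarrow> ?a x * v $ y + v $ x * ?a y = ?a (sup x y) * v $ inf x y + v $ sup x y * ?a (inf x y)" (is "?l = ?r \<longleftrightarrow> _") for x y
  proof -
    have "?l = ?t x * ?t y * (?a x * v $ y + v $ x * ?a y)"
      by (simp only: algebra_simps)
    moreover have "?r = ?t x * ?t y * (?a (sup x y) * v $ inf x y + v $ sup x y * ?a (inf x y))"
      unfolding torus_coordinate_hibi[of t x y] by (simp only: algebra_simps)
    ultimately show ?thesis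
      using nz[of x] nz[of y] by (simp only: mult_cancel_left) simp
  qed
  then show ?thesis
    by (simp only: linearised_solutions_def mem_Collect_eq a1 vec_lambda_beta)
qed

text \<open>
  Coordinates on the tangent space: the elements of the chain, which determine the part inside \<open>D\<close>,
  and one representative of each class that avoids \<open>E_set D\<close>. They are independent. For \<open>s\<close> in the
  chain, the indicator of \<open>z \<le> x\<close> minus that of \<open>w \<le> x\<close> is a solution, where \<open>z\<close> enters the order
  ideals of the chain at \<open>s\<close> and \<open>w\<close> just after \<open>s\<close>; it is \<open>1\<close> at \<open>s\<close> and \<open>0\<close> at the other elements
  of the chain. For the representative of a class, the indicator of the class is a solution.
\<close>
theorem tangent_coordinates:
  fixes t :: "'l::{finite, distrib_lattice} ji \<Rightarrow> 'k::field"
  assumes D: "embedded_sublattice D" and C: "maximal_chain_in D C" and t: "\<And>z. t z \<noteq> 0"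
  defines "T \<equiv> linearised_solutions (orbit_point D t)"
  obtains S where "card S = card C + card (G_set D C)"
    "determined_by S T" "vec.dim T = card S"
proof -
  let ?t = "torus_coordinate t" and ?T1 = "linearised_solutions (orbit_point D (\<lambda>_. 1 :: 'k))"
  have nz: "?t x \<noteq> 0" for x
    using t by (rule torus_coordinate_nonzero)
  note CD = maxchainD(1)[OF C] and lin = maxchainD(2)[OF C]
  have DD: "sup x y \<in> D" "inf x y \<in> D" if "x \<in> D" "y \<in> D" for x y
    using embedded_sublatticeD[OF D] that by (auto simp: sublattice_def)
  let ?G = "{side_class D x | x. x \<notin> D \<and> side_class D x \<inter> E_set D = {}}"
  define rep where "rep K = (SOME x. x \<in> K)" for K :: "'l set"
  have rep: "rep K \<in> K" "rep K \<notin> D" "K \<inter> E_set D = {}" "side_class D (rep K) = K" if K: "K \<in> ?G" for K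
  proof -
    obtain x where x: "K = side_class D x" "x \<notin> D" "side_class D x \<inter> E_set D = {}"
      using K by auto
    show "rep K \<in> K"
      unfolding rep_def x(1) using side_class_self by (rule someI)
    then show "rep K \<notin> D" "K \<inter> E_set D = {}" "side_class D (rep K) = K"
      using x side_class_outside side_class_eq by blast+
  qed
  have inj: "inj_on rep ?G"
    using rep(4) by (rule inj_on_inverseI)
  define S where "S = C \<union> rep ` ?G"
  have "C \<inter> rep ` ?G = {}"
    using CD rep(2) by blast
  then have card: "card S = card C + card (G_set D C)"
    unfolding S_def G_set_eq[OF D C] using inj by (simp add: card_Un_disjoint card_image)
  have zero1: "v = 0" if v: "v \<in> ?T1" "\<And>s. s \<in> S \<Longrightarrow> v $ s = 0" for v
  proof -
    have V: "\<forall>x\<in>D. \<forall>y\<in>D. v $ x + v $ y = v $ sup x y + v $ inf x y"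
      and E: "\<forall>x\<in>E_set D. v $ x = 0" and step: "\<forall>x y. side_step D x y \<longrightarrow> v $ x = v $ y"
      using v(1) unfolding linearised_solutions_iff[OF D] by auto
    have "D \<subseteq> {x. v $ x = 0}"
    proof (rule maximal_chain_generates[OF embedded_sublatticeD[OF D] C])
      show "C \<subseteq> {x. v $ x = 0}"
        using v(2) by (auto simp: S_def)
      show "x \<in> {x. v $ x = 0}" if "x \<in> D" "y \<in> D" "y \<in> {x. v $ x = 0}"
        "sup x y \<in> {x. v $ x = 0}" "inf x y \<in> {x. v $ x = 0}" for x y
        using that bspec[OF bspec[OF V that(1)] that(2)] by simp
    qed
    moreover have "v $ x = 0" if "x \<notin> D" for x
    proof -
      have const: "v $ y = v $ x" if "y \<in> side_class D x" for x y
        using that unfolding side_class_def mem_Collect_eq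
        by (induction rule: rtranclp_induct) (use step in auto)
      show ?thesis
      proof (cases "side_class D x \<inter> E_set D = {}")
        case True
        then have "side_class D x \<in> ?G"
          using that by auto
        then have "rep (side_class D x) \<in> side_class D x" "rep (side_class D x) \<in> S"
          using rep(1) by (auto simp: S_def)
        then show ?thesis
          using const[of "rep (side_class D x)" x] v(2) by simp
      next
        case False
        then show ?thesis
          using const E by (metis disjoint_iff)
      qed
    qed
    ultimately show ?thesis
      by (auto simp: vec_eq_iff)
  qed
  have dual1: "\<exists>b. b \<in> ?T1 \<and> (\<forall>s'\<in>S. b $ s' = (if s' = s then 1 else 0))" if s: "s \<in> S" for s
  proof -
    consider "s \<in> C" | K where "K \<in> ?G" "s = rep K"
      using s by (auto simp: S_def)
    then show ?thesis
    proof cases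
      case 1
      obtain z where z: "\<And>d. d \<in> C \<Longrightarrow> Rep_ji z \<le> d \<longleftrightarrow> s \<le> d"
        using chain_separating_ji[OF lin 1] by blast
      obtain w where w: "\<And>d. d \<in> C \<Longrightarrow> (case w of None \<Rightarrow> False | Some w \<Rightarrow> Rep_ji w \<le> d) \<longleftrightarrow> s < d"
        using chain_separating_ji_strict[OF lin 1] by blast
      let ?z = "\<lambda>d. if Rep_ji z \<le> d then 1 else 0 :: 'k"
        and ?w = "\<lambda>d. if (case w of None \<Rightarrow> False | Some w \<Rightarrow> Rep_ji w \<le> d) then 1 else 0 :: 'k"
      define u where "u d = ?z d - ?w d" for d
      define b :: "'k ^ 'l::{finite, distrib_lattice}" where "b = (\<chi> d. if d \<in> D then u d else 0)"
      have zv: "?z x + ?z y = ?z (sup x y) + ?z (inf x y)" for x y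
        by auto
      have wv: "?w x + ?w y = ?w (sup x y) + ?w (inf x y)" for x y
        by (cases w) auto
      have uv: "u x + u y = u (sup x y) + u (inf x y)" for x y
      proof -
        have "u x + u y = (?z x + ?z y) - (?w x + ?w y)"
          unfolding u_def by (rule add_diff_add[symmetric])
        also have "\<dots> = u (sup x y) + u (inf x y)"
          unfolding zv[of x y] wv[of x y] unfolding u_def by (rule add_diff_add)
        finally show ?thesis .
      qed
      have "b \<in> ?T1"
        unfolding linearised_solutions_iff[OF D]
      proof (intro conjI ballI allI impI)
        show "b $ x + b $ y = b $ sup x y + b $ inf x y" if "x \<in> D" "y \<in> D" for x y
          using that DD[OF that] uv[of x y] by (simp add: b_def)
        show "b $ x = 0" if "x \<in> E_set D" for x
          using that by (simp add: b_def E_set_def)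
        show "b $ x = b $ y" if "side_step D x y" for x y
          using that by (simp add: b_def side_step_def)
      qed
      moreover have "b $ s' = (if s' = s then 1 else 0)" if "s' \<in> S" for s'
      proof (cases "s' \<in> C")
        case True
        then show ?thesis
          using z[OF True] w[OF True] CD by (auto simp: b_def u_def order.order_iff_strict)
      next
        case False
        then have "s' \<notin> D" "s' \<noteq> s"
          using that rep(2) 1 by (auto simp: S_def)
        then show ?thesis
          by (simp add: b_def)
      qed
      ultimately show ?thesis
        by blast
    next
      case 2
      define b :: "'k ^ 'l::{finite, distrib_lattice}" where "b = (\<chi> x. if x \<in> K then 1 else 0)"
      have out: "x \<notin> D" if "x \<in> K" for x
        using side_class_outside[of "rep K" D x] rep(2,4)[OF 2(1)] that by auto
      have "x \<in> K \<longleftrightarrow> y \<in> K" if xy: "side_step D x y" for x y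
      proof -
        have mem: "u \<in> K \<longleftrightarrow> side_class D u = K" for u
          using side_class_eq[of u D "rep K"] rep(4)[OF 2(1)] side_class_self[of u D] by auto
        have "y \<in> side_class D x"
          using xy by (simp add: side_class_def)
        then have "side_class D y = side_class D x"
          by (rule side_class_eq)
        then show ?thesis
          by (simp add: mem)
      qed
      then have b_step: "b $ x = b $ y" if "side_step D x y" for x y
        using that by (simp add: b_def)
      have "b \<in> ?T1"
        unfolding linearised_solutions_iff[OF D]
      proof (intro conjI ballI allI impI)
        show "b $ x + b $ y = b $ sup x y + b $ inf x y" if "x \<in> D" "y \<in> D" for x y
        proof -
          have "sup x y \<in> D" "inf x y \<in> D"
            using DD[OF that] by auto
          then have "x \<notin> K" "y \<notin> K" "sup x y \<notin> K" "inf x y \<notin> K"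
            using out that by blast+
          then show ?thesis
            by (simp add: b_def)
        qed
        show "b $ x = 0" if "x \<in> E_set D" for x
          using that rep(3)[OF 2(1)] by (auto simp: b_def)
        show "b $ x = b $ y" if "side_step D x y" for x y
          using b_step[OF that] .
      qed
      moreover have "b $ s' = (if s' = s then 1 else 0)" if s': "s' \<in> S" for s'
      proof (cases "s' \<in> C")
        case True
        then show ?thesis
          using CD out rep(2)[OF 2(1)] 2(2) by (auto simp: b_def)
      next
        case False
        then obtain K' where K': "K' \<in> ?G" "s' = rep K'"
          using s' by (auto simp: S_def)
        have "s' \<in> K \<longleftrightarrow> K' = K"
          using rep(1,4)[OF K'(1)] rep(1,4)[OF 2(1)] side_class_eq K'(2) by metis
        then show ?thesis
          using inj_onD[OF inj, of K' K] K' 2 by (auto simp: b_def)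
      qed
      ultimately show ?thesis
        by blast
    qed
  qed
  (* the torus element t carries the tangent space at the distinguished point to T *)
  have zero: "v = 0" if v: "v \<in> T" "\<And>s. s \<in> S \<Longrightarrow> v $ s = 0" for v
  proof -
    define u where "u = (\<chi> x. v $ x / ?t x)"
    have "v = (\<chi> x. ?t x * u $ x)"
      using nz by (simp add: u_def vec_eq_iff)
    then have "u \<in> ?T1"
      using v(1) linearised_solutions_orbit[OF t, where v = u and D = D] by (simp add: T_def)
    then have "u = 0"
      using zero1[of u] v(2) by (simp add: u_def)
    then show ?thesis
      using nz by (simp add: u_def vec_eq_iff)
  qed
  then have determined: "determined_by S T"
    by (simp add: determined_by_def)
  obtain b where b: "\<And>s. s \<in> S \<Longrightarrow> b s \<in> ?T1" "\<And>s s'. s \<in> S \<Longrightarrow> s' \<in> S \<Longrightarrow> b s $ s' = (if s' = s then 1 else 0)"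
    using dual1 by metis
  have "card S \<le> vec.dim T"
  proof (rule dim_ge_card_coordinates)
    fix s assume s: "s \<in> S"
    have "(\<chi> x. ?t x * ((1 / ?t s) *s b s) $ x) \<in> T"
      unfolding T_def linearised_solutions_orbit[OF t]
      using b(1)[OF s] by (intro vec.subspace_scale subspace_linearised_solutions)
    then show "(\<chi> x. ?t x * ((1 / ?t s) *s b s) $ x) \<in> T" .
  next
    fix s s' assume "s \<in> S" "s' \<in> S"
    then show "(\<chi> x. ?t x * ((1 / ?t s) *s b s) $ x) $ s' = (if s' = s then 1 else 0)"
      using b(2)[of s s'] nz by simp
  qed
  moreover have "vec.dim T \<le> card S"
    using determined by (intro dim_le_card_coordinates) (simp_all add: T_def subspace_linearised_solutions)
  ultimately have "vec.dim T = card S"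
    by simp
  then show ?thesis
    using that[of S] card determined by blast
qed


section \<open>Semicontinuity of the tangent dimension along an orbit closure\<close>

text \<open>
  Injectivity of the restriction to the coordinates in \<open>S\<close> is an open condition: it says that the
  matrix of the linearised equations, extended by the unit vectors of \<open>S\<close>, has a left inverse \<open>B\<close>,
  and at other points it holds as long as the determinant of the product with \<open>B\<close> does not vanish.
  Openness and density of the orbit transfer the condition to a point of the orbit.
\<close>
lemma coordinates_injective_on_orbit:
  fixes q :: "'k::alg_closed_field ^ 'l::{finite, distrib_lattice}"
  assumes D: "sublattice D" and q: "q \<in> hibi_subvariety D"
    and inj: "determined_by S (linearised_solutions q)"
  obtains t :: "'l ji \<Rightarrow> 'k" where "\<forall>z. t z \<noteq> 0"
    "determined_by S (linearised_solutions (orbit_point D t))"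
proof -
  define coef where "coef a r c = (case r of
      Inl (x, y) \<Rightarrow> a $ x * (if c = y then 1 else 0) + a $ y * (if c = x then 1 else 0)
        - (a $ sup x y * (if c = inf x y then 1 else 0) + a $ inf x y * (if c = sup x y then 1 else 0))
    | Inr s \<Rightarrow> if s \<in> S \<and> c = s then 1 else 0)" for a :: "'k ^ 'l::{finite, distrib_lattice}" and r c
  define A where "A a = (\<chi> r c. coef a r c)" for a
  have row_eq: "(A a *v v) $ Inl (x, y)
      = a $ x * v $ y + v $ x * a $ y - (a $ sup x y * v $ inf x y + v $ sup x y * a $ inf x y)" for a v x y
  proof -
    have "(A a *v v) $ Inl (x, y) = (\<Sum>c\<in>UNIV. a $ x * (if c = y then v $ c else 0) + a $ y * (if c = x then v $ c else 0)
        - (a $ sup x y * (if c = inf x y then v $ c else 0) + a $ inf x y * (if c = sup x y then v $ c else 0)))"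
      unfolding matrix_vector_mult_def A_def coef_def vec_lambda_beta
      by (intro sum.cong) (simp_all add: algebra_simps)
    also have "\<dots> = a $ x * v $ y + v $ x * a $ y - (a $ sup x y * v $ inf x y + v $ sup x y * a $ inf x y)"
      by (simp add: sum.distrib sum_subtractf sum_distrib_left[symmetric] mult.commute)
    finally show ?thesis .
  qed
  have row_unit: "(A a *v v) $ Inr s = (if s \<in> S then v $ s else 0)" for a v s
  proof -
    have "(A a *v v) $ Inr s = (\<Sum>c\<in>UNIV. if c = s then (if s \<in> S then v $ s else 0) else 0)"
      unfolding matrix_vector_mult_def A_def coef_def vec_lambda_beta
      by (intro sum.cong) auto
    then show ?thesis
      by simp
  qed
  have kernel: "A a *v v = 0 \<longleftrightarrow> v \<in> linearised_solutions a \<and> (\<forall>s\<in>S. v $ s = 0)" for a v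
  proof -
    have "A a *v v = 0 \<longleftrightarrow> (\<forall>p. (A a *v v) $ Inl p = 0) \<and> (\<forall>s. (A a *v v) $ Inr s = 0)"
      by (simp add: vec_eq_iff split_sum_all)
    then show ?thesis
      by (auto simp: split_paired_all row_eq row_unit linearised_solutions_def)
  qed
  have "\<forall>v. A q *v v = 0 \<longrightarrow> v = 0"
    using inj by (simp add: kernel determined_by_def)
  then have "\<exists>B. B ** A q = mat 1"
    by (simp only: matrix_left_invertible_ker)
  then obtain B where B: "B ** A q = mat 1" ..
  define F where "F a = det (B ** A a)" for a
  have "polynomial_function (\<lambda>a. coef a r c)" for r c
  proof (cases r)
    case (Inl p)
    obtain x y where p: "p = (x, y)"
      by (cases p)
    have "(\<lambda>a. coef a r c) = (\<lambda>a. a $ x * (if c = y then 1 else 0) + a $ y * (if c = x then 1 else 0)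
        + - (a $ sup x y * (if c = inf x y then 1 else 0) + a $ inf x y * (if c = sup x y then 1 else 0)))"
      unfolding coef_def Inl p by (intro ext) (simp only: sum.case prod.case diff_conv_add_uminus)
    moreover have "polynomial_function (\<lambda>a. a $ x * (if c = y then 1 else 0) + a $ y * (if c = x then 1 else 0)
        + - (a $ sup x y * (if c = inf x y then 1 else 0) + a $ inf x y * (if c = sup x y then 1 else 0)))"
      by (intro polynomial_function_add polynomial_function_uminus polynomial_function_mult
          polynomial_function_coordinate polynomial_function_const)
    ultimately show ?thesis
      by simp
  next
    case (Inr s)
    then show ?thesis
      by (simp add: coef_def polynomial_function_const)
  qed
  then have "polynomial_function F"
    unfolding F_def det_def matrix_matrix_mult_def A_def vec_lambda_beta
    by (intro polynomial_function_sum polynomial_function_prod polynomial_function_mult polynomial_function_const)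
  moreover have "F q \<noteq> 0"
    by (simp add: F_def B)
  ultimately have "\<not> (\<forall>t. (\<forall>z. t z \<noteq> 0) \<longrightarrow> F (orbit_point D t) = 0)"
    using orbit_dense[OF D, of F q] q by metis
  then obtain t where t: "\<And>z. t z \<noteq> 0" "F (orbit_point D t) \<noteq> 0"
    by auto
  show ?thesis
  proof (rule that[of t])
    show "\<forall>z. t z \<noteq> 0"
      using t(1) by blast
    show "determined_by S (linearised_solutions (orbit_point D t))"
      unfolding determined_by_def
    proof (intro ballI impI)
      fix v
      assume v: "v \<in> linearised_solutions (orbit_point D t)" "\<forall>s\<in>S. v $ s = 0"
      then have "A (orbit_point D t) *v v = 0"
        by (simp add: kernel)
      then have "(B ** A (orbit_point D t)) *v v = 0"
        by (simp add: matrix_vector_mul_assoc[symmetric] matrix_vector_mult_0_right)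
      moreover have "invertible (B ** A (orbit_point D t))"
        using t(2) by (simp add: F_def invertible_det_nz)
      then have "\<exists>B'. B' ** (B ** A (orbit_point D t)) = mat 1"
        by (auto simp: invertible_def)
      then have "\<forall>v. (B ** A (orbit_point D t)) *v v = 0 \<longrightarrow> v = 0"
        by (simp only: matrix_left_invertible_ker)
      ultimately show "v = 0"
        by simp
    qed
  qed
qed

lemma tangent_coordinates_at_point:
  fixes q :: "'k::alg_closed_field ^ 'l::{finite, distrib_lattice}"
  assumes q: "q \<in> hibi_variety" and C: "maximal_chain_in {x. q $ x \<noteq> 0} C"
  obtains S where "card S = card C + card (G_set {x. q $ x \<noteq> 0} C)"
    "determined_by S (linearised_solutions q)" "vec.dim (tangent_space hibi_variety q) = card S"
proof -
  let ?D = "{x. q $ x \<noteq> 0}"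
  obtain t where t: "\<And>z. t z \<noteq> 0" "q = orbit_point ?D t"
    using point_in_orbit[OF q] by blast
  have T: "tangent_space hibi_variety q = linearised_solutions (orbit_point ?D t)"
    using tangent_space_hibi_variety[OF q] t(2) by simp
  obtain S where "card S = card C + card (G_set ?D C)"
    "determined_by S (linearised_solutions (orbit_point ?D t))"
    "vec.dim (linearised_solutions (orbit_point ?D t)) = card S"
    by (rule tangent_coordinates[OF support_embedded_sublattice[OF q] C t(1)])
  then show ?thesis
    using that[of S] T t(2) by simp
qed

text \<open>Coordinates that determine the tangent vectors at \<open>q\<close> also do so at some point of the orbit.\<close>
theorem tangent_dim_on_orbit_closure:
  fixes q :: "'k::alg_closed_field ^ 'l::{finite, distrib_lattice}"
  assumes D: "embedded_sublattice D" and C: "maximal_chain_in D C" and q: "q \<in> hibi_subvariety D"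
  shows "card C + card (G_set D C) \<le> vec.dim (tangent_space hibi_variety q)"
proof -
  have qX: "q \<in> hibi_variety"
    using hibi_subvariety_subset[OF D] q by blast
  obtain C' where C': "maximal_chain_in {x. q $ x \<noteq> 0} C'"
    using pred_on.Hausdorff by blast
  obtain S where S: "vec.dim (tangent_space hibi_variety q) = card S"
    "determined_by S (linearised_solutions q)"
    by (rule tangent_coordinates_at_point[OF qX C'])
  obtain t :: "'l ji \<Rightarrow> 'k" where t: "\<forall>z. t z \<noteq> 0"
    "determined_by S (linearised_solutions (orbit_point D t))"
    by (rule coordinates_injective_on_orbit[OF embedded_sublatticeD[OF D] q S(2)])
  have "vec.dim (linearised_solutions (orbit_point D t)) \<le> card S"
    by (rule dim_le_card_coordinates[OF subspace_linearised_solutions t(2)])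
  moreover have "vec.dim (linearised_solutions (orbit_point D t)) = card C + card (G_set D C)"
    by (rule tangent_coordinates[OF D C t(1)[rule_format]]) simp
  ultimately show ?thesis
    using S(1) by simp
qed

text \<open>
  On the open orbit the sums of coefficients over order ideals are independent solutions of the
  linearised equations, one for each join-irreducible element.
\<close>
theorem tangent_dim_ge_card_ji:
  fixes q :: "'k::alg_closed_field ^ 'l::{finite, distrib_lattice}"
  assumes q: "q \<in> hibi_variety"
  shows "CARD('l ji) \<le> vec.dim (tangent_space hibi_variety q)"
proof (rule ccontr)
  obtain C where C: "maximal_chain_in {x. q $ x \<noteq> 0} C"
    using pred_on.Hausdorff by blast
  obtain S where S: "vec.dim (tangent_space hibi_variety q) = card S"
    "determined_by S (linearised_solutions q)"
    by (rule tangent_coordinates_at_point[OF q C])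
  have q': "q \<in> hibi_subvariety UNIV"
    using q by (simp add: hibi_subvariety_UNIV)
  obtain t :: "'l ji \<Rightarrow> 'k" where t: "\<forall>z. t z \<noteq> 0"
    "determined_by S (linearised_solutions (orbit_point UNIV t))"
    by (rule coordinates_injective_on_orbit[OF embedded_sublatticeD[OF embedded_sublattice_UNIV] q' S(2)])
  assume "\<not> CARD('l ji) \<le> vec.dim (tangent_space hibi_variety q)"
  then have "card S < CARD('l ji)"
    using S(1) by simp
  then obtain c :: "'l ji \<Rightarrow> 'k" where c: "\<exists>z. c z \<noteq> 0"
    "\<And>s. s \<in> S \<Longrightarrow> (\<Sum>z\<in>UNIV. (if Rep_ji z \<le> s then 1 else 0) * c z) = 0"
    using homogeneous_system_solution[of S UNIV "\<lambda>s z. if Rep_ji z \<le> s then 1 else 0"] by auto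
  define u :: "'k ^ 'l::{finite, distrib_lattice}" where "u = (\<chi> x. \<Sum>z | Rep_ji z \<le> x. c z)"
  have "u $ x + u $ y = u $ sup x y + u $ inf x y" for x y
  proof -
    have "{z. Rep_ji z \<le> sup x y} = {z. Rep_ji z \<le> x} \<union> {z. Rep_ji z \<le> y}"
      "{z. Rep_ji z \<le> inf x y} = {z. Rep_ji z \<le> x} \<inter> {z. Rep_ji z \<le> y}"
      by auto
    then show ?thesis
      unfolding u_def by (simp add: sum.union_inter)
  qed
  then have "u \<in> linearised_solutions (orbit_point UNIV (\<lambda>_. 1))"
    by (simp add: linearised_solutions_def torus_coordinate_def add.commute)
  then have "(\<chi> x. torus_coordinate t x * u $ x) \<in> linearised_solutions (orbit_point UNIV t)"
    by (simp only: linearised_solutions_orbit[OF t(1)[rule_format]])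
  moreover have "u $ s = 0" if "s \<in> S" for s
    using c(2)[OF that] by (simp add: u_def sum.If_cases if_distrib[of "\<lambda>e. e * _"] cong: if_cong)
  ultimately have "(\<chi> x. torus_coordinate t x * u $ x) = 0"
    using t(2) by (simp add: determined_by_def)
  then have "torus_coordinate t x * u $ x = 0" for x
    by (simp add: vec_eq_iff)
  moreover have "torus_coordinate t x \<noteq> 0" for x
    using t(1) by (intro torus_coordinate_nonzero) blast
  ultimately have u0: "u $ x = 0" for x
    by simp
  have "c z = 0" for z
  proof (induction "card {w. Rep_ji w \<le> Rep_ji z}" arbitrary: z rule: less_induct)
    case less
    let ?Z = "{w. Rep_ji w \<le> Rep_ji z}"
    have "c w = 0" if "w \<in> ?Z - {z}" for w
    proof (rule less.hyps)
      have "Rep_ji w < Rep_ji z"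
        using that by (auto simp: order.strict_iff_order Rep_ji_inject)
      then have "{v. Rep_ji v \<le> Rep_ji w} \<subseteq> ?Z" "z \<in> ?Z" "z \<notin> {v. Rep_ji v \<le> Rep_ji w}"
        by auto
      then show "card {v. Rep_ji v \<le> Rep_ji w} < card ?Z"
        by (intro psubset_card_mono) auto
    qed
    then have "(\<Sum>w\<in>?Z. c w) = c z"
      by (subst sum.remove[of _ z]) auto
    then show ?case
      using u0[of "Rep_ji z"] by (simp add: u_def)
  qed
  then show False
    using c(1) by simp
qed


section \<open>The Krull dimension\<close>

subsection \<open>Upper bound: counting weights\<close>

definition total_degree_le :: "nat \<Rightarrow> ('x::finite, 'k::zero) mpoly \<Rightarrow> bool" where
  "total_degree_le d p \<longleftrightarrow> (\<forall>m\<in>Poly_Mapping.keys p. (\<Sum>x\<in>UNIV. Poly_Mapping.lookup m x) \<le> d)"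

lemma total_degree_le_exists: "\<exists>d. total_degree_le d p"
  unfolding total_degree_le_def
  by (rule exI[of _ "Max ((\<lambda>m. \<Sum>x\<in>UNIV. Poly_Mapping.lookup m x) ` Poly_Mapping.keys p)"]) auto

lemma total_degree_le_mono: "total_degree_le d p \<Longrightarrow> d \<le> e \<Longrightarrow> total_degree_le e p"
  by (auto simp: total_degree_le_def)

lemma total_degree_le_one: "total_degree_le 0 (1 :: ('x::finite, 'k::zero_neq_one) mpoly)"
  by (auto simp: total_degree_le_def)

lemma total_degree_le_mult:
  fixes p q :: "('x::finite, 'k::comm_ring_1) mpoly"
  assumes "total_degree_le d p" "total_degree_le e q"
  shows "total_degree_le (d + e) (p * q)"
  unfolding total_degree_le_def
proof
  fix m assume "m \<in> Poly_Mapping.keys (p * q)"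
  then obtain m1 m2 where "m = m1 + m2" "m1 \<in> Poly_Mapping.keys p" "m2 \<in> Poly_Mapping.keys q"
    using keys_mult[of p q] by blast
  then show "(\<Sum>x\<in>UNIV. Poly_Mapping.lookup m x) \<le> d + e"
    using assms by (auto simp: total_degree_le_def lookup_add sum.distrib intro: add_mono)
qed

lemma total_degree_le_power:
  fixes p :: "('x::finite, 'k::comm_ring_1) mpoly"
  assumes "total_degree_le d p"
  shows "total_degree_le (n * d) (p ^ n)"
  using assms by (induction n) (auto simp: total_degree_le_one intro: total_degree_le_mult)

text \<open>
  On the Hibi variety a monomial depends only on its weight, and the weights of total degree at
  most \<open>d\<close> are bounded by \<open>d\<close> in each of their components. So there are fewer weights than
  polynomials.
\<close>
lemma polynomials_dependent_on_hibi_variety: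
  fixes p :: "'i \<Rightarrow> ('l::{finite, distrib_lattice}, 'k::field) mpoly"
  assumes I: "finite I" and deg: "\<And>i. i \<in> I \<Longrightarrow> total_degree_le d (p i)"
    and card: "(d + 1) ^ CARD('l ji) < card I"
  obtains c where "\<exists>i\<in>I. c i \<noteq> 0" "\<forall>a\<in>hibi_variety. (\<Sum>i\<in>I. c i * meval (p i) a) = 0"
proof -
  define W where "W = (UNIV :: 'l ji set) \<rightarrow>\<^sub>E {..d}"
  have W: "finite W" "card W = (d + 1) ^ CARD('l ji)"
    by (simp_all add: W_def finite_PiE card_PiE)
  define A where "A w i = (\<Sum>m | m \<in> Poly_Mapping.keys (p i) \<and> weight m = w. Poly_Mapping.lookup (p i) m)" for w i
  obtain c where c: "\<exists>i\<in>I. c i \<noteq> 0" "\<And>w. w \<in> W \<Longrightarrow> (\<Sum>i\<in>I. A w i * c i) = 0"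
    using homogeneous_system_solution[of W I A] W I card by auto
  define rep where "rep w = (SOME m. weight m = w)" for w :: "'l ji \<Rightarrow> nat"
  have rep: "weight (rep (weight m)) = weight m" for m
    unfolding rep_def by (rule someI) (rule refl)
  have "(\<Sum>i\<in>I. c i * meval (p i) a) = 0" if a: "a \<in> hibi_variety" for a
  proof -
    have "meval (p i) a = (\<Sum>w\<in>W. A w i * monomial_value (($) a) (rep w))" if i: "i \<in> I" for i
    proof -
      have in_W: "weight m \<in> W" if m: "m \<in> Poly_Mapping.keys (p i)" for m
      proof -
        have "weight m z \<le> (\<Sum>x\<in>UNIV. Poly_Mapping.lookup m x)" for z
          unfolding weight_def by (intro sum_mono2) auto
        then have "weight m z \<le> d" for z
          using deg[OF i] m unfolding total_degree_le_def by (meson order_trans)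
        then show ?thesis
          by (simp add: W_def PiE_UNIV_domain)
      qed
      have "meval (p i) a = (\<Sum>m\<in>Poly_Mapping.keys (p i). Poly_Mapping.lookup (p i) m * monomial_value (($) a) (rep (weight m)))"
        unfolding meval_eq
      proof (intro sum.cong refl)
        fix m
        have "monomial_value (($) a) m = monomial_value (($) a) (rep (weight m))"
          using a by (intro monomial_value_eq_of_weight_eq[of UNIV])
            (auto simp: sublattice_def hibi_multiplicative_on_def in_hibi_variety_iff rep)
        then show "Poly_Mapping.lookup (p i) m * monomial_value (($) a) m
            = Poly_Mapping.lookup (p i) m * monomial_value (($) a) (rep (weight m))"
          by simp
      qed
      also have "\<dots> = (\<Sum>w\<in>W. \<Sum>m | m \<in> Poly_Mapping.keys (p i) \<and> weight m = w.
          Poly_Mapping.lookup (p i) m * monomial_value (($) a) (rep (weight m)))"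
        using W(1) in_W by (intro sum.group[symmetric]) auto
      also have "\<dots> = (\<Sum>w\<in>W. A w i * monomial_value (($) a) (rep w))"
        unfolding A_def sum_distrib_right by (intro sum.cong) auto
      finally show ?thesis .
    qed
    then have "(\<Sum>i\<in>I. c i * meval (p i) a) = (\<Sum>i\<in>I. \<Sum>w\<in>W. monomial_value (($) a) (rep w) * (A w i * c i))"
      by (simp add: sum_distrib_left mult_ac)
    also have "\<dots> = (\<Sum>w\<in>W. monomial_value (($) a) (rep w) * (\<Sum>i\<in>I. A w i * c i))"
      by (subst sum.swap) (simp add: sum_distrib_left)
    also have "\<dots> = 0"
      using c(2) by simp
    finally show ?thesis .
  qed
  then show ?thesis
    using that c(1) by blast
qed

lemma zariski_closed_Int_zero_set:
  assumes "zariski_closed V" "polynomial_function f"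
  shows "zariski_closed (V \<inter> {a. f a = 0})"
proof -
  obtain F p where "V = zero_locus F" "\<forall>a. f a = meval p a"
    using assms by (auto simp: zariski_closed_def polynomial_function_def)
  then have "V \<inter> {a. f a = 0} = zero_locus (insert p F)"
    by (auto simp: zero_locus_def)
  then show ?thesis
    unfolding zariski_closed_def by blast
qed

lemma irreducible_closed_mult_cancel:
  assumes V: "irreducible_closed V" and f: "polynomial_function f" and g: "polynomial_function g"
    and fg: "\<And>a. a \<in> V \<Longrightarrow> f a * g a = (0 :: 'k::field)" and b: "b \<in> V" "f b \<noteq> 0" and "a \<in> V"
  shows "g a = 0"
proof -
  let ?F = "V \<inter> {a. f a = 0}" and ?G = "V \<inter> {a. g a = 0}"
  have "V = ?F \<union> ?G"
    using fg by auto
  moreover have "zariski_closed ?F" "zariski_closed ?G"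
    using V f g by (auto simp: irreducible_closed_def intro: zariski_closed_Int_zero_set)
  ultimately have "V = ?F \<or> V = ?G"
    using V unfolding irreducible_closed_def by blast
  then show ?thesis
    using b \<open>a \<in> V\<close> by blast
qed

text \<open>
  The exponents are listed from the last function to the first, so that an induction on the length
  splits off the function with the greatest index.
\<close>
fun list_monomial :: "(nat \<Rightarrow> 'a::comm_monoid_mult) \<Rightarrow> nat list \<Rightarrow> 'a" where
  "list_monomial f [] = 1"
| "list_monomial f (e # es) = f (length es) ^ e * list_monomial f es"

text \<open>
  Functions \<open>f i\<close> that vanish on \<open>Z i\<close> but not on \<open>Z (i + 1)\<close> are algebraically independent on the top
  of the chain. In a relation on \<open>Z (k + 1)\<close> the lowest power of \<open>f k\<close> can be cancelled; restricting
  the rest to \<open>Z k\<close>, where \<open>f k\<close> vanishes, leaves a relation between the other functions.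
\<close>
lemma chain_functions_independent:
  fixes Z :: "nat \<Rightarrow> ('k::field ^ 'x::finite) set"
  assumes irr: "\<And>i. i \<le> k \<Longrightarrow> irreducible_closed (Z i)" and sub: "\<And>i. i < k \<Longrightarrow> Z i \<subseteq> Z (Suc i)"
    and f0: "\<And>i a. i < k \<Longrightarrow> a \<in> Z i \<Longrightarrow> meval (f i) a = 0"
    and f1: "\<And>i. i < k \<Longrightarrow> \<exists>a\<in>Z (Suc i). meval (f i) a \<noteq> 0"
    and rel: "\<And>a. a \<in> Z k \<Longrightarrow> (\<Sum>es | set es \<subseteq> {..<b} \<and> length es = k. c es * meval (list_monomial f es) a) = 0"
    and es: "set es \<subseteq> {..<b}" "length es = k"
  shows "c es = 0"
  using assms
proof (induction k arbitrary: c es)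
  case 0
  have "{es. set es \<subseteq> {..<b} \<and> length es = 0} = {[]}"
    by auto
  moreover obtain a where "a \<in> Z 0"
    using 0(1)[of 0] by (auto simp: irreducible_closed_def)
  ultimately show ?case
    using 0(5)[of a] 0(7) by simp
next
  case (Suc k)
  define L where "L k = {es. set es \<subseteq> {..<b} \<and> length es = k}" for k
  have finL: "finite (L k)" for k
    unfolding L_def by (rule finite_lists_length_eq) simp
  define g where "g e a = (\<Sum>es\<in>L k. c (e # es) * meval (list_monomial f es) a)" for e a
  have polyg: "polynomial_function (g e)" for e
    unfolding g_def
    by (intro polynomial_function_sum polynomial_function_mult polynomial_function_const)
       (auto simp: polynomial_function_def)
  have polyf: "polynomial_function (meval (f k))"
    by (auto simp: polynomial_function_def)
  have L_Suc: "L (Suc k) = (\<lambda>(e, es). e # es) ` ({..<b} \<times> L k)"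
    by (auto simp: L_def length_Suc_conv)
  have rel: "(\<Sum>e<b. meval (f k) a ^ e * g e a) = 0" if a: "a \<in> Z (Suc k)" for a
  proof -
    have "0 = (\<Sum>es\<in>L (Suc k). c es * meval (list_monomial f es) a)"
      using Suc.prems(5)[OF a] by (simp add: L_def)
    also have "\<dots> = (\<Sum>(e, es)\<in>{..<b} \<times> L k. c (e # es) * meval (list_monomial f (e # es)) a)"
      unfolding L_Suc by (subst sum.reindex) (auto simp: inj_on_def case_prod_unfold)
    also have "\<dots> = (\<Sum>e<b. \<Sum>es\<in>L k. c (e # es) * meval (list_monomial f (e # es)) a)"
      by (rule sum.cartesian_product[symmetric])
    also have "\<dots> = (\<Sum>e<b. \<Sum>es\<in>L k. meval (f k) a ^ e * (c (e # es) * meval (list_monomial f es) a))"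
      by (intro sum.cong refl) (auto simp: L_def meval_mult meval_power)
    finally show ?thesis
      by (simp add: g_def sum_distrib_left)
  qed
  obtain a1 where a1: "a1 \<in> Z (Suc k)" "meval (f k) a1 \<noteq> 0"
    using Suc.prems(4)[of k] by auto
  have zero: "\<forall>es\<in>L k. c (e # es) = 0" if "e < b" for e
    using that
  proof (induction e rule: less_induct)
    case (less e)
    define h where "h a = (\<Sum>i\<in>{e..<b}. meval (f k) a ^ (i - e) * g i a)" for a
    have polypow: "polynomial_function (\<lambda>a. meval (f k) a ^ n)" for n
      by (induction n) (auto intro: polynomial_function_const polynomial_function_mult polyf)
    then have polyh: "polynomial_function h"
      unfolding h_def by (intro polynomial_function_sum polynomial_function_mult polyg)
    have h0: "h a = 0" if a: "a \<in> Z (Suc k)" for a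
    proof (rule irreducible_closed_mult_cancel[where b = a1, OF Suc.prems(1)[of "Suc k"] polypow[of e] polyh])
      fix a assume a: "a \<in> Z (Suc k)"
      have "g i a = 0" if "i < e" for i
        using less.IH[OF that] less.prems that by (simp add: g_def)
      then have "(\<Sum>i<b. meval (f k) a ^ i * g i a) = (\<Sum>i\<in>{e..<b}. meval (f k) a ^ i * g i a)"
        by (intro sum.mono_neutral_right) (auto simp: not_le)
      also have "\<dots> = (\<Sum>i\<in>{e..<b}. meval (f k) a ^ e * (meval (f k) a ^ (i - e) * g i a))"
        by (intro sum.cong refl) (auto simp: mult.assoc[symmetric] power_add[symmetric])
      finally show "meval (f k) a ^ e * h a = 0"
        using rel[OF a] by (simp add: h_def sum_distrib_left)
    qed (use a a1 in auto)
    have hg: "h a = g e a" if a: "a \<in> Z k" for a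
    proof -
      have "h a = (\<Sum>i\<in>{e..<b}. if i = e then g e a else 0)"
        unfolding h_def using Suc.prems(3)[of k a] a by (intro sum.cong) auto
      then show ?thesis
        using less.prems by simp
    qed
    have "g e a = 0" if a: "a \<in> Z k" for a
    proof -
      have "a \<in> Z (Suc k)"
        using Suc.prems(2)[of k] a by auto
      then show ?thesis
        using h0[of a] hg[OF a] by simp
    qed
    then have rel': "(\<Sum>es | set es \<subseteq> {..<b} \<and> length es = k. c (e # es) * meval (list_monomial f es) a) = 0"
      if "a \<in> Z k" for a
      using that by (simp add: g_def L_def)
    show ?case
    proof
      fix es assume "es \<in> L k"
      then show "c (e # es) = 0"
        using Suc.IH[of "\<lambda>es. c (e # es)" es] Suc.prems(1-4) rel' by (auto simp: L_def)
    qed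
  qed
  have "es \<in> L (Suc k)"
    using Suc.prems(6,7) by (simp add: L_def)
  then show ?case
    using zero unfolding L_Suc by auto
qed

text \<open>
  Each step of the chain gives a function, and monomials in more than \<open>CARD('l ji)\<close> independent
  functions would outnumber the weights as the bound on their exponents grows.
\<close>
lemma chain_length_le:
  fixes Z :: "nat \<Rightarrow> ('k::field ^ 'l::{finite, distrib_lattice}) set"
  assumes irr: "\<forall>i\<le>n. irreducible_closed (Z i) \<and> Z i \<subseteq> hibi_variety" and sub: "\<forall>i<n. Z i \<subset> Z (Suc i)"
  shows "n \<le> CARD('l ji)"
proof (rule ccontr)
  assume "\<not> n \<le> CARD('l ji)"
  then have n: "CARD('l ji) + 1 \<le> n"
    by simp
  have "\<exists>p. (\<forall>a\<in>Z i. meval p a = 0) \<and> (\<exists>a\<in>Z (Suc i). meval p a \<noteq> 0)" if i: "i < n" for i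
  proof -
    have "zariski_closed (Z i)"
      using irr i by (auto simp: irreducible_closed_def)
    then obtain F where F: "Z i = zero_locus F"
      by (auto simp: zariski_closed_def)
    obtain a where "a \<in> Z (Suc i)" "a \<notin> Z i"
      using sub i by blast
    then show ?thesis
      unfolding F by (auto simp: zero_locus_def)
  qed
  then obtain f where f: "\<And>i. i < n \<Longrightarrow> (\<forall>a\<in>Z i. meval (f i) a = 0) \<and> (\<exists>a\<in>Z (Suc i). meval (f i) a \<noteq> 0)"
    by metis
  define d where "d = Max ((\<lambda>i. SOME d. total_degree_le d (f i)) ` {..<n})"
  have d: "total_degree_le d (f i)" if "i < n" for i
  proof (rule total_degree_le_mono)
    show "total_degree_le (SOME d. total_degree_le d (f i)) (f i)"
      by (rule someI_ex) (rule total_degree_le_exists)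
    show "(SOME d. total_degree_le d (f i)) \<le> d"
      unfolding d_def using that by (intro Max_ge) auto
  qed
  define D where "D = CARD('l ji)"
  (* so large that the b ^ n monomials outnumber the (n b d + 1) ^ D weights *)
  define b where "b = (n * d + 1) ^ D + 1"
  let ?L = "{es. set es \<subseteq> {..<b} \<and> length es = n}"
  have deg: "total_degree_le (length es * (b * d)) (list_monomial f es)" if "set es \<subseteq> {..<b}" "length es \<le> n" for es
    using that
  proof (induction es)
    case (Cons e es)
    have "total_degree_le (e * d) (f (length es) ^ e)"
      using Cons.prems d by (intro total_degree_le_power) auto
    then have "total_degree_le (b * d) (f (length es) ^ e)"
      using Cons.prems by (elim total_degree_le_mono) (auto intro: mult_right_mono)
    then show ?case
      using total_degree_le_mult[of "b * d" _ "length es * (b * d)"] Cons by simp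
  qed (simp add: total_degree_le_one)
  have "n * (b * d) + 1 \<le> (n * d + 1) * b"
    by (simp add: b_def algebra_simps)
  then have "(n * (b * d) + 1) ^ D \<le> ((n * d + 1) * b) ^ D"
    by (intro power_mono) auto
  also have "\<dots> = (n * d + 1) ^ D * b ^ D"
    by (rule power_mult_distrib)
  also have "\<dots> < b * b ^ D"
    by (intro mult_strict_right_mono) (auto simp: b_def)
  also have "\<dots> = b ^ (D + 1)"
    by simp
  also have "\<dots> \<le> b ^ n"
    using n by (intro power_increasing) (auto simp: D_def b_def)
  also have "\<dots> = card ?L"
    by (subst card_lists_length_eq) auto
  finally have card: "(n * (b * d) + 1) ^ CARD('l ji) < card ?L"
    by (simp add: D_def)
  have "finite ?L"
    by (rule finite_lists_length_eq) simp
  moreover have "total_degree_le (n * (b * d)) (list_monomial f es)" if "es \<in> ?L" for es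
    using deg[of es] that by auto
  ultimately obtain c where c: "\<exists>es\<in>?L. c es \<noteq> 0"
    "\<forall>a\<in>hibi_variety. (\<Sum>es\<in>?L. c es * meval (list_monomial f es) a) = 0"
    using polynomials_dependent_on_hibi_variety[of ?L "n * (b * d)" "list_monomial f"] card by blast
  have "c es = 0" if "es \<in> ?L" for es
  proof (rule chain_functions_independent[where k = n and Z = Z and f = f and b = b and c = c and es = es])
    show "(\<Sum>es | set es \<subseteq> {..<b} \<and> length es = n. c es * meval (list_monomial f es) a) = 0"
      if "a \<in> Z n" for a
      using c(2) irr that by blast
  qed (use irr sub f that in auto)
  then show False
    using c(1) by blast
qed

subsection \<open>Lower bound: closures of subtori\<close>

text \<open>
  If the closure were the union of two proper closed subsets, then two polynomials with product zero
  on \<open>P\<close> would be nonzero at points \<open>a\<close> and \<open>b\<close> of \<open>P\<close>. Restricted to a curve through \<open>a\<close> and \<open>b\<close>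
  they would be nonzero univariate polynomials whose product vanishes everywhere.
\<close>
lemma irreducible_closure:
  fixes P :: "('k::alg_closed_field ^ 'x::finite) set"
  assumes "P \<noteq> {}" and curve: "\<And>a b. a \<in> P \<Longrightarrow> b \<in> P \<Longrightarrow> \<exists>g :: 'x \<Rightarrow> 'k poly.
      (\<forall>s. (\<chi> x. poly (g x) s) \<in> P) \<and> (\<chi> x. poly (g x) 0) = a \<and> (\<chi> x. poly (g x) 1) = b"
  shows "irreducible_closed (zero_locus (vanishing_ideal P))"
proof -
  let ?V = "zero_locus (vanishing_ideal P)"
  have PV: "P \<subseteq> ?V"
    by (auto simp: zero_locus_def vanishing_ideal_def)
  have vanish: "meval p v = 0" if "\<forall>a\<in>P. meval p a = 0" "v \<in> ?V" for p v
    using that by (auto simp: zero_locus_def vanishing_ideal_def)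
  have "?V = A \<or> ?V = B" if closed: "zariski_closed A" "zariski_closed B" and V: "?V = A \<union> B" for A B
  proof (rule ccontr)
    assume "\<not> (?V = A \<or> ?V = B)"
    then have not_sub: "\<not> ?V \<subseteq> A" "\<not> ?V \<subseteq> B"
      using V by auto
    obtain F G where FG: "A = zero_locus F" "B = zero_locus G"
      using closed by (auto simp: zariski_closed_def)
    have witness: "\<exists>f\<in>F. \<exists>a\<in>P. meval f a \<noteq> 0" if "\<not> ?V \<subseteq> zero_locus F" for F
    proof (rule ccontr)
      assume "\<not> (\<exists>f\<in>F. \<exists>a\<in>P. meval f a \<noteq> 0)"
      then have "meval f v = 0" if "f \<in> F" "v \<in> ?V" for f v
        using vanish[of f v] that by blast
      then have "?V \<subseteq> zero_locus F"
        unfolding zero_locus_def[of F] by blast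
      then show False
        using that by blast
    qed
    obtain f where f: "f \<in> F" "\<exists>a\<in>P. meval f a \<noteq> 0"
      using witness[of F] not_sub(1) unfolding FG by blast
    obtain h where h: "h \<in> G" "\<exists>a\<in>P. meval h a \<noteq> 0"
      using witness[of G] not_sub(2) unfolding FG by blast
    obtain a b where ab: "a \<in> P" "meval f a \<noteq> 0" "b \<in> P" "meval h b \<noteq> 0"
      using f(2) h(2) by blast
    obtain g :: "'x \<Rightarrow> 'k poly" where g: "\<And>s. (\<chi> x. poly (g x) s) \<in> P"
      "(\<chi> x. poly (g x) 0) = a" "(\<chi> x. poly (g x) 1) = b"
      using curve[OF ab(1,3)] by blast
    define Q where "Q p = (\<Sum>m\<in>Poly_Mapping.keys p. [:Poly_Mapping.lookup p m:] * monomial_value g m)" for p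
    have Q: "poly (Q p) s = meval p (\<chi> x. poly (g x) s)" for p s
      by (simp add: Q_def poly_sum meval_eq monomial_value_def poly_prod poly_power)
    have "poly (Q f * Q h) s = 0" for s
    proof -
      have "(\<chi> x. poly (g x) s) \<in> A \<union> B"
        using g(1) PV V by blast
      then show ?thesis
        using f(1) h(1) unfolding FG by (auto simp: Q zero_locus_def)
    qed
    then have "Q f * Q h = 0"
      using poly_roots_finite[of "Q f * Q h"] infinite_UNIV_alg_closed[where 'k = 'k] by auto
    then have "Q f = 0 \<or> Q h = 0"
      by simp
    moreover have "poly (Q f) 0 \<noteq> 0" "poly (Q h) 1 \<noteq> 0"
      using ab g by (simp_all add: Q)
    ultimately show False
      by auto
  qed
  moreover have "zariski_closed ?V"
    by (auto simp: zariski_closed_def)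
  moreover have "?V \<noteq> {}"
    using assms(1) PV by auto
  ultimately show ?thesis
    unfolding irreducible_closed_def by blast
qed

text \<open>
  The subtorus in which only the parameters in \<open>A\<close> vary, together with the points where some of
  these are zero, so that the parameter space is an affine space.
\<close>
definition subtorus :: "'l ji set \<Rightarrow> ('k::comm_ring_1 ^ 'l::{finite, distrib_lattice}) set" where
  "subtorus A = {orbit_point UNIV t | t. \<forall>z. z \<notin> A \<longrightarrow> t z = 1}"

lemma subtorus_closure_irreducible:
  "irreducible_closed (zero_locus (vanishing_ideal (subtorus A :: ('k::alg_closed_field ^ 'l::{finite, distrib_lattice}) set)))"
proof (rule irreducible_closure)
  show "subtorus A \<noteq> ({} :: ('k ^ 'l::{finite, distrib_lattice}) set)"
    by (auto simp: subtorus_def intro: exI[of _ "\<lambda>_. 1"])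
  fix a b :: "'k ^ 'l::{finite, distrib_lattice}"
  assume "a \<in> subtorus A" "b \<in> subtorus A"
  then obtain t u where t: "a = orbit_point UNIV t" "\<forall>z. z \<notin> A \<longrightarrow> t z = 1"
    and u: "b = orbit_point UNIV u" "\<forall>z. z \<notin> A \<longrightarrow> u z = 1"
    by (auto simp: subtorus_def)
  define g where "g x = (\<Prod>z | Rep_ji z \<le> x. [:t z, u z - t z:])" for x :: 'l
  have g: "(\<chi> x. poly (g x) s) = orbit_point UNIV (\<lambda>z. t z + s * (u z - t z))" for s
    by (simp add: vec_eq_iff g_def poly_prod torus_coordinate_def)
  have "(\<chi> x. poly (g x) s) \<in> subtorus A" for s
    unfolding g subtorus_def using t(2) u(2) by auto
  moreover have "(\<chi> x. poly (g x) 0) = a" "(\<chi> x. poly (g x) 1) = b"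
    unfolding g by (simp_all add: t(1) u(1))
  ultimately show "\<exists>g :: 'l \<Rightarrow> 'k poly. (\<forall>s. (\<chi> x. poly (g x) s) \<in> subtorus A) \<and>
      (\<chi> x. poly (g x) 0) = a \<and> (\<chi> x. poly (g x) 1) = b"
    by blast
qed

lemma subtorus_closure_subset:
  "zero_locus (vanishing_ideal (subtorus A)) \<subseteq> (hibi_variety :: ('k::comm_ring_1 ^ 'l::{finite, distrib_lattice}) set)"
proof
  fix a :: "'k ^ 'l::{finite, distrib_lattice}"
  assume a: "a \<in> zero_locus (vanishing_ideal (subtorus A))"
  have "meval (hibi_binomial x y) a = 0" for x y
  proof -
    have "hibi_binomial x y \<in> vanishing_ideal (subtorus A :: ('k ^ 'l::{finite, distrib_lattice}) set)"
      using torus_coordinate_hibi by (auto simp: vanishing_ideal_def subtorus_def meval_hibi_binomial)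
    then show ?thesis
      using a by (auto simp: zero_locus_def)
  qed
  then show "a \<in> hibi_variety"
    by (auto simp: hibi_variety_def zero_locus_def)
qed

text \<open>
  The coordinate at a join-irreducible element is the parameter there times the coordinate at its
  unique lower cover, or the parameter itself at the least element; so a parameter fixed to \<open>1\<close>
  gives a linear equation.
\<close>
lemma subtorus_closure_psubset:
  fixes z :: "'l::{finite, distrib_lattice} ji"
  assumes z: "z \<notin> A"
  shows "zero_locus (vanishing_ideal (subtorus A :: ('k::field ^ 'l::{finite, distrib_lattice}) set))
    \<subset> zero_locus (vanishing_ideal (subtorus (insert z A)))"
proof -
  have "subtorus A \<subseteq> (subtorus (insert z A) :: ('k ^ 'l::{finite, distrib_lattice}) set)"
    by (auto simp: subtorus_def)
  then have sub: "zero_locus (vanishing_ideal (subtorus A :: ('k ^ 'l::{finite, distrib_lattice}) set))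
      \<subseteq> zero_locus (vanishing_ideal (subtorus (insert z A)))"
    by (auto simp: zero_locus_def vanishing_ideal_def)
  obtain r :: "('l, 'k) mpoly" and f where r: "\<And>t. meval r (orbit_point UNIV t) = f t"
    and coord: "\<And>t. torus_coordinate t (Rep_ji z) = t z * f t" and f: "f ((\<lambda>_. 1)(z := 0)) = 1"
  proof (cases "z = bottom_ji")
    case True
    have "w = z" if "Rep_ji w \<le> Rep_ji z" for w
      using order.antisym[OF that] bottom_ji_le[of "Rep_ji w"] by (simp add: True Rep_ji_inject)
    then have "{w. Rep_ji w \<le> Rep_ji z} = {z}"
      by auto
    then show ?thesis
      by (intro that[of 1 "\<lambda>_. 1"]) (auto simp: torus_coordinate_def)
  next
    case False
    let ?I = "{w. Rep_ji w \<le> Rep_ji z \<and> w \<noteq> z}"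
    have ideal: "w \<in> ?I" if "v \<in> ?I" "Rep_ji w \<le> Rep_ji v" for v w
    proof -
      have "Rep_ji w \<le> Rep_ji z"
        using that order_trans by blast
      moreover have "w \<noteq> z"
        using that order.antisym[of "Rep_ji v" "Rep_ji z"] by (auto simp: Rep_ji_inject)
      ultimately show ?thesis
        by simp
    qed
    have "bottom_ji \<in> ?I"
      using False by auto
    then have "?I \<noteq> {}"
      by blast
    then obtain y where y: "\<And>w. Rep_ji w \<le> y \<longleftrightarrow> w \<in> ?I"
      using nonempty_order_ideal_realised[of ?I] ideal by blast
    have "{w. Rep_ji w \<le> Rep_ji z} = insert z {w. Rep_ji w \<le> y}" "z \<notin> {w. Rep_ji w \<le> y}"
      using y by auto
    then have "torus_coordinate t (Rep_ji z) = t z * torus_coordinate t y" for t :: "'l ji \<Rightarrow> 'k"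
      by (simp add: torus_coordinate_def)
    moreover have "torus_coordinate ((\<lambda>_. 1)(z := 0)) y = (1 :: 'k)"
      unfolding torus_coordinate_def by (intro prod.neutral) (auto simp: y)
    ultimately show ?thesis
      by (intro that[of "mvar y" "\<lambda>t. torus_coordinate t y"]) auto
  qed
  let ?q = "orbit_point UNIV ((\<lambda>_. 1)(z := 0)) :: 'k ^ 'l::{finite, distrib_lattice}"
  have "?q \<in> subtorus (insert z A)"
    by (auto simp: subtorus_def)
  then have "?q \<in> zero_locus (vanishing_ideal (subtorus (insert z A)))"
    by (auto simp: zero_locus_def vanishing_ideal_def)
  moreover have "?q \<notin> zero_locus (vanishing_ideal (subtorus A))"
  proof
    let ?p = "mvar (Rep_ji z) - r"
    assume "?q \<in> zero_locus (vanishing_ideal (subtorus A))"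
    moreover have "?p \<in> vanishing_ideal (subtorus A)"
      using z by (auto simp: vanishing_ideal_def subtorus_def meval_diff r coord)
    ultimately have "meval ?p ?q = 0"
      by (auto simp: zero_locus_def)
    then show False
      by (simp add: meval_diff r coord f)
  qed
  ultimately show ?thesis
    using sub by blast
qed

text \<open>A strict chain of closed subtori is obtained by releasing one parameter after the other.\<close>
theorem variety_dim_hibi_variety:
  "variety_dim (hibi_variety :: ('k::alg_closed_field ^ 'l::{finite, distrib_lattice}) set) = enat CARD('l ji)"
proof (rule antisym)
  show "variety_dim (hibi_variety :: ('k ^ 'l::{finite, distrib_lattice}) set) \<le> enat CARD('l ji)"
    unfolding variety_dim_def using chain_length_le by (intro SUP_least) auto
  obtain h :: "nat \<Rightarrow> 'l ji" where h: "bij_betw h {0..<CARD('l ji)} UNIV"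
    using ex_bij_betw_nat_finite[of "UNIV :: 'l ji set"] by auto
  define Z where "Z i = zero_locus (vanishing_ideal (subtorus (h ` {0..<i}) :: ('k ^ 'l::{finite, distrib_lattice}) set))" for i
  have "Z i \<subset> Z (Suc i)" if "i < CARD('l ji)" for i
  proof -
    have "h ` {0..<Suc i} = insert (h i) (h ` {0..<i})"
      by (simp add: atLeast0_lessThan_Suc)
    moreover have "h i \<notin> h ` {0..<i}"
      using inj_on_image_mem_iff[OF bij_betw_imp_inj_on[OF h], of i "{0..<i}"] that by auto
    ultimately show ?thesis
      unfolding Z_def using subtorus_closure_psubset[of "h i" "h ` {0..<i}"] by simp
  qed
  moreover have "irreducible_closed (Z i) \<and> Z i \<subseteq> hibi_variety" for i
    unfolding Z_def using subtorus_closure_irreducible subtorus_closure_subset by blast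
  ultimately show "enat CARD('l ji) \<le> variety_dim (hibi_variety :: ('k ^ 'l::{finite, distrib_lattice}) set)"
    unfolding variety_dim_def by (intro SUP_upper) blast
qed


section \<open>The faces of the cone\<close>

lemma lookup_ideal_character:
  "Poly_Mapping.lookup (ideal_character x) z = (if Rep_ji z \<le> x then 1 else 0)"
  by (simp add: ideal_character_def lookup_sum lookup_single when_def)

lemma inner_ideal_character: "real_character (ideal_character x) \<bullet> v = (\<Sum>z | Rep_ji z \<le> x. v $ z)"
proof -
  have "real_character (ideal_character x) \<bullet> v = (\<Sum>z\<in>UNIV. if Rep_ji z \<le> x then v $ z else 0)"
    unfolding inner_vec_def real_character_def lookup_ideal_character by (intro sum.cong) auto
  then show ?thesis
    by (simp add: sum.If_cases)
qed

lemma inner_ideal_character_modular: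
  "real_character (ideal_character x) \<bullet> v + real_character (ideal_character y) \<bullet> v
    = real_character (ideal_character (sup x y)) \<bullet> v + real_character (ideal_character (inf x y)) \<bullet> v"
proof -
  have "{z. Rep_ji z \<le> sup x y} = {z. Rep_ji z \<le> x} \<union> {z. Rep_ji z \<le> y}"
    "{z. Rep_ji z \<le> inf x y} = {z. Rep_ji z \<le> x} \<inter> {z. Rep_ji z \<le> y}"
    by auto
  then show ?thesis
    unfolding inner_ideal_character by (simp add: sum.union_inter)
qed

text \<open>The character by which a monomial pulls back to the torus: its weight, as an element of the character lattice.\<close>
definition weight_character :: "('l::{finite, distrib_lattice} \<Rightarrow>\<^sub>0 nat) \<Rightarrow> ('l ji \<Rightarrow>\<^sub>0 int)" where
  "weight_character m = (\<Sum>x\<in>UNIV. \<Sum>i<Poly_Mapping.lookup m x. ideal_character x)"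

lemma lookup_weight_character: "Poly_Mapping.lookup (weight_character m) z = int (weight m z)"
  by (simp add: weight_character_def lookup_sum lookup_ideal_character weight_def sum.If_cases
      if_distrib[of "\<lambda>e. _ * e"] cong: if_cong)

lemma single_one_power:
  "Poly_Mapping.single a (1 :: 'k::comm_ring_1) ^ n = Poly_Mapping.single (\<Sum>i<n. a) 1"
  by (induction n) (auto simp: mult_single add.commute)

lemma single_one_prod:
  "finite A \<Longrightarrow> (\<Prod>x\<in>A. Poly_Mapping.single (f x) (1 :: 'k::comm_ring_1)) = Poly_Mapping.single (\<Sum>x\<in>A. f x) 1"
  by (induction A rule: finite_induct) (auto simp: mult_single)

lemma torus_pullback_eq:
  fixes p :: "('l::{finite, distrib_lattice}, 'k::comm_ring_1) mpoly"
  shows "torus_pullback p = (\<Sum>m\<in>Poly_Mapping.keys p. Poly_Mapping.single (weight_character m) (Poly_Mapping.lookup p m))"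
  unfolding torus_pullback_def msubst_def weight_character_def
  by (simp add: single_one_power single_one_prod mult_single)

lemma ideal_character_in_semigroup:
  fixes \<sigma> :: "(real ^ ('l::{finite, distrib_lattice}) ji) set"
  assumes "is_hibi_cone TYPE('k::comm_ring_1) \<sigma>"
  shows "ideal_character x \<in> cone_semigroup \<sigma>"
proof -
  have "weight_character (Poly_Mapping.single x 1) = ideal_character x"
    by (rule poly_mapping_eqI) (simp add: lookup_weight_character lookup_ideal_character weight_single[where k = "Suc 0", simplified])
  then have "torus_pullback (mvar x :: ('l, 'k) mpoly) = Poly_Mapping.single (ideal_character x) 1"
    by (simp add: torus_pullback_eq mvar_def)
  moreover have "torus_pullback (mvar x :: ('l, 'k) mpoly) \<in> semigroup_algebra (cone_semigroup \<sigma>)"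
    using assms unfolding is_hibi_cone_def by blast
  ultimately show ?thesis
    by (simp add: semigroup_algebra_def)
qed

lemma semigroup_element_is_weight:
  fixes \<sigma> :: "(real ^ ('l::{finite, distrib_lattice}) ji) set"
  assumes cone: "is_hibi_cone TYPE('k::comm_ring_1) \<sigma>" and m: "m \<in> cone_semigroup \<sigma>"
  obtains n where "m = weight_character n"
proof -
  have "(Poly_Mapping.single m 1 :: ('l ji \<Rightarrow>\<^sub>0 int) \<Rightarrow>\<^sub>0 'k) \<in> semigroup_algebra (cone_semigroup \<sigma>)"
    using m by (simp add: semigroup_algebra_def)
  then obtain p :: "('l, 'k) mpoly" where "Poly_Mapping.single m 1 = torus_pullback p"
    using cone unfolding is_hibi_cone_def by blast
  then have "m \<in> Poly_Mapping.keys (torus_pullback p)"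
    by (metis keys_single insertI1 zero_neq_one)
  also have "\<dots> \<subseteq> (\<Union>n\<in>Poly_Mapping.keys p. Poly_Mapping.keys (Poly_Mapping.single (weight_character n) (Poly_Mapping.lookup p n)))"
    unfolding torus_pullback_eq by (rule keys_sum)
  finally show ?thesis
    using that by (auto split: if_splits)
qed

lemma inner_weight_character:
  "real_character (weight_character n) \<bullet> v
    = (\<Sum>x\<in>UNIV. real (Poly_Mapping.lookup n x) * (real_character (ideal_character x) \<bullet> v))"
proof -
  have "real_character (weight_character n) \<bullet> v
      = (\<Sum>z\<in>UNIV. \<Sum>x\<in>UNIV. real (Poly_Mapping.lookup n x) * (if Rep_ji z \<le> x then v $ z else 0))"
    unfolding inner_vec_def real_character_def vec_lambda_beta lookup_weight_character weight_def
    by (intro sum.cong) (auto simp: sum_distrib_right sum.If_cases if_distrib[of "\<lambda>e. _ * e"] cong: if_cong)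
  also have "\<dots> = (\<Sum>x\<in>UNIV. real (Poly_Mapping.lookup n x) * (\<Sum>z\<in>UNIV. if Rep_ji z \<le> x then v $ z else 0))"
    by (subst sum.swap) (simp add: sum_distrib_left)
  finally show ?thesis
    by (simp add: inner_ideal_character sum.If_cases)
qed

text \<open>Round a large multiple of \<open>a\<close>: the rounding error on each \<open>x\<close> is bounded independently of the multiple.\<close>
lemma integral_solution_of_strict_inequalities:
  fixes X :: "(real ^ 'j::finite) set"
  assumes fin: "finite X" and a: "\<And>x. x \<in> X \<Longrightarrow> 0 < a \<bullet> x"
  obtains m where "\<And>x. x \<in> X \<Longrightarrow> 0 < real_character m \<bullet> x"
proof -
  define N where "N = Max (insert 0 ((\<lambda>x. (\<Sum>z\<in>UNIV. \<bar>x $ z\<bar>) / (a \<bullet> x)) ` X)) + 1"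
  define m where "m = Abs_poly_mapping (\<lambda>z. \<lfloor>N * a $ z\<rfloor>)"
  have m: "Poly_Mapping.lookup m z = \<lfloor>N * a $ z\<rfloor>" for z
    unfolding m_def by (subst lookup_Abs_poly_mapping) auto
  have "0 < real_character m \<bullet> x" if x: "x \<in> X" for x
  proof -
    have "(\<Sum>z\<in>UNIV. \<bar>x $ z\<bar>) / (a \<bullet> x) < N"
    proof -
      have "(\<Sum>z\<in>UNIV. \<bar>x $ z\<bar>) / (a \<bullet> x)
          \<le> Max (insert 0 ((\<lambda>x. (\<Sum>z\<in>UNIV. \<bar>x $ z\<bar>) / (a \<bullet> x)) ` X))"
        using fin x by (intro Max_ge) auto
      then have "(\<Sum>z\<in>UNIV. \<bar>x $ z\<bar>) / (a \<bullet> x) \<le> N - 1"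
        by (simp add: N_def)
      then show ?thesis
        by simp
    qed
    then have less: "(\<Sum>z\<in>UNIV. \<bar>x $ z\<bar>) < N * (a \<bullet> x)"
      using a[OF x] by (simp add: divide_less_eq mult.commute)
    have "N * (a \<bullet> x) - real_character m \<bullet> x = (\<Sum>z\<in>UNIV. (N * a $ z - \<lfloor>N * a $ z\<rfloor>) * x $ z)"
      by (simp add: inner_vec_def real_character_def m sum_distrib_left sum_subtractf[symmetric] algebra_simps)
    also have "\<dots> \<le> (\<Sum>z\<in>UNIV. \<bar>x $ z\<bar>)"
    proof (rule sum_mono)
      fix z
      have "\<bar>(N * a $ z - \<lfloor>N * a $ z\<rfloor>) * x $ z\<bar> \<le> 1 * \<bar>x $ z\<bar>"
        unfolding abs_mult by (intro mult_right_mono) linarith+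
      then show "(N * a $ z - \<lfloor>N * a $ z\<rfloor>) * x $ z \<le> \<bar>x $ z\<bar>"
        by linarith
    qed
    finally show ?thesis
      using less by linarith
  qed
  then show ?thesis
    using that by blast
qed

text \<open>
  By strong convexity \<open>0\<close> is not in the convex hull of the nonzero generators: a convex combination
  equal to \<open>0\<close> would put the negative of a generator into the cone. Then separate \<open>0\<close> from the hull.
\<close>
lemma strongly_convex_positive_functional:
  fixes V :: "(real ^ 'j::finite) set"
  assumes fin: "finite V" and sc: "strongly_convex (convex_cone hull V)"
  obtains u where "\<And>v. v \<in> V \<Longrightarrow> v \<noteq> 0 \<Longrightarrow> 0 < u \<bullet> v"
proof -
  have "0 \<notin> convex hull (V - {0})"
  proof
    assume "0 \<in> convex hull (V - {0})"
    then obtain c where c: "\<forall>v\<in>V - {0}. 0 \<le> c v" "sum c (V - {0}) = 1" "(\<Sum>v\<in>V - {0}. c v *\<^sub>R v) = 0"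
      using fin by (auto simp: convex_hull_finite)
    have "\<exists>w\<in>V - {0}. c w \<noteq> 0"
    proof (rule ccontr)
      assume "\<not> (\<exists>w\<in>V - {0}. c w \<noteq> 0)"
      then have "sum c (V - {0}) = 0"
        by (intro sum.neutral) auto
      then show False
        using c(2) by simp
    qed
    then obtain w where w: "w \<in> V - {0}" "c w > 0"
      using c(1) by (auto simp: order.strict_iff_order)
    have sums: "(\<Sum>v\<in>A. c v *\<^sub>R v) \<in> convex_cone hull V" if "A \<subseteq> V - {0}" for A
    proof -
      have "finite A"
        using that fin finite_subset by blast
      then show ?thesis
        using that
      proof (induction A rule: finite_induct)
        case empty
        then show ?case
          by (simp add: convex_cone_hull_contains_0)
      next
        case (insert v A)
        then have "c v *\<^sub>R v \<in> convex_cone hull V"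
          using c(1) by (intro convex_cone_hull_mul hull_inc) auto
        then show ?case
          using insert by (auto intro: convex_cone_hull_add)
      qed
    qed
    have "c w *\<^sub>R w + (\<Sum>v\<in>V - {0} - {w}. c v *\<^sub>R v) = 0"
      using c(3) w fin by (subst sum.remove[symmetric]) auto
    then have neg: "(\<Sum>v\<in>V - {0} - {w}. c v *\<^sub>R v) = - (c w *\<^sub>R w)"
      by (simp add: add_eq_0_iff)
    have "c w *\<^sub>R w \<in> convex_cone hull V"
      using w by (intro convex_cone_hull_mul hull_inc) auto
    moreover have "- (c w *\<^sub>R w) \<in> convex_cone hull V"
      using sums[of "V - {0} - {w}"] unfolding neg by blast
    ultimately have "c w *\<^sub>R w \<in> (convex_cone hull V) \<inter> uminus ` (convex_cone hull V)"
      by (metis IntI imageI minus_minus)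
    then have "c w *\<^sub>R w = 0"
      using sc unfolding strongly_convex_def by blast
    then show False
      using w by simp
  qed
  moreover have "closed (convex hull (V - {0}))"
    using fin by (intro compact_imp_closed finite_imp_compact_convex_hull) auto
  ultimately obtain a b where "a \<bullet> 0 < b" "\<forall>x\<in>convex hull (V - {0}). b < a \<bullet> x"
    using separating_hyperplane_closed_point[of "convex hull (V - {0})" 0] convex_convex_hull by blast
  then have "0 < a \<bullet> v" if "v \<in> V" "v \<noteq> 0" for v
    using that hull_inc[of v "V - {0}" convex] by fastforce
  then show ?thesis
    using that by blast
qed

text \<open>
  A vector outside \<open>\<sigma>\<close> is separated from it by a real functional; as the cone is strongly convex,
  the functional can be made positive on the nonzero generators, and then integral. So it belongs to the semigroup, whose elements are sums of ideal characters,
  and cannot be negative on a vector on which all ideal characters are nonnegative.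
\<close>
lemma hibi_cone_eq:
  fixes \<sigma> :: "(real ^ ('l::{finite, distrib_lattice}) ji) set"
  assumes cone: "is_hibi_cone TYPE('k::comm_ring_1) \<sigma>"
  shows "\<sigma> = {v. \<forall>x. 0 \<le> real_character (ideal_character x) \<bullet> v}"
proof (intro equalityI subsetI)
  fix v :: "real ^ 'l ji" assume "v \<in> \<sigma>"
  then show "v \<in> {v. \<forall>x. 0 \<le> real_character (ideal_character x) \<bullet> v}"
    using ideal_character_in_semigroup[OF cone] by (auto simp: cone_semigroup_def dual_cone_def)
next
  fix v :: "real ^ 'l ji" assume v: "v \<in> {v. \<forall>x. 0 \<le> real_character (ideal_character x) \<bullet> v}"
  obtain V where V: "finite V" "\<sigma> = convex_cone hull V"
    using cone by (auto simp: is_hibi_cone_def rational_polyhedral_cone_def)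
  show "v \<in> \<sigma>"
  proof (rule ccontr)
    assume "v \<notin> \<sigma>"
    moreover have "closed \<sigma>" "convex \<sigma>"
      using V by (auto intro: closed_convex_cone_hull convex_convex_cone_hull)
    ultimately obtain a b where ab: "a \<bullet> v < b" "\<And>x. x \<in> \<sigma> \<Longrightarrow> b < a \<bullet> x"
      using separating_hyperplane_closed_point[of \<sigma> v] by blast
    have "0 \<in> \<sigma>"
      by (simp add: V convex_cone_hull_contains_0)
    then have b: "b < 0"
      using ab(2) by force
    have nonneg: "0 \<le> a \<bullet> x" if x: "x \<in> \<sigma>" for x
    proof (rule ccontr)
      assume neg: "\<not> 0 \<le> a \<bullet> x"
      have "(b / (a \<bullet> x)) *\<^sub>R x \<in> \<sigma>"
        using x neg b unfolding V by (intro convex_cone_hull_mul) (auto simp: divide_nonpos_nonpos)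
      then have "b < a \<bullet> ((b / (a \<bullet> x)) *\<^sub>R x)"
        by (rule ab(2))
      then show False
        using neg by simp
    qed
    obtain u where u: "\<And>x. x \<in> V \<Longrightarrow> x \<noteq> 0 \<Longrightarrow> 0 < u \<bullet> x"
      using strongly_convex_positive_functional[OF V(1)] cone unfolding is_hibi_cone_def V(2) by blast
    obtain e where e: "e > 0" "a \<bullet> v + e * (u \<bullet> v) < 0"
    proof (cases "u \<bullet> v \<le> 0")
      case True
      then show ?thesis
        using ab(1) b by (intro that[of 1]) auto
    next
      case False
      then show ?thesis
        using ab(1) b by (intro that[of "- (a \<bullet> v) / (2 * (u \<bullet> v))"]) (auto simp: field_simps)
    qed
    let ?a = "a + e *\<^sub>R u"
    have "0 < ?a \<bullet> x" if "x \<in> insert (- v) (V - {0})" for x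
    proof (cases "x = - v")
      case True
      then show ?thesis
        using e by (simp add: inner_add_left)
    next
      case False
      then have x: "x \<in> V" "x \<noteq> 0"
        using that by auto
      then have "0 \<le> a \<bullet> x"
        unfolding V(2) by (intro nonneg) (simp add: V(2) hull_inc)
      then show ?thesis
        using mult_pos_pos[OF e(1) u[OF x]] by (simp add: inner_add_left)
    qed
    then obtain m where m: "\<And>x. x \<in> insert (- v) (V - {0}) \<Longrightarrow> 0 < real_character m \<bullet> x"
      using integral_solution_of_strict_inequalities[of "insert (- v) (V - {0})" ?a] V(1) by auto
    have "convex_cone {x. 0 \<le> real_character m \<bullet> x}"
      by (auto simp: convex_cone_iff inner_add_right)
    moreover have "V \<subseteq> {x. 0 \<le> real_character m \<bullet> x}"
      using m by (force intro: order.strict_implies_order)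
    ultimately have "\<sigma> \<subseteq> {x. 0 \<le> real_character m \<bullet> x}"
      unfolding V(2) by (intro hull_minimal)
    then have "m \<in> cone_semigroup \<sigma>"
      by (auto simp: cone_semigroup_def dual_cone_def)
    then obtain n where "m = weight_character n"
      using semigroup_element_is_weight[OF cone] by blast
    then have "0 \<le> real_character m \<bullet> v"
      using v by (simp add: inner_weight_character sum_nonneg)
    then show False
      using m[of "- v"] by simp
  qed
qed

lemma in_face_sublattice_iff:
  "x \<in> face_sublattice \<tau> \<longleftrightarrow> (\<forall>v\<in>\<tau>. real_character (ideal_character x) \<bullet> v = 0)"
  by (auto simp: face_sublattice_def orthogonal_comp_def orthogonal_def inner_commute)

text \<open>
  On the cone the ideal characters are nonnegative, so that two of them vanish exactly if their sum
  does; and by modularity the join and the meet have the same sum.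
\<close>
lemma face_sublattice_embedded:
  fixes \<sigma> :: "(real ^ ('l::{finite, distrib_lattice}) ji) set"
  assumes cone: "is_hibi_cone TYPE('k::comm_ring_1) \<sigma>" and face: "is_cone_face \<tau> \<sigma>"
  shows "embedded_sublattice (face_sublattice \<tau>)"
proof -
  let ?f = "\<lambda>x v. real_character (ideal_character x) \<bullet> v"
  have nonneg: "0 \<le> ?f x v" if "v \<in> \<tau>" for x v
  proof -
    have "v \<in> \<sigma>"
      using face that by (auto simp: is_cone_face_def)
    then show ?thesis
      using hibi_cone_eq[OF cone] by auto
  qed
  have "?f x v = 0 \<and> ?f y v = 0 \<longleftrightarrow> ?f (sup x y) v = 0 \<and> ?f (inf x y) v = 0" if "v \<in> \<tau>" for x y v
    using inner_ideal_character_modular[of x v y] nonneg[OF that, of x] nonneg[OF that, of y]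
      nonneg[OF that, of "sup x y"] nonneg[OF that, of "inf x y"] by linarith
  then show ?thesis
    unfolding embedded_sublattice_def in_face_sublattice_iff by blast
qed

text \<open>
  The superlevel sets of \<open>h\<close> are order ideals, hence the ideals of lattice elements, and \<open>h\<close> is the
  sum of their indicators.
\<close>
lemma decreasing_function_is_weight:
  fixes h :: "'l::{finite, distrib_lattice} ji \<Rightarrow> nat"
  assumes "\<And>z w. Rep_ji w \<le> Rep_ji z \<Longrightarrow> h z \<le> h w"
  shows "\<exists>M. mset_weight M = h"
  using assms
proof (induction "h bottom_ji" arbitrary: h)
  case 0
  then have "h z = 0" for z
  proof -
    have "h z \<le> h bottom_ji"
      by (rule "0.prems") (rule bottom_ji_le)
    then show ?thesis
      using "0.hyps" by simp
  qed
  then show ?case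
    by (intro exI[of _ "{#}"]) (auto simp: mset_weight_def)
next
  case (Suc n)
  have "bottom_ji \<in> {z. h z > 0}"
    using Suc.hyps(2) by simp
  then have "{z. h z > 0} \<noteq> {}"
    by blast
  moreover have "w \<in> {z. h z > 0}" if "z \<in> {z. h z > 0}" "Rep_ji w \<le> Rep_ji z" for z w
    using Suc.prems[OF that(2)] that(1) by simp
  ultimately obtain x where x: "\<And>z. Rep_ji z \<le> x \<longleftrightarrow> z \<in> {z. h z > 0}"
    using nonempty_order_ideal_realised[of "{z. h z > 0}"] by blast
  have "\<exists>M. mset_weight M = (\<lambda>z. h z - 1)"
  proof (rule Suc.hyps(1))
    show "n = h bottom_ji - 1"
      using Suc.hyps(2) by simp
    show "h z - 1 \<le> h w - 1" if "Rep_ji w \<le> Rep_ji z" for z w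
      using Suc.prems[OF that] by (rule diff_le_mono)
  qed
  then obtain M where "mset_weight M = (\<lambda>z. h z - 1)" ..
  then have "mset_weight (add_mset x M) = h"
    by (auto simp: mset_weight_add_mset x fun_eq_iff)
  then show ?case ..
qed

text \<open>
  Suppose that no pair \<open>z \<le> w\<close> separates \<open>\<beta>\<close> from \<open>D\<close>, where \<open>w\<close> may also be missing. Then the sum
  of the ideals of the elements of \<open>D\<close> minus the ideal of \<open>\<beta>\<close> is a decreasing function, so that \<open>\<beta>\<close>
  times some monomial has the weight of the product of the elements of \<open>D\<close>. But the indicator of \<open>D\<close>
  is a point of the Hibi variety at which the product is \<open>1\<close> and the coordinate of \<open>\<beta>\<close> is \<open>0\<close>.
\<close>
lemma embedded_sublattice_separation:
  fixes \<beta> :: "'l::{finite, distrib_lattice}"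
  assumes D: "embedded_sublattice D" and \<beta>: "\<beta> \<notin> D"
  shows "\<exists>z. Rep_ji z \<le> \<beta> \<and> ((\<forall>x\<in>D. \<not> Rep_ji z \<le> x) \<or>
    (\<exists>w. Rep_ji z \<le> Rep_ji w \<and> \<not> Rep_ji w \<le> \<beta> \<and> (\<forall>x\<in>D. Rep_ji z \<le> x \<longrightarrow> Rep_ji w \<le> x)))"
proof (rule ccontr)
  assume contra: "\<not> ?thesis"
  define N where "N z = card {x \<in> D. Rep_ji z \<le> x}" for z
  define h where "h z = N z - (if Rep_ji z \<le> \<beta> then 1 else 0)" for z
  have pos: "N z > 0" if "Rep_ji z \<le> \<beta>" for z
  proof -
    have "{x \<in> D. Rep_ji z \<le> x} \<noteq> {}"
      using contra that by blast
    then show ?thesis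
      unfolding N_def by (simp only: card_gt_0_iff) simp
  qed
  have "h w \<le> h z" if zw: "Rep_ji z \<le> Rep_ji w" for z w
  proof -
    have sub: "{x \<in> D. Rep_ji w \<le> x} \<subseteq> {x \<in> D. Rep_ji z \<le> x}"
      using zw by (auto dest: order_trans)
    then have le: "N w \<le> N z"
      unfolding N_def by (intro card_mono) auto
    show ?thesis
    proof (cases "Rep_ji w \<le> \<beta>")
      case True
      then have "Rep_ji z \<le> \<beta>"
        using zw by (rule order_trans[rotated])
      then show ?thesis
        using True le by (simp add: h_def diff_le_mono)
    next
      case False
      show ?thesis
      proof (cases "Rep_ji z \<le> \<beta>")
        case True
        then obtain x where "x \<in> D" "Rep_ji z \<le> x" "\<not> Rep_ji w \<le> x"
          using contra zw False by blast
        then have "N w < N z"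
          unfolding N_def using sub by (intro psubset_card_mono) auto
        then show ?thesis
          using True False by (simp add: h_def)
      qed (use le False in \<open>simp add: h_def\<close>)
    qed
  qed
  then obtain M where M: "mset_weight M = h"
    using decreasing_function_is_weight[of h] by blast
  let ?g = "\<lambda>x. if x \<in> D then 1 else 0 :: nat"
  have "?g x * ?g y = ?g (sup x y) * ?g (inf x y)" for x y
  proof -
    have "x \<in> D \<and> y \<in> D \<longleftrightarrow> sup x y \<in> D \<and> inf x y \<in> D"
      using D unfolding embedded_sublattice_def by blast
    then show ?thesis
      by auto
  qed
  then have "hibi_multiplicative_on UNIV ?g"
    unfolding hibi_multiplicative_on_def by blast
  moreover have "mset_weight (mset_set D) z = N z" for z
    by (simp add: mset_weight_def N_def)
  then have "mset_weight (add_mset \<beta> M) z = mset_weight (mset_set D) z" for z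
    using pos[of z] by (simp add: mset_weight_add_mset M h_def)
  ultimately have "prod_mset (image_mset ?g (add_mset \<beta> M)) = prod_mset (image_mset ?g (mset_set D))"
    by (intro prod_mset_eq_of_weight_eq[of UNIV]) (auto simp: sublattice_def)
  moreover have "prod_mset (image_mset ?g (mset_set D)) = 1"
    by (simp add: prod_unfold_prod_mset[symmetric])
  ultimately show False
    using \<beta> by simp
qed

text \<open>
  The face is cut out by the sum of the ideal characters of \<open>D\<close>. The separating pair \<open>z \<le> w\<close> gives
  the vector \<open>axis z 1 - axis w 1\<close> (or \<open>axis z 1\<close>) of that face, on which the character of \<open>\<beta>\<close> is \<open>1\<close>.
\<close>
theorem embedded_sublattice_is_face_sublattice:
  fixes \<sigma> :: "(real ^ ('l::{finite, distrib_lattice}) ji) set"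
  assumes cone: "is_hibi_cone TYPE('k::comm_ring_1) \<sigma>" and D: "embedded_sublattice D"
  obtains \<tau> where "is_cone_face \<tau> \<sigma>" "face_sublattice \<tau> = D"
proof -
  let ?f = "\<lambda>x. real_character (ideal_character x)"
  have \<sigma>: "v \<in> \<sigma> \<longleftrightarrow> (\<forall>x. 0 \<le> ?f x \<bullet> v)" for v
    using hibi_cone_eq[OF cone] by blast
  define u where "u = (\<Sum>x\<in>D. ?f x)"
  define \<tau> where "\<tau> = {v \<in> \<sigma>. u \<bullet> v = 0}"
  have uv: "u \<bullet> v = (\<Sum>x\<in>D. ?f x \<bullet> v)" for v
    unfolding u_def by (rule inner_sum_left)
  have "0 \<le> u \<bullet> v" if "v \<in> \<sigma>" for v
    unfolding uv using \<sigma>[of v] that by (intro sum_nonneg) auto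
  then have "u \<in> dual_cone \<sigma>"
    unfolding dual_cone_def by blast
  then have face: "is_cone_face \<tau> \<sigma>"
    unfolding is_cone_face_def \<tau>_def by blast
  have \<tau>: "v \<in> \<tau> \<longleftrightarrow> v \<in> \<sigma> \<and> (\<forall>x\<in>D. ?f x \<bullet> v = 0)" for v
  proof (cases "v \<in> \<sigma>")
    case True
    then show ?thesis
      using \<sigma>[of v] by (simp add: \<tau>_def uv sum_nonneg_eq_0_iff)
  qed (simp add: \<tau>_def)
  have "\<beta> \<in> D" if \<beta>: "\<beta> \<in> face_sublattice \<tau>" for \<beta>
  proof (rule ccontr)
    have f_axis: "?f x \<bullet> axis z 1 = (if Rep_ji z \<le> x then 1 else 0)" for x z
      by (simp add: inner_axis real_character_def lookup_ideal_character)
    assume "\<beta> \<notin> D"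
    then obtain z where z: "Rep_ji z \<le> \<beta>" "(\<forall>x\<in>D. \<not> Rep_ji z \<le> x) \<or>
        (\<exists>w. Rep_ji z \<le> Rep_ji w \<and> \<not> Rep_ji w \<le> \<beta> \<and> (\<forall>x\<in>D. Rep_ji z \<le> x \<longrightarrow> Rep_ji w \<le> x))"
      using embedded_sublattice_separation[OF D] by blast
    from z(2) show False
    proof
      assume "\<forall>x\<in>D. \<not> Rep_ji z \<le> x"
      then have "axis z 1 \<in> \<tau>"
        by (simp add: \<tau> \<sigma> f_axis)
      then show False
        using \<beta> z(1) f_axis[of \<beta> z] by (simp add: in_face_sublattice_iff)
    next
      assume "\<exists>w. Rep_ji z \<le> Rep_ji w \<and> \<not> Rep_ji w \<le> \<beta> \<and> (\<forall>x\<in>D. Rep_ji z \<le> x \<longrightarrow> Rep_ji w \<le> x)"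
      then obtain w where w: "Rep_ji z \<le> Rep_ji w" "\<not> Rep_ji w \<le> \<beta>" "\<forall>x\<in>D. Rep_ji z \<le> x \<longrightarrow> Rep_ji w \<le> x"
        by blast
      have diff: "?f x \<bullet> (axis z 1 - axis w 1) = (if Rep_ji z \<le> x then 1 else 0) - (if Rep_ji w \<le> x then 1 else 0)" for x
        by (simp only: inner_diff_right f_axis)
      have down: "Rep_ji z \<le> x" if "Rep_ji w \<le> x" for x
        using w(1) that by (rule order_trans)
      then have "axis z 1 - axis w 1 \<in> \<tau>"
        unfolding \<tau> \<sigma> diff using w(3) by auto
      then have "?f \<beta> \<bullet> (axis z 1 - axis w 1) = 0"
        using \<beta> unfolding in_face_sublattice_iff by blast
      then show False
        unfolding diff using z(1) w(2) by simp
    qed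
  qed
  moreover have "D \<subseteq> face_sublattice \<tau>"
    by (auto simp: in_face_sublattice_iff \<tau>)
  ultimately have "face_sublattice \<tau> = D"
    by blast
  then show ?thesis
    using that face by blast
qed


section \<open>The singular locus\<close>

theorem theorem2:
  fixes \<sigma> :: "(real ^ ('l::{finite, distrib_lattice}) ji) set"
    and \<Gamma> :: "(real ^ 'l ji) set \<Rightarrow> 'l set"
  assumes "is_hibi_cone TYPE('k::alg_closed_field) \<sigma>"
    and "\<And>\<tau>. is_cone_face \<tau> \<sigma> \<Longrightarrow> maximal_chain_in (face_sublattice \<tau>) (\<Gamma> \<tau>)"
  defines "S \<equiv> {\<tau>. is_cone_face \<tau> \<sigma> \<and>
      card (G_set (face_sublattice \<tau>) (\<Gamma> \<tau>)) + card (\<Gamma> \<tau>) > card (join_irreducibles :: 'l set)}"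
  shows "singular_locus (hibi_variety :: ('k ^ 'l::{finite, distrib_lattice}) set) =
           (\<Union>\<tau>\<in>S. hibi_subvariety (face_sublattice \<tau>))"
proof -
  let ?X = "hibi_variety :: ('k ^ 'l::{finite, distrib_lattice}) set"
  have ji: "CARD('l ji) = card (join_irreducibles :: 'l set)"
    by (rule type_definition.card[OF type_definition_ji])
  have singular: "q \<in> singular_locus ?X \<longleftrightarrow> q \<in> ?X \<and> vec.dim (tangent_space ?X q) > CARD('l ji)" for q
    unfolding singular_locus_def variety_dim_hibi_variety
    using tangent_dim_ge_card_ji[of q] by auto
  show ?thesis
  proof (intro equalityI subsetI)
    fix q :: "'k ^ 'l::{finite, distrib_lattice}"
    assume "q \<in> singular_locus ?X"
    then have q: "q \<in> ?X" "vec.dim (tangent_space ?X q) > CARD('l ji)"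
      by (simp_all add: singular)
    let ?D = "{x. q $ x \<noteq> 0}"
    obtain \<tau> where \<tau>: "is_cone_face \<tau> \<sigma>" "face_sublattice \<tau> = ?D"
      by (rule embedded_sublattice_is_face_sublattice[OF assms(1) support_embedded_sublattice[OF q(1)]])
    have "maximal_chain_in ?D (\<Gamma> \<tau>)"
      using assms(2)[OF \<tau>(1)] by (simp add: \<tau>(2))
    then obtain R where "card R = card (\<Gamma> \<tau>) + card (G_set ?D (\<Gamma> \<tau>))"
      "determined_by R (linearised_solutions q)" "vec.dim (tangent_space ?X q) = card R"
      by (rule tangent_coordinates_at_point[OF q(1)])
    then have "\<tau> \<in> S"
      using q(2) \<tau> by (simp add: S_def ji)
    moreover have "q \<in> hibi_subvariety (face_sublattice \<tau>)"
      using q(1) by (simp add: \<tau>(2) in_hibi_subvariety_iff in_hibi_variety_iff)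
    ultimately show "q \<in> (\<Union>\<tau>\<in>S. hibi_subvariety (face_sublattice \<tau>))"
      by blast
  next
    fix q :: "'k ^ 'l::{finite, distrib_lattice}"
    assume "q \<in> (\<Union>\<tau>\<in>S. hibi_subvariety (face_sublattice \<tau>))"
    then obtain \<tau> where \<tau>: "is_cone_face \<tau> \<sigma>" "q \<in> hibi_subvariety (face_sublattice \<tau>)"
      "card (\<Gamma> \<tau>) + card (G_set (face_sublattice \<tau>) (\<Gamma> \<tau>)) > CARD('l ji)"
      by (auto simp: S_def ji)
    have D: "embedded_sublattice (face_sublattice \<tau>)"
      by (rule face_sublattice_embedded[OF assms(1) \<tau>(1)])
    then have "q \<in> ?X"
      using hibi_subvariety_subset \<tau>(2) by blast
    moreover have "vec.dim (tangent_space ?X q) > CARD('l ji)"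
      using tangent_dim_on_orbit_closure[OF D assms(2)[OF \<tau>(1)] \<tau>(2)] \<tau>(3) by simp
    ultimately show "q \<in> singular_locus ?X"
      by (simp add: singular)
  qed
qed

end
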